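(* Theta-products give examples of Jacobi cusp forms of critical weight with trivial character for some lattices of all odd ranks $\ge5$; that is, for every odd integer $n\ge5$ there exist a positive definite even lattice $L$ of rank $n$ and a non-zero Jacobi cusp form in $J^{cusp}_{\frac{n+1}2,L}$ which is a theta-product.
   Context: **Jacobi forms of index one.** Let $L$ be a positive definite even lattice with form $(\cdot,\cdot)$ (extended bilinearly to $L\otimes\mathbb C$) and dual $L^\vee$. For $k\in\mathbb Z$, $J_{k,L}$ (index one, trivial character) is the space of holomorphic $\varphi:\mathbb H\times(L\otimes\mathbb C)\to\mathbb C$ such that $\varphi(\frac{a\tau+b}{c\tau+d},\frac{\mathfrak Z}{c\tau+d})=(c\tau+d)^ke^{\pi i\frac{c(\mathfrak Z,\mathfrak Z)}{c\tau+d}}\varphi(\tau,\mathfrak Z)$ for all $\begin{pmatrix}a&b\\c&d\end{pmatrix}\in\mathrm{SL}_2(\mathbb Z)$, $\varphi(\tau,\mathfrak Z+x\tau+y)=e^{-\pi i((x,x)\tau+2(x,\mathfrak Z))}\varphi(\tau,\mathfrak Z)$ for $x,y\in L$, and $\varphi=\sum f(n,l)e^{2\pi i(n\tau+(l,\mathfrak Z))}$ with the sum over integers $n\ge0$ and $l\in L^\vee$ with $2n-(l,l)\ge0$. $J^{cusp}_{k,L}$ is the subspace of $\varphi$ with $f(n,l)\ne0$ only for $2n-(l,l)>0$. The critical weight for $L$ is $\frac{\mathrm{rank}L+1}2$. **Theta-products.** $\vartheta(\tau,z)=\sum_{n\in\mathbb Z}\left(\frac{-4}n\right)e^{2\pi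 i(\frac{n^2}8\tau+\frac n2z)}$, where $\left(\frac{-4}n\right)$ is $1,-1,0$ for $n\equiv1\bmod4$, $n\equiv3\bmod4$, $n$ even; $\eta$ is the Dedekind eta function; $\vartheta_{3/2}(\tau,z)=\eta(\tau)\vartheta(\tau,2z)/\vartheta(\tau,z)$. A theta-product on $\mathbb H\times(L\otimes\mathbb C)$ is a finite product of functions $\vartheta(\tau,\ell(\mathfrak Z))$ and $\vartheta_{3/2}(\tau,\ell(\mathfrak Z))$, with $\ell$ linear forms on $L\otimes\mathbb C$, times an integral (possibly negative) power of $\eta(\tau)$. *)

theory Defs
  imports "HOL-Complex_Analysis.Complex_Analysis"
begin

text \<open>
  A lattice \<open>L\<close> of rank \<open>CARD('n)\<close> is given in coordinates with respect to a \<open>\<int>\<close>-basis: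
  \<open>L\<close> is \<open>int ^ 'n\<close>, its form is given by the Gram matrix \<open>G\<close> of the basis, and
  \<open>L \<otimes> \<real>\<close> and \<open>L \<otimes> \<complex>\<close> are \<open>real ^ 'n\<close> and \<open>complex ^ 'n\<close>.
  The polymorphic \<open>lform G\<close> is the form on \<open>L\<close> together with its bilinear (not sesquilinear)
  extensions.
\<close>

definition lform :: "int ^ 'n ^ 'n \<Rightarrow> 'a::comm_ring_1 ^ 'n \<Rightarrow> 'a ^ 'n \<Rightarrow> 'a" where
  "lform G v w = (\<Sum>i\<in>UNIV. \<Sum>j\<in>UNIV. of_int (G $ i $ j) * v $ i * w $ j)"

definition vec_of_int :: "int ^ 'n \<Rightarrow> 'a::ring_1 ^ 'n" where
  "vec_of_int x = (\<chi> i. of_int (x $ i))"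

definition vec_of_real :: "real ^ 'n \<Rightarrow> complex ^ 'n" where
  "vec_of_real x = (\<chi> i. complex_of_real (x $ i))"

definition pos_def_even_lattice :: "int ^ 'n ^ 'n \<Rightarrow> bool" where
  "pos_def_even_lattice G \<longleftrightarrow>
     transpose G = G \<and>
     (\<forall>x :: real ^ 'n. x \<noteq> 0 \<longrightarrow> lform G x x > 0) \<and>
     (\<forall>x :: int ^ 'n. even (lform G x x))"

definition dual_lattice :: "int ^ 'n ^ 'n \<Rightarrow> (real ^ 'n) set" where
  "dual_lattice G = {l. \<forall>x :: int ^ 'n. lform G l (vec_of_int x) \<in> \<int>}"

text \<open>
  Functions on \<open>\<H> \<times> (L \<otimes> \<complex>)\<close> are represented by total functions
  \<open>complex \<Rightarrow> complex ^ 'n \<Rightarrow> complex\<close>; all conditions below only involve the values at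
  arguments with first component in \<open>\<H>\<close>.
\<close>

definition upper_half_plane :: "complex set"  (\<open>\<H>\<close>) where
  "\<H> = {\<tau>. Im \<tau> > 0}"

text \<open>
  Holomorphy in several variables: complex differentiability, that is, the existence at every
  point of a Frechet derivative which is complex-linear.
\<close>

definition holomorphic_on_HxV :: "(complex \<Rightarrow> complex ^ 'n \<Rightarrow> complex) \<Rightarrow> bool" where
  "holomorphic_on_HxV \<phi> \<longleftrightarrow>
     (\<forall>\<tau>\<in>\<H>. \<forall>Z. \<exists>D. ((\<lambda>(t, W). \<phi> t W) has_derivative D) (at (\<tau>, Z)) \<and>
        (\<forall>c t W. D (c * t, c *s W) = c * D (t, W)))"

text \<open>
  The Fourier coefficient \<open>f(n, l)\<close> is constrained only on the index set of the sum; the values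
  of \<open>f\<close> elsewhere are irrelevant.
\<close>

definition jacobi_index_set :: "int ^ 'n ^ 'n \<Rightarrow> (nat \<times> (real ^ 'n)) set" where
  "jacobi_index_set G = {(n, l). l \<in> dual_lattice G \<and> 2 * real n - lform G l l \<ge> 0}"

definition has_jacobi_fourier_expansion ::
    "int ^ 'n ^ 'n \<Rightarrow> (complex \<Rightarrow> complex ^ 'n \<Rightarrow> complex) \<Rightarrow> (nat \<Rightarrow> real ^ 'n \<Rightarrow> complex) \<Rightarrow> bool" where
  "has_jacobi_fourier_expansion G \<phi> f \<longleftrightarrow>
     (\<forall>\<tau>\<in>\<H>. \<forall>Z.
        ((\<lambda>(n, l). f n l * exp (2 * of_real pi * \<i> * (of_nat n * \<tau> + lform G (vec_of_real l) Z)))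
           has_sum \<phi> \<tau> Z) (jacobi_index_set G))"

definition jacobi_forms ::
    "int \<Rightarrow> int ^ 'n ^ 'n \<Rightarrow> (complex \<Rightarrow> complex ^ 'n \<Rightarrow> complex) set" where
  "jacobi_forms k G = {\<phi>.
     holomorphic_on_HxV \<phi> \<and>
     (\<forall>a b c d :: int. a * d - b * c = 1 \<longrightarrow> (\<forall>\<tau>\<in>\<H>. \<forall>Z.
        \<phi> ((of_int a * \<tau> + of_int b) / (of_int c * \<tau> + of_int d))
          (inverse (of_int c * \<tau> + of_int d) *s Z)
        = (of_int c * \<tau> + of_int d) powi k
          * exp (of_real pi * \<i> * (of_int c * lform G Z Z / (of_int c * \<tau> + of_int d)))
          * \<phi> \<tau> Z)) \<and>
     (\<forall>x y :: int ^ 'n. \<forall>\<tau>\<in>\<H>. \<forall>Z.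
        \<phi> \<tau> (Z + \<tau> *s vec_of_int x + vec_of_int y)
        = exp (- (of_real pi * \<i> * (of_int (lform G x x) * \<tau> + 2 * lform G (vec_of_int x) Z)))
          * \<phi> \<tau> Z) \<and>
     (\<exists>f. has_jacobi_fourier_expansion G \<phi> f)}"

text \<open>
  The Fourier coefficients on the index set are determined by the function, so
  the existential quantifier below refers to the Fourier coefficients of \<open>\<phi>\<close>.
\<close>

definition jacobi_cusp_forms ::
    "int \<Rightarrow> int ^ 'n ^ 'n \<Rightarrow> (complex \<Rightarrow> complex ^ 'n \<Rightarrow> complex) set" where
  "jacobi_cusp_forms k G = {\<phi> \<in> jacobi_forms k G.
     \<exists>f. has_jacobi_fourier_expansion G \<phi> f \<and>
         (\<forall>(n, l)\<in>jacobi_index_set G. f n l \<noteq> 0 \<longrightarrow> 2 * real n - lform G l l > 0)}"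

definition kronecker_m4 :: "int \<Rightarrow> complex" where
  "kronecker_m4 n = (if n mod 4 = 1 then 1 else if n mod 4 = 3 then -1 else 0)"

definition jtheta :: "complex \<Rightarrow> complex \<Rightarrow> complex" where
  "jtheta \<tau> z = (\<Sum>\<^sub>\<infinity>n::int.
     kronecker_m4 n * exp (2 * of_real pi * \<i> * (of_int n ^ 2 / 8 * \<tau> + of_int n / 2 * z)))"

definition dedekind_eta :: "complex \<Rightarrow> complex" where
  "dedekind_eta \<tau> = exp (2 * of_real pi * \<i> * \<tau> / 24) *
     (\<Prod>n. 1 - exp (2 * of_real pi * \<i> * of_nat (Suc n) * \<tau>))"

text \<open>
  The quotient \<open>\<eta>(\<tau>) \<vartheta>(\<tau>, 2z) / \<vartheta>(\<tau>, z)\<close> has removable singularities at the zeros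
  \<open>\<int>\<tau> + \<int>\<close> of the denominator. Since division by zero yields zero in HOL, the
  holomorphic extension has to be taken explicitly.
\<close>

definition jtheta_3_2 :: "complex \<Rightarrow> complex \<Rightarrow> complex" where
  "jtheta_3_2 \<tau> = remove_sings (\<lambda>z. dedekind_eta \<tau> * jtheta \<tau> (2 * z) / jtheta \<tau> z)"

definition linear_form :: "(complex ^ 'n \<Rightarrow> complex) \<Rightarrow> bool" where
  "linear_form \<l> \<longleftrightarrow> Vector_Spaces.linear (*s) (*) \<l>"

definition theta_product :: "(complex \<Rightarrow> complex ^ 'n \<Rightarrow> complex) \<Rightarrow> bool" where
  "theta_product \<phi> \<longleftrightarrow>
     (\<exists>ls ms :: (complex ^ 'n \<Rightarrow> complex) list. \<exists>e :: int.
        (\<forall>\<l>\<in>set ls \<union> set ms. linear_form \<l>) \<and>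
        (\<forall>\<tau>\<in>\<H>. \<forall>Z. \<phi> \<tau> Z =
           (\<Prod>\<l>\<leftarrow>ls. jtheta \<tau> (\<l> Z)) * (\<Prod>\<l>\<leftarrow>ms. jtheta_3_2 \<tau> (\<l> Z)) * dedekind_eta \<tau> powi e))"

end

theory Submission
  imports Defs "HOL-Probability.Characteristic_Functions"
begin

text \<open>
  All lattices below are diagonal: \<open>L = \<int>\<^sup>n\<close> with form \<open>\<Sum> g\<^sub>i x\<^sub>i\<^sup>2\<close> and even positive \<open>g\<^sub>i\<close>.

  The cusp forms come from theta-products of singular weight. A form of weight \<open>rank / 2\<close> has
  nonzero Fourier coefficients only at \<open>2n = (l, l)\<close>. Restricting it from rank \<open>n + 1\<close> to a sublattice
  of rank \<open>n\<close> keeps the weight, which is now the critical weight \<open>(n + 1) / 2\<close>, and projects \<open>l\<close>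
  orthogonally onto the hyperplane spanned by the sublattice; the hyperbolic norm \<open>2n - (l, l)\<close> of a
  coefficient becomes the squared distance of \<open>l\<close> from that hyperplane. Hence the restriction is a
  cusp form as soon as no vector \<open>l\<close> with nonzero coefficient lies on the hyperplane.

  The building blocks of singular weight are \<open>\<vartheta>(z)\<close> and \<open>\<vartheta>\<^sub>3\<^sub>/\<^sub>2(z)\<close> (rank 1, weight 1/2, multiplier systems
  \<open>v\<^sub>\<eta>\<^sup>3\<close> and \<open>v\<^sub>\<eta>\<close>) and the theta quark \<open>\<vartheta>(z) \<vartheta>(w) \<vartheta>(z + w) / \<eta>\<close> (rank 2, weight 1, \<open>v\<^sub>\<eta>\<^sup>8\<close>). The quark
  has the terms \<open>q\<close> to the power \<open>(l\<^sup>2 - l m + m\<^sup>2) / 3\<close> times \<open>\<zeta>\<^sub>z\<^sup>l \<zeta>\<^sub>w\<^sup>m\<close>, with zero coefficient whenever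
  \<open>3\<close> divides \<open>l + m\<close>. On the line \<open>w = 2 z\<close> a term has hyperbolic norm zero only if \<open>5 l = 4 m\<close>, and then
  \<open>3\<close> divides \<open>l + m\<close>; so \<open>\<vartheta>(z) \<vartheta>(2z) \<vartheta>(3z) / \<eta>\<close> has critical weight 1 and positive hyperbolic norms.
  Multiplying this cuspidal quark by blocks in further variables adds 1/2 to the weight for each new
  variable and keeps it cuspidal. It remains to make the multiplier system trivial, that is, to make
  the exponent of \<open>v\<^sub>\<eta>\<close> divisible by 24. For \<open>n = 5\<close> two more quarks do it, as \<open>3 * 8 = 24\<close>
  (\<open>cusp_form_rank_5\<close>). For odd \<open>n \<ge> 7\<close> one takes \<open>b\<close> factors \<open>\<vartheta>\<close> and \<open>n - 1 - b\<close> factors \<open>\<vartheta>\<^sub>3\<^sub>/\<^sub>2\<close> with a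
  suitable \<open>b < 12\<close> (\<open>cusp_form_rank_ge_7\<close>).

  The Fourier expansions come from Euler's pentagonal number theorem: multiplying out a product of
  theta series and fixing the powers of the elliptic variables leaves a shifted copy of Euler's series
  for \<open>\<eta>\<close> as inner sum (\<open>three_jtheta_has_sum\<close>, \<open>jtheta_times_quintuple_theta\<close>). Behaviour under
  \<open>\<tau> \<mapsto> -1/\<tau>\<close> comes from Poisson summation for Gaussians and the identity theorem
  (\<open>theta_S_transform\<close>). Invariance under \<open>\<tau> \<mapsto> \<tau> + 1\<close> and under integral translations can be read off
  the Fourier expansion, and translations by \<open>\<lambda> \<tau>\<close> are conjugate to integral ones under the inversion
  (\<open>jacobi_cusp_form_of_block\<close>).
\<close>

no_notation fps_nth (infixl \<open>$\<close> 75)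

section \<open>Theta series in two variables\<close>

text \<open>
  With bounded coefficients and rescaled arguments this one series covers \<open>\<vartheta>\<close>, \<open>\<vartheta>\<^sub>3\<^sub>/\<^sub>2\<close>, \<open>\<eta>\<close> and the
  classical theta function, so that convergence and holomorphy are proved only once.
\<close>

definition theta_series :: "(int \<Rightarrow> complex) \<Rightarrow> complex \<Rightarrow> complex \<Rightarrow> complex" where
  "theta_series c \<tau> z = (\<Sum>\<^sub>\<infinity>n. c n * exp (of_real pi * \<i> * (of_int n ^ 2 * \<tau> + 2 * of_int n * z)))"

lemma summable_on_int_of_halves:
  fixes f :: "int \<Rightarrow> real"
  assumes "summable (\<lambda>n. norm (f (int n)))" "summable (\<lambda>n. norm (f (- int n)))"
  shows "f summable_on UNIV"
proof -
  have 1: "f summable_on range int"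
    by (subst summable_on_reindex) (auto simp: o_def intro!: norm_summable_imp_summable_on assms)
  have 2: "f summable_on range (\<lambda>n. - int n)"
    by (subst summable_on_reindex) (auto simp: o_def inj_def intro!: norm_summable_imp_summable_on assms)
  have "f summable_on (range int \<union> (range (\<lambda>n. - int n) - range int))"
    by (intro summable_on_Un_disjoint 1 summable_on_subset_banach[OF 2]) auto
  also have "range int \<union> (range (\<lambda>n. - int n) - range int) = UNIV"
  proof -
    have "x \<in> range int \<union> range (\<lambda>n. - int n)" for x
      by (cases x rule: int_cases2) auto
    thus ?thesis by blast
  qed
  finally show ?thesis .
qed

text \<open>
  The factor \<open>(1 + |n|)\<^sup>2\<close> leaves room for the first derivatives of theta series in both variables.
\<close>

lemma summable_on_gaussian:
  fixes a b :: real
  assumes "a > 0"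
  shows "(\<lambda>n::int. (1 + \<bar>of_int n\<bar>)\<^sup>2 * exp (b * \<bar>of_int n\<bar> - a * of_int n ^ 2)) summable_on UNIV"
proof -
  \<comment> \<open>After \<open>1 + x \<le> exp x\<close> and splitting off \<open>exp (-x)\<close>, the exponent \<open>(b + 3) x - a x\<^sup>2\<close> remains; \<open>C\<close> bounds it.\<close>
  define C where "C = exp ((b + 3)\<^sup>2 / (4 * a))"
  have bound: "(1 + x)\<^sup>2 * exp (b * x - a * x\<^sup>2) \<le> C * exp (-1) ^ n" if "x = real n" for x n
  proof -
    have "(1 + x)\<^sup>2 \<le> exp x ^ 2"
      using that by (intro power_mono) (auto simp: exp_ge_add_one_self)
    also have "exp x ^ 2 = exp (2 * x)"
      by (simp add: exp_double)
    finally have "(1 + x)\<^sup>2 * exp (b * x - a * x\<^sup>2) \<le> exp (2 * x) * exp (b * x - a * x\<^sup>2)"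
      by (intro mult_right_mono) auto
    also have "\<dots> = exp ((b + 3) * x - a * x\<^sup>2 - x)"
      by (simp add: exp_add [symmetric] algebra_simps)
    also have "(b + 3) * x - a * x\<^sup>2 \<le> (b + 3)\<^sup>2 / (4 * a)"
    proof -
      have "0 \<le> (2 * a * x - (b + 3))\<^sup>2 / (4 * a)" using assms by simp
      also have "\<dots> = a * x\<^sup>2 - (b + 3) * x + (b + 3)\<^sup>2 / (4 * a)"
        using assms by (simp add: field_simps power2_eq_square)
      finally show ?thesis by simp
    qed
    hence "exp ((b + 3) * x - a * x\<^sup>2 - x) \<le> exp ((b + 3)\<^sup>2 / (4 * a) - x)"
      by simp
    also have "\<dots> = C * exp (-x)"
      by (simp add: C_def exp_diff exp_minus field_simps)
    also have "exp (-x) = exp (-1) ^ n"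
      using that by (simp add: exp_of_nat_mult [symmetric])
    finally show ?thesis .
  qed
  have S: "summable (\<lambda>n. C * exp (-1::real) ^ n)"
    by (intro summable_mult summable_geometric) auto
  have "summable (\<lambda>n. norm ((1 + \<bar>real n\<bar>)\<^sup>2 * exp (b * \<bar>real n\<bar> - a * real n ^ 2)))"
    by (rule summable_comparison_test[OF _ S]) (use bound in \<open>auto simp: abs_mult\<close>)
  thus ?thesis
    by (intro summable_on_int_of_halves) auto
qed

lemma theta_term_norm:
  "norm (exp (of_real pi * \<i> * (of_int n ^ 2 * \<tau> + 2 * of_int n * z))) =
     exp (- pi * (of_int n ^ 2 * Im \<tau> + 2 * of_int n * Im z))"
proof -
  have "of_int n ^ 2 = complex_of_real (of_int n ^ 2)" by simp
  thus ?thesis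
    by (simp add: norm_exp_eq_Re del: of_real_power of_int_power)
qed

lemma theta_term_bound:
  assumes "Im \<tau> \<ge> \<delta>" "\<bar>Im z\<bar> \<le> R"
  shows "norm (exp (of_real pi * \<i> * (of_int n ^ 2 * \<tau> + 2 * of_int n * z))) \<le>
     exp (2 * pi * R * \<bar>of_int n\<bar> - pi * \<delta> * of_int n ^ 2)"
proof -
  have "of_int n ^ 2 * \<delta> \<le> of_int n ^ 2 * Im \<tau>"
    using assms by (intro mult_left_mono) auto
  moreover have "- (of_int n * Im z) \<le> \<bar>of_int n\<bar> * R"
  proof -
    have "- (of_int n * Im z) \<le> \<bar>of_int n * Im z\<bar>" by simp
    also have "\<dots> \<le> \<bar>of_int n\<bar> * R"
      unfolding abs_mult using assms by (intro mult_left_mono) auto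
    finally show ?thesis .
  qed
  ultimately have "- (of_int n ^ 2 * Im \<tau> + 2 * of_int n * Im z) \<le> 2 * R * \<bar>of_int n\<bar> - \<delta> * of_int n ^ 2"
    by (simp add: algebra_simps)
  hence "pi * - (of_int n ^ 2 * Im \<tau> + 2 * of_int n * Im z) \<le> pi * (2 * R * \<bar>of_int n\<bar> - \<delta> * of_int n ^ 2)"
    by (intro mult_left_mono) auto
  thus ?thesis
    unfolding theta_term_norm by (simp add: algebra_simps)
qed

lemma summable_on_int_comparison:
  fixes f :: "int \<Rightarrow> complex"
  assumes "g summable_on UNIV" "\<And>n. norm (f n) \<le> g n"
  shows "f summable_on UNIV"
proof -
  have "(\<lambda>n. norm (g n)) summable_on UNIV"
    using assms(1) summable_on_iff_abs_summable_on_real by blast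
  hence "(\<lambda>n. norm (f n)) summable_on UNIV"
    by (rule Infinite_Sum.abs_summable_on_comparison_test) (use assms(2) in \<open>auto intro: order.trans[OF _ abs_ge_self]\<close>)
  thus ?thesis by (rule abs_summable_summable)
qed

lemma theta_series_has_sum:
  assumes c: "\<And>n. norm (c n) \<le> 1" and "Im \<tau> > 0"
  shows "((\<lambda>n. c n * exp (of_real pi * \<i> * (of_int n ^ 2 * \<tau> + 2 * of_int n * z))) has_sum theta_series c \<tau> z) UNIV"
proof -
  have "(\<lambda>n. c n * exp (of_real pi * \<i> * (of_int n ^ 2 * \<tau> + 2 * of_int n * z))) summable_on UNIV"
  proof (rule summable_on_int_comparison[OF summable_on_gaussian])
    show "pi * Im \<tau> > 0" using assms by simp
    fix n :: int
    have "norm (c n * exp (of_real pi * \<i> * (of_int n ^ 2 * \<tau> + 2 * of_int n * z))) \<le>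
      (1 + \<bar>of_int n\<bar>)\<^sup>2 * exp (2 * pi * \<bar>Im z\<bar> * \<bar>of_int n\<bar> - pi * Im \<tau> * of_int n ^ 2)"
      unfolding norm_mult
    proof (rule mult_mono)
      have "norm (c n) \<le> 1 ^ 2" using c by simp
      also have "1 ^ 2 \<le> (1 + \<bar>real_of_int n\<bar>)\<^sup>2" by (intro power_mono) auto
      finally show "norm (c n) \<le> (1 + \<bar>real_of_int n\<bar>)\<^sup>2" .
    qed (intro theta_term_bound, auto)
    thus "norm (c n * exp (of_real pi * \<i> * (of_int n ^ 2 * \<tau> + 2 * of_int n * z))) \<le>
      (1 + \<bar>of_int n\<bar>)\<^sup>2 * exp ((2 * pi * \<bar>Im z\<bar>) * \<bar>of_int n\<bar> - (pi * Im \<tau>) * of_int n ^ 2)" .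
  qed
  thus ?thesis
    unfolding theta_series_def by (rule has_sum_infsum)
qed

lemma has_sum_int_imp_sums:
  fixes f :: "int \<Rightarrow> 'a :: {topological_comm_monoid_add, t2_space}"
  assumes "(f has_sum S) UNIV"
  shows "(\<lambda>n. f (int_decode n)) sums S"
  using has_sum_reindex_bij_betw[of int_decode UNIV UNIV f S] assms
  by (intro has_sum_imp_sums) (simp add: bij_int_decode)

text \<open>
  Termwise differentiation: on the convex open set of all \<open>(t, w)\<close> with \<open>Im t > \<delta>\<close> and \<open>|Im w| < R\<close> the
  derivatives of the terms are dominated by one summable Gaussian sequence. Joint differentiability
  is what holomorphy on \<open>\<H> \<times> V\<close> asks for.
\<close>

lemma theta_series_has_derivative:
  assumes c: "\<And>n. norm (c n) \<le> 1" and "Im \<tau> > 0"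
  shows "\<exists>p q. ((\<lambda>(t, w). theta_series c t w) has_derivative (\<lambda>(h, k). p * h + q * k)) (at (\<tau>, z))"
proof -
  define \<delta> where "\<delta> = Im \<tau> / 2"
  define R where "R = \<bar>Im z\<bar> + 1"
  have "\<delta> > 0" using assms by (simp add: \<delta>_def)
  define S where "S = {t. Im t > \<delta>} \<times> ({w. Im w < R} \<inter> {w. Im w > -R})"
  have "convex S"
    unfolding S_def by (intro convex_Times convex_Int convex_halfspace_Im_gt convex_halfspace_Im_lt)
  have "open S"
    unfolding S_def by (intro open_Times open_Int open_halfspace_Im_gt open_halfspace_Im_lt)
  have "(\<tau>, z) \<in> S"
    using assms by (auto simp: S_def \<delta>_def R_def)
  define E where "E = (\<lambda>n (t, w). exp (of_real pi * \<i> * (of_int n ^ 2 * t + 2 * of_int n * w)))"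
  define M where "M = (\<lambda>n::int. pi * ((1 + \<bar>of_int n\<bar>)\<^sup>2 * exp ((2 * pi * R) * \<bar>of_int n\<bar> - (pi * \<delta>) * of_int n ^ 2)))"
  define P where "P = (\<lambda>n x. c n * (of_real pi * \<i> * of_int n ^ 2) * E n x)"
  define Q where "Q = (\<lambda>n x. c n * (2 * of_real pi * \<i> * of_int n) * E n x)"
  have E_bound: "norm (E n x) \<le> exp ((2 * pi * R) * \<bar>of_int n\<bar> - (pi * \<delta>) * of_int n ^ 2)" if "x \<in> S" for n x
    proof (cases x)
    case (Pair t w)
    have "norm (E n x) \<le> exp (2 * pi * R * \<bar>of_int n\<bar> - pi * \<delta> * of_int n ^ 2)"
      unfolding E_def Pair prod.case using that Pair by (intro theta_term_bound) (auto simp: S_def)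
    thus ?thesis by simp
  qed
  have M_sum: "M summable_on UNIV"
    unfolding M_def using \<open>\<delta> > 0\<close> by (intro summable_on_cmult_right summable_on_gaussian) auto
  hence "(M has_sum infsum M UNIV) UNIV" by simp
  from has_sum_int_imp_sums[OF this] have M_summable: "summable (\<lambda>n. M (int_decode n))"
    by (simp add: sums_iff)
  have PQ_bound: "norm (P n x * h + Q n x * k) \<le> M n * norm (h, k)" if "x \<in> S" for n x h k
  proof -
    have hk: "norm h \<le> norm (h, k)" "norm k \<le> norm (h, k)"
      by (metis norm_fst_le fst_conv, metis norm_snd_le snd_conv)
    have "norm (of_int n ^ 2 * h + 2 * of_int n * k) \<le> of_int n ^ 2 * norm h + 2 * \<bar>of_int n\<bar> * norm k"
      by (rule order.trans[OF norm_triangle_ineq]) (simp add: norm_mult norm_power)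
    also have "\<dots> \<le> of_int n ^ 2 * norm (h, k) + 2 * \<bar>of_int n\<bar> * norm (h, k)"
      using hk by (intro add_mono mult_left_mono) auto
    also have "\<dots> \<le> (1 + \<bar>of_int n\<bar>)\<^sup>2 * norm (h, k)"
      unfolding ring_distribs(2)[symmetric]
      by (intro mult_right_mono) (auto simp: power2_eq_square algebra_simps)
    finally have *: "norm (of_int n ^ 2 * h + 2 * of_int n * k) \<le> (1 + \<bar>of_int n\<bar>)\<^sup>2 * norm (h, k)" .
    have "P n x * h + Q n x * k = (of_real pi * \<i> * c n) * (of_int n ^ 2 * h + 2 * of_int n * k) * E n x"
      by (simp add: P_def Q_def algebra_simps)
    also have "norm \<dots> = pi * norm (c n) * norm (of_int n ^ 2 * h + 2 * of_int n * k) * norm (E n x)"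
      by (simp add: norm_mult)
    also have "\<dots> \<le> pi * 1 * ((1 + \<bar>of_int n\<bar>)\<^sup>2 * norm (h, k)) * exp ((2 * pi * R) * \<bar>of_int n\<bar> - (pi * \<delta>) * of_int n ^ 2)"
      using c * E_bound[OF that] by (intro mult_mono) auto
    finally show ?thesis by (simp add: M_def algebra_simps)
  qed
  have P_bound: "norm (P n x) \<le> M n" and Q_bound: "norm (Q n x) \<le> M n" if "x \<in> S" for n x
    using PQ_bound[OF that, of n 1 0] PQ_bound[OF that, of n 0 1] by (simp_all add: norm_Pair)
  have summ: "summable (\<lambda>n. P (int_decode n) x)" "summable (\<lambda>n. Q (int_decode n) x)" if "x \<in> S" for x
    by (rule summable_comparison_test'[OF M_summable], use P_bound[OF that] in simp,
        rule summable_comparison_test'[OF M_summable], use Q_bound[OF that] in simp)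
  define p where "p = (\<lambda>x. \<Sum>n. P (int_decode n) x)"
  define q where "q = (\<lambda>x. \<Sum>n. Q (int_decode n) x)"
  define D where "D = (\<lambda>x (h, k). p x * h + q x * k)"
  have sums: "(\<lambda>n. c (int_decode n) * E (int_decode n) x) sums (case x of (t, w) \<Rightarrow> theta_series c t w)"
    if "x \<in> S" for x
  proof (cases x)
    case (Pair t w)
    have "Im t > 0" using that \<open>\<delta> > 0\<close> Pair by (auto simp: S_def)
    from has_sum_int_imp_sums[OF theta_series_has_sum[OF c this, where z = w]]
    show ?thesis by (simp add: Pair E_def)
  qed
  have "\<exists>g. \<forall>x\<in>S. (\<lambda>n. c (int_decode n) * E (int_decode n) x) sums g x \<and>
          (g has_derivative D x) (at x within S)"
  proof (rule has_derivative_series)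
    show "convex S" "(\<tau>, z) \<in> S" by fact+
    show "(\<lambda>n. c (int_decode n) * E (int_decode n) (\<tau>, z)) sums (theta_series c \<tau> z)"
      using sums[OF \<open>(\<tau>, z) \<in> S\<close>] by simp
  next
    fix n x assume "x \<in> S"
    show "((\<lambda>x. c (int_decode n) * E (int_decode n) x) has_derivative
            (\<lambda>(h,k). P (int_decode n) x * h + Q (int_decode n) x * k)) (at x within S)"
    proof -
      let ?m = "of_int (int_decode n) :: complex"
      have "((\<lambda>x. of_real pi * \<i> * (?m ^ 2 * fst x + 2 * ?m * snd x)) has_derivative
              (\<lambda>x. of_real pi * \<i> * (?m ^ 2 * fst x + 2 * ?m * snd x))) (at x within S)"
        by (auto intro!: derivative_eq_intros)
      from has_derivative_compose[OF this DERIV_exp[unfolded has_field_derivative_def]]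
      have "((\<lambda>x. c (int_decode n) * exp (of_real pi * \<i> * (?m ^ 2 * fst x + 2 * ?m * snd x))) has_derivative
              (\<lambda>h. c (int_decode n) * (exp (of_real pi * \<i> * (?m ^ 2 * fst x + 2 * ?m * snd x)) *
                (of_real pi * \<i> * (?m ^ 2 * fst h + 2 * ?m * snd h))))) (at x within S)"
        by (intro has_derivative_mult_right)
      thus ?thesis
        unfolding E_def P_def Q_def case_prod_unfold by (simp add: algebra_simps)
    qed
  next
    fix e :: real assume "e > 0"
    from suminf_exist_split[OF this M_summable] obtain N
      where N: "\<And>n. n \<ge> N \<Longrightarrow> norm (\<Sum>i. M (int_decode (i + n))) < e" by blast
    show "\<forall>\<^sub>F n in sequentially. \<forall>x\<in>S. \<forall>h. norm ((\<Sum>i<n. (\<lambda>(h,k). P (int_decode i) x * h + Q (int_decode i) x * k) h) - D x h) \<le> e * norm h"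
    proof (rule eventually_sequentiallyI[of N], safe)
      fix n x h k assume n: "n \<ge> N" and x: "x \<in> S"
      let ?F = "\<lambda>i. P (int_decode i) x * h + Q (int_decode i) x * k"
      have F: "?F sums (p x * h + q x * k)"
        unfolding p_def q_def by (intro sums_add sums_mult2 summable_sums summ x)
      have "(\<Sum>i<n. ?F i) - (p x * h + q x * k) = -(\<Sum>i. ?F (i + n))"
        using suminf_split_initial_segment[of ?F n] F by (simp add: sums_iff)
      also have "norm \<dots> \<le> (\<Sum>i. M (int_decode (i + n)) * norm (h, k))"
        unfolding norm_minus_cancel
        by (rule norm_suminf_le) (auto intro!: PQ_bound x summable_mult2 summable_ignore_initial_segment M_summable)
      also have "\<dots> = (\<Sum>i. M (int_decode (i + n))) * norm (h, k)"
        by (intro suminf_mult2[symmetric] summable_ignore_initial_segment M_summable)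
      also have "\<dots> \<le> e * norm (h, k)"
        using N[OF n] by (intro mult_right_mono) auto
      finally show "norm ((\<Sum>i<n. ?F i) - D x (h, k)) \<le> e * norm (h, k)" by (simp add: D_def)
    qed
  qed
  then obtain g where g: "\<forall>x\<in>S. (\<lambda>n. c (int_decode n) * E (int_decode n) x) sums g x \<and>
          (g has_derivative D x) (at x within S)" ..
  have "(g has_derivative D (\<tau>, z)) (at (\<tau>, z))"
    by (rule bspec[OF g \<open>(\<tau>, z) \<in> S\<close>, THEN conjunct2, unfolded at_within_open[OF \<open>(\<tau>, z) \<in> S\<close> \<open>open S\<close>]])
  hence "((\<lambda>(t, w). theta_series c t w) has_derivative D (\<tau>, z)) (at (\<tau>, z))"
    by (rule has_derivative_transform_within_open[OF _ \<open>open S\<close> \<open>(\<tau>, z) \<in> S\<close>])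
       (rule sums_unique2[OF bspec[OF g, THEN conjunct1] sums])
  thus ?thesis unfolding D_def by blast
qed

section \<open>The pentagonal number theorem\<close>

text \<open>
  Shanks' finite form of the pentagonal number theorem. From \<open>n\<close> to \<open>n + 1\<close> the summands on the left
  change by a telescoping difference, which together with the new last summand gives the two new
  terms on the right. The exponents use the triangular numbers \<open>\<Sum>{..j}\<close> to avoid division.
\<close>

lemma shanks_identity:
  fixes q :: "'a :: comm_ring_1"
  shows "(\<Sum>s\<le>n. (-1) ^ s * (\<Prod>i\<in>{s<..n}. 1 - q ^ i) * q ^ (s * n + \<Sum>{..s})) =
           1 + (\<Sum>j<n. (-1) ^ Suc j * (q ^ (Suc j ^ 2 + \<Sum>{..j}) + q ^ (Suc j ^ 2 + \<Sum>{..Suc j})))"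
proof (induction n)
  case (Suc m)
  define R where "R = (\<lambda>n s. \<Prod>i\<in>{s<..n}. 1 - q ^ i)"
  \<comment> \<open>The partial sums, up to \<open>s\<close>, of the differences between the summands for \<open>m + 1\<close> and for \<open>m\<close>.\<close>
  define U where "U = (\<lambda>s. (-1) ^ Suc s * R m s * q ^ (Suc s * Suc m + \<Sum>{..s}))"
  have R_Suc: "R (Suc m) s = (1 - q ^ Suc m) * R m s" if "s \<le> m" for s
  proof -
    have "{s<..Suc m} = insert (Suc m) {s<..m}" using that by auto
    thus ?thesis by (simp add: R_def)
  qed
  have R_Suc': "R m s = (1 - q ^ Suc s) * R m (Suc s)" if "Suc s \<le> m" for s
  proof -
    have "{s<..m} = insert (Suc s) {Suc s<..m}" using that by auto
    thus ?thesis by (simp add: R_def)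
  qed
  have step: "(\<Sum>s\<le>k. (-1) ^ s * R (Suc m) s * q ^ (s * Suc m + \<Sum>{..s}) - (-1) ^ s * R m s * q ^ (s * m + \<Sum>{..s})) = U k"
    if "k \<le> m" for k
    using that
  proof (induction k)
    case 0
    show ?case by (simp add: R_Suc U_def algebra_simps)
  next
    case (Suc k)
    define X y w r \<sigma> where "X = q ^ (Suc k * Suc m + \<Sum>{..k})" and "y = q ^ Suc k" and "w = q ^ Suc m"
      and "r = R m (Suc k)" and "\<sigma> = (-1 :: 'a) ^ Suc k"
    have "U k = \<sigma> * ((1 - y) * r) * X"
      using Suc.prems by (simp only: U_def R_Suc' X_def y_def r_def \<sigma>_def)
    moreover have "U (Suc k) = - \<sigma> * r * (X * y * w)"
    proof -
      have "q ^ (Suc (Suc k) * Suc m + \<Sum>{..Suc k}) = X * y * w"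
        unfolding X_def y_def w_def power_add [symmetric] by (simp add: algebra_simps)
      thus ?thesis by (simp add: U_def r_def \<sigma>_def)
    qed
    moreover have "(-1) ^ Suc k * R (Suc m) (Suc k) * q ^ (Suc k * Suc m + \<Sum>{..Suc k}) = \<sigma> * ((1 - w) * r) * (X * y)"
    proof -
      have "q ^ (Suc k * Suc m + \<Sum>{..Suc k}) = X * y"
        unfolding X_def y_def power_add [symmetric] by (simp add: algebra_simps)
      thus ?thesis using Suc.prems by (simp only: R_Suc w_def r_def \<sigma>_def)
    qed
    moreover have "(-1) ^ Suc k * R m (Suc k) * q ^ (Suc k * m + \<Sum>{..Suc k}) = \<sigma> * r * X"
    proof -
      have "q ^ (Suc k * m + \<Sum>{..Suc k}) = X"
        unfolding X_def by (rule arg_cong[of _ _ "(^) q"]) simp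
      thus ?thesis by (simp only: r_def \<sigma>_def)
    qed
    ultimately show ?case
      using Suc.IH Suc.prems by (simp only: sum.atMost_Suc) (simp add: algebra_simps)
  qed
  have "(\<Sum>s\<le>Suc m. (-1) ^ s * R (Suc m) s * q ^ (s * Suc m + \<Sum>{..s})) =
          (\<Sum>s\<le>m. (-1) ^ s * R m s * q ^ (s * m + \<Sum>{..s})) + U m +
          (-1) ^ Suc m * q ^ (Suc m * Suc m + \<Sum>{..Suc m})"
    using step[of m] by (simp add: sum_subtractf R_def algebra_simps)
  also have "U m = (-1) ^ Suc m * q ^ (Suc m ^ 2 + \<Sum>{..m})"
    by (simp add: U_def R_def power2_eq_square)
  finally show ?case
    using Suc.IH by (simp add: R_def power2_eq_square algebra_simps)
qed auto

lemma tendsto_sum_symmetric_int: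
  assumes "(f has_sum S) (UNIV :: int set)"
  shows "(\<lambda>n. \<Sum>k\<in>{-int n..int n}. f k) \<longlonglongrightarrow> S"
proof -
  have "filterlim (\<lambda>n. {-int n..int n}) (finite_subsets_at_top UNIV) sequentially"
    unfolding filterlim_finite_subsets_at_top
  proof (intro allI impI)
    fix X :: "int set" assume X: "finite X \<and> X \<subseteq> UNIV"
    define N where "N = nat (Max (insert 0 (abs ` X)))"
    have "\<bar>x\<bar> \<le> int N" if "x \<in> X" for x
      using X that by (auto simp: N_def)
    hence "x \<in> {-int n..int n}" if "x \<in> X" "n \<ge> N" for x n
      using that by force
    thus "\<forall>\<^sub>F n in sequentially. finite {-int n..int n} \<and> X \<subseteq> {-int n..int n} \<and> {-int n..int n} \<subseteq> UNIV"
      by (intro eventually_sequentiallyI[of N]) auto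
  qed
  with assms show ?thesis
    unfolding has_sum_def by (rule filterlim_compose)
qed

lemma sum_symmetric_int_Suc:
  "(\<Sum>k\<in>{-int (Suc n)..int (Suc n)}. f k) = (\<Sum>k\<in>{-int n..int n}. f k) + f (int (Suc n)) + f (- int (Suc n))"
proof -
  have "{-int (Suc n)..int (Suc n)} = insert (int (Suc n)) (insert (- int (Suc n)) {-int n..int n})" by auto
  thus ?thesis by (simp add: add_ac)
qed

text \<open>
  In Shanks' identity the summand with index \<open>s\<close> is of order \<open>|q|\<^sup>s\<^sup>n\<close>; in the limit only \<open>s = 0\<close>
  survives, and this summand is the partial product.
\<close>

lemma pentagonal_product:
  fixes q :: complex
  assumes "norm q < 1"
  shows "(\<lambda>n. 1 + (\<Sum>j<n. (-1) ^ Suc j * (q ^ (Suc j ^ 2 + \<Sum>{..j}) + q ^ (Suc j ^ 2 + \<Sum>{..Suc j}))))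
           \<longlonglongrightarrow> (\<Prod>n. 1 - q ^ Suc n)" (is ?th1)
    and "(\<Prod>n. 1 - q ^ Suc n) \<noteq> 0" (is ?th2)
proof -
  define R where "R = (\<lambda>n s. \<Prod>i\<in>{s<..n}. 1 - q ^ i)"
  define B where "B = exp (1 / (1 - norm q))"
  have ne: "q ^ Suc n \<noteq> 1" for n
  proof -
    have "norm (q ^ Suc n) < 1" unfolding norm_power using assms by (intro power_less_one_iff[THEN iffD2]) auto
    thus ?thesis by auto
  qed
  have sq: "summable (\<lambda>n. norm q ^ n)" using assms by (intro summable_geometric) auto
  have "convergent_prod (\<lambda>n. 1 + (- (q ^ Suc n)))"
  proof (rule summable_imp_convergent_prod_complex)
    show "summable (\<lambda>n. norm (- (q ^ Suc n)))"
      using sq by (subst norm_minus_cancel, subst norm_power, subst summable_Suc_iff)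
    show "- (q ^ Suc n) \<noteq> -1" for n using ne[of n] by auto
  qed
  hence conv: "convergent_prod (\<lambda>n. 1 - q ^ Suc n)" by simp
  show ?th2 by (rule prodinf_nonzero[OF conv]) (use ne in auto)
  have prod_eq: "(\<Prod>i<n. 1 - q ^ Suc i) = R n 0" for n
    unfolding R_def by (rule prod.reindex_bij_witness[of _ "\<lambda>i. i - 1" Suc]) auto
  have lim: "(\<lambda>n. R n 0) \<longlonglongrightarrow> (\<Prod>n. 1 - q ^ Suc n)"
    using convergent_prod_LIMSEQ[OF conv] LIMSEQ_lessThan_iff_atMost[of "\<lambda>A. \<Prod>i\<in>A. 1 - q ^ Suc i"]
    by (simp flip: prod_eq)
  have R_bound: "norm (R n s) \<le> B" for n s
  proof -
    have "norm (R n s) \<le> (\<Prod>i\<in>{s<..n}. exp (norm q ^ i))"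
      unfolding R_def prod_norm [symmetric]
    proof (intro prod_mono conjI)
      fix i
      have "norm (1 - q ^ i) \<le> 1 + norm q ^ i"
        by (metis norm_one norm_power norm_triangle_ineq4)
      also have "\<dots> \<le> exp (norm q ^ i)" by (rule exp_ge_add_one_self)
      finally show "norm (1 - q ^ i) \<le> exp (norm q ^ i)" .
    qed auto
    also have "\<dots> = exp (\<Sum>i\<in>{s<..n}. norm q ^ i)" by (simp add: exp_sum)
    also have "(\<Sum>i\<in>{s<..n}. norm q ^ i) \<le> (\<Sum>i. norm q ^ i)"
      by (intro sum_le_suminf sq) auto
    also have "\<dots> = 1 / (1 - norm q)" using assms by (intro suminf_geometric) auto
    finally show ?thesis by (simp add: B_def)
  qed
  have diff: "norm ((\<Sum>s\<le>n. (-1) ^ s * R n s * q ^ (s * n + \<Sum>{..s})) - R n 0) \<le> B * (real n * norm q ^ n)" for n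
  proof -
    have "(\<Sum>s\<le>n. (-1) ^ s * R n s * q ^ (s * n + \<Sum>{..s})) - R n 0 =
            (\<Sum>s\<in>{1..n}. (-1) ^ s * R n s * q ^ (s * n + \<Sum>{..s}))"
      by (subst atMost_atLeast0, subst sum.atLeast_Suc_atMost) auto
    also have "norm \<dots> \<le> (\<Sum>s\<in>{1..n}. B * norm q ^ n)"
    proof (rule sum_norm_le)
      fix s assume s: "s \<in> {1..n}"
      have "n \<le> s * n + \<Sum>{..s}" using s by (simp add: trans_le_add1)
      hence "norm q ^ (s * n + \<Sum>{..s}) \<le> norm q ^ n"
        using assms by (intro power_decreasing) auto
      thus "norm ((-1) ^ s * R n s * q ^ (s * n + \<Sum>{..s})) \<le> B * norm q ^ n"
        unfolding norm_mult norm_power using R_bound[of n s]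
        by (simp add: norm_power mult_mono B_def)
    qed
    finally show ?thesis by (simp add: algebra_simps)
  qed
  have "(\<lambda>n. B * (real n * norm q ^ n)) \<longlonglongrightarrow> B * 0"
    using assms by (intro tendsto_mult_left powser_times_n_limit_0[of "norm q", simplified]) auto
  hence "(\<lambda>n. B * (real n * norm q ^ n)) \<longlonglongrightarrow> 0" by simp
  have eq: "(\<Sum>s\<le>n. (-1) ^ s * R n s * q ^ (s * n + \<Sum>{..s})) =
       1 + (\<Sum>j<n. (-1) ^ Suc j * (q ^ (Suc j ^ 2 + \<Sum>{..j}) + q ^ (Suc j ^ 2 + \<Sum>{..Suc j})))" for n
    unfolding R_def by (rule shanks_identity)
  from tendsto_add[OF Lim_null_comparison[OF always_eventually[OF allI[OF diff]] \<open>_ \<longlonglongrightarrow> 0\<close>] lim] show ?th1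
    unfolding eq diff_add_cancel add_0 .
qed

definition parity_sign :: "int \<Rightarrow> complex" where
  "parity_sign k = (if even k then 1 else -1)"

lemma parity_sign_simps [simp]: "parity_sign 0 = 1" "parity_sign 1 = -1" "parity_sign (- k) = parity_sign k" "norm (parity_sign k) = 1"
  "parity_sign k * parity_sign k = 1" "parity_sign k \<noteq> 0"
  by (auto simp: parity_sign_def)

lemma parity_sign_diff: "parity_sign (a - b) = parity_sign a * parity_sign b"
  by (auto simp: parity_sign_def)

lemma parity_sign_of_nat: "parity_sign (int n) = (-1) ^ n"
  by (auto simp: parity_sign_def)

text \<open>
  \<open>q\<close> to the power \<open>x\<close>, for \<open>q = exp (2\<pi>i\<tau>)\<close>; the exponent is real because multiples of \<open>1/24\<close> occur.
\<close>

definition qpow :: "complex \<Rightarrow> real \<Rightarrow> complex" where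
  "qpow \<tau> x = exp (2 * of_real pi * \<i> * of_real x * \<tau>)"

lemma qpow_add: "qpow \<tau> (x + y) = qpow \<tau> x * qpow \<tau> y"
  by (simp add: qpow_def exp_add [symmetric] algebra_simps)

lemma qpow_nonzero [simp]: "qpow \<tau> x \<noteq> 0" by (simp add: qpow_def)

lemma qpow_0 [simp]: "qpow \<tau> 0 = 1" by (simp add: qpow_def)

lemma qpow_of_nat: "qpow \<tau> (real n) = exp (2 * of_real pi * \<i> * \<tau>) ^ n"
  by (simp add: qpow_def exp_of_nat_mult [symmetric] algebra_simps)

text \<open>
  All series in \<open>q\<close> below have exponents of the form \<open>(a k + b)\<^sup>2 / 24\<close>. Expanding the square turns them
  into theta series, which settles their convergence.
\<close>

lemma theta_series_square_completed:
  assumes c: "\<And>n. norm (c n) \<le> 1" and "Im \<tau> > 0" and "a \<noteq> 0"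
  shows "((\<lambda>k. c k * qpow \<tau> ((a * of_int k + b)\<^sup>2 / 24) * exp (2 * of_real pi * \<i> * of_int k * z)) has_sum
            qpow \<tau> (b\<^sup>2 / 24) * theta_series c (of_real (a\<^sup>2) * \<tau> / 12) (of_real (a * b) * \<tau> / 12 + z)) UNIV"
proof -
  have "Im (of_real (a\<^sup>2) * \<tau> / 12) > 0" using assms by simp
  note * = has_sum_cmult_right[OF theta_series_has_sum[OF c this, where z = "of_real (a * b) * \<tau> / 12 + z"], of "qpow \<tau> (b\<^sup>2 / 24)"]
  have eq: "qpow \<tau> ((a * of_int k + b)\<^sup>2 / 24) * exp (2 * of_real pi * \<i> * of_int k * z) =
     qpow \<tau> (b\<^sup>2 / 24) * exp (of_real pi * \<i> * (of_int k ^ 2 * (of_real (a\<^sup>2) * \<tau> / 12) + 2 * of_int k * (of_real (a * b) * \<tau> / 12 + z)))" for k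
    unfolding qpow_def exp_add [symmetric]
    by (rule arg_cong[of _ _ exp]) (simp add: field_simps power2_eq_square)
  show ?thesis
  proof (rule iffD1[OF has_sum_cong *])
    fix k :: int
    have "x * (c k * y) = c k * u * v" if "u * v = x * y" for x y u v :: complex
      using that by (simp add: mult_ac)
    from this[OF eq[of k]] show "qpow \<tau> (b\<^sup>2 / 24) * (c k * exp (of_real pi * \<i> * (of_int k ^ 2 * (of_real (a\<^sup>2) * \<tau> / 12) +
            2 * of_int k * (of_real (a * b) * \<tau> / 12 + z)))) =
          c k * qpow \<tau> ((a * of_int k + b)\<^sup>2 / 24) * exp (2 * of_real pi * \<i> * of_int k * z)" .
  qed
qed

lemma quadratic_summable:
  assumes "\<And>n. norm (c n) \<le> 1" "Im \<tau> > 0" "a \<noteq> 0"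
  shows "(\<lambda>k. c k * qpow \<tau> ((a * of_int k + b)\<^sup>2 / 24)) summable_on UNIV"
  using theta_series_square_completed[of c \<tau> a b 0] assms by (auto simp: summable_on_def)

lemma pentagonal_exponents:
  "((6 * real (Suc j) + 1)\<^sup>2 / 24 :: real) = 1 / 24 + real (Suc j ^ 2 + \<Sum>{..Suc j})"
  "((6 * (- real (Suc j)) + 1)\<^sup>2 / 24 :: real) = 1 / 24 + real (Suc j ^ 2 + \<Sum>{..j})"
proof -
  have gauss: "real (\<Sum>{..n}) = real n * (real n + 1) / 2" for n
    by (induction n) (simp_all add: field_simps)
  show "((6 * real (Suc j) + 1)\<^sup>2 / 24 :: real) = 1 / 24 + real (Suc j ^ 2 + \<Sum>{..Suc j})"
    unfolding of_nat_add gauss by (simp add: power2_eq_square field_simps)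
  show "((6 * (- real (Suc j)) + 1)\<^sup>2 / 24 :: real) = 1 / 24 + real (Suc j ^ 2 + \<Sum>{..j})"
    unfolding of_nat_add gauss by (simp add: power2_eq_square field_simps)
qed

lemma norm_q_less_1: "Im \<tau> > 0 \<Longrightarrow> norm (exp (2 * of_real pi * \<i> * \<tau>)) < 1"
  by simp

lemma eta_eq_product: "dedekind_eta \<tau> = qpow \<tau> (1/24) * (\<Prod>n. 1 - exp (2 * of_real pi * \<i> * \<tau>) ^ Suc n)"
proof -
  have "exp (2 * of_real pi * \<i> * of_nat (Suc n) * \<tau>) = exp (2 * of_real pi * \<i> * \<tau>) ^ Suc n" for n
    by (subst exp_of_nat_mult [symmetric]) (simp add: algebra_simps)
  thus ?thesis by (simp add: dedekind_eta_def qpow_def mult_ac del: power_Suc)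
qed

lemma eta_nonzero: "Im \<tau> > 0 \<Longrightarrow> dedekind_eta \<tau> \<noteq> 0"
  unfolding eta_eq_product using pentagonal_product(2)[OF norm_q_less_1] by simp

text \<open>
  As \<open>(6k + 1)\<^sup>2 / 24 = 1 / 24 + k (3k + 1) / 2\<close>, the symmetric partial sums are those of the
  pentagonal number theorem.
\<close>

lemma eta_has_sum:
  assumes "Im \<tau> > 0"
  shows "((\<lambda>k. parity_sign k * qpow \<tau> ((6 * of_int k + 1)\<^sup>2 / 24)) has_sum dedekind_eta \<tau>) UNIV"
proof -
  define q where "q = exp (2 * of_real pi * \<i> * \<tau>)"
  define f where "f = (\<lambda>k. parity_sign k * qpow \<tau> ((6 * of_int k + 1)\<^sup>2 / 24))"
  have "f summable_on UNIV"
    unfolding f_def using assms by (intro quadratic_summable) auto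
  then obtain S where S: "(f has_sum S) UNIV" by (auto simp: summable_on_def)
  have "(\<Sum>k\<in>{-int n..int n}. f k) = qpow \<tau> (1/24) *
          (1 + (\<Sum>j<n. (-1) ^ Suc j * (q ^ (Suc j ^ 2 + \<Sum>{..j}) + q ^ (Suc j ^ 2 + \<Sum>{..Suc j}))))" for n
  proof (induction n)
    case 0
    show ?case by (simp add: f_def)
  next
    case (Suc n)
    have "f (int (Suc n)) = qpow \<tau> (1/24) * ((-1) ^ Suc n * q ^ (Suc n ^ 2 + \<Sum>{..Suc n}))"
      unfolding f_def parity_sign_of_nat of_int_of_nat_eq pentagonal_exponents qpow_add qpow_of_nat q_def
      by (simp only: mult_ac)
    moreover have "f (- int (Suc n)) = qpow \<tau> (1/24) * ((-1) ^ Suc n * q ^ (Suc n ^ 2 + \<Sum>{..n}))"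
      unfolding f_def parity_sign_simps parity_sign_of_nat of_int_of_nat_eq of_int_minus pentagonal_exponents qpow_add qpow_of_nat q_def
      by (simp only: mult_ac)
    ultimately show ?case
      unfolding sum_symmetric_int_Suc Suc.IH sum.lessThan_Suc by (simp only: algebra_simps)
  qed
  moreover have "norm q < 1" using norm_q_less_1[OF assms] by (simp only: q_def)
  ultimately have "(\<lambda>n. \<Sum>k\<in>{-int n..int n}. f k) \<longlonglongrightarrow> dedekind_eta \<tau>"
    using tendsto_mult_left[OF pentagonal_product(1)[of q], of "qpow \<tau> (1/24)"]
    by (simp only: eta_eq_product q_def)
  with tendsto_sum_symmetric_int[OF S] have "S = dedekind_eta \<tau>"
    using LIMSEQ_unique by blast
  with S show ?thesis by (simp add: f_def)
qed

text \<open>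
  The multiple of \<open>\<eta>\<close> that the alternating sum of the powers of \<open>q\<close> with exponents \<open>3/2 (k + 1/2 - s/3)\<^sup>2\<close>
  amounts to; Euler's series is the case \<open>s = 1\<close>.
\<close>

definition euler_coeff :: "int \<Rightarrow> complex" where
  "euler_coeff s = (if 3 dvd s then 0 else parity_sign (s div 3))"

text \<open>
  The inner sum to which products of theta series are reduced. If \<open>3\<close> does not divide \<open>s\<close>, an integral
  shift or reflection of \<open>k\<close> gives Euler's series up to sign. If \<open>s = 3 u\<close>, the reflection
  \<open>k \<mapsto> 2 u - 1 - k\<close> reverses the sign of every term, so that the sum vanishes.
\<close>

lemma shifted_eta_has_sum:
  assumes "Im \<tau> > 0"
  shows "((\<lambda>k. parity_sign k * qpow \<tau> ((6 * of_int k + 3 - 2 * of_int s)\<^sup>2 / 24)) has_sum euler_coeff s * dedekind_eta \<tau>) UNIV"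
proof -
  define u where "u = s div 3"
  consider "s = 3 * u" | "s = 3 * u + 1" | "s = 3 * u + 2"
  proof -
    have "s = 3 * u \<or> s = 3 * u + 1 \<or> s = 3 * u + 2" unfolding u_def by presburger
    thus ?thesis using that by blast
  qed
  thus ?thesis
  proof cases
    case 1
    define f where "f = (\<lambda>k. parity_sign k * qpow \<tau> ((6 * of_int k + (3 - 2 * of_int s))\<^sup>2 / 24))"
    have "f summable_on UNIV"
      unfolding f_def using assms by (intro quadratic_summable) auto
    then obtain S where S: "(f has_sum S) UNIV" by (auto simp: summable_on_def)
    have "((\<lambda>k. - f k) has_sum S) UNIV \<longleftrightarrow> (f has_sum S) UNIV"
    proof (rule has_sum_reindex_bij_witness[of _ "\<lambda>k. 2 * u - 1 - k" "\<lambda>k. 2 * u - 1 - k"])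
      fix k :: int
      have "(6 * of_int (2 * u - 1 - k) + (3 - 2 * of_int s))\<^sup>2 = (6 * of_int k + (3 - 2 * of_int s :: real))\<^sup>2"
        unfolding 1 by (simp add: power2_eq_square algebra_simps)
      thus "f (2 * u - 1 - k) = - f k"
        by (simp add: f_def parity_sign_def)
    qed auto
    with S have "((\<lambda>k. - f k) has_sum S) UNIV" by simp
    with S have "S = -S" using has_sum_uminus has_sum_unique by blast
    with S show ?thesis by (simp add: f_def euler_coeff_def 1 algebra_simps)
  next
    case 2
    have "((\<lambda>k. parity_sign k * qpow \<tau> ((6 * of_int k + 3 - 2 * of_int s)\<^sup>2 / 24)) has_sum parity_sign u * dedekind_eta \<tau>) UNIV \<longleftrightarrow>
          ((\<lambda>k. parity_sign u * (parity_sign k * qpow \<tau> ((6 * of_int k + 1)\<^sup>2 / 24))) has_sum parity_sign u * dedekind_eta \<tau>) UNIV"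
      by (rule has_sum_reindex_bij_witness[of _ "\<lambda>k. k + u" "\<lambda>k. k - u"])
         (auto simp: parity_sign_diff 2 algebra_simps)
    moreover have "\<not> 3 dvd s" using 2 by presburger
    hence "euler_coeff s = parity_sign u" by (simp add: euler_coeff_def u_def)
    ultimately show ?thesis
      using has_sum_cmult_right[OF eta_has_sum[OF assms], of "parity_sign u"] by simp
  next
    case 3
    have "((\<lambda>k. parity_sign k * qpow \<tau> ((6 * of_int k + 3 - 2 * of_int s)\<^sup>2 / 24)) has_sum parity_sign u * dedekind_eta \<tau>) UNIV \<longleftrightarrow>
          ((\<lambda>k. parity_sign u * (parity_sign k * qpow \<tau> ((6 * of_int k + 1)\<^sup>2 / 24))) has_sum parity_sign u * dedekind_eta \<tau>) UNIV"
    proof (rule has_sum_reindex_bij_witness[of _ "\<lambda>k. u - k" "\<lambda>k. u - k"])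
      fix k :: int
      have "(6 * of_int (u - k) + 1)\<^sup>2 = (6 * of_int k + 3 - 2 * of_int s :: real)\<^sup>2"
        unfolding 3 by (simp add: power2_eq_square algebra_simps)
      thus "parity_sign u * (parity_sign (u - k) * qpow \<tau> ((6 * of_int (u - k) + 1)\<^sup>2 / 24)) =
              parity_sign k * qpow \<tau> ((6 * of_int k + 3 - 2 * of_int s)\<^sup>2 / 24)"
        by (simp add: parity_sign_diff)
    qed auto
    moreover have "\<not> 3 dvd s" using 3 by presburger
    hence "euler_coeff s = parity_sign u" by (simp add: euler_coeff_def u_def)
    ultimately show ?thesis
      using has_sum_cmult_right[OF eta_has_sum[OF assms], of "parity_sign u"] by simp
  qed
qed

section \<open>The product of three theta functions\<close>

lemma has_sum_product:
  fixes f :: "'a \<Rightarrow> complex" and g :: "'b \<Rightarrow> complex"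
  assumes f: "(f has_sum a) A" and g: "(g has_sum b) B"
  shows "((\<lambda>(x, y). f x * g y) has_sum a * b) (A \<times> B)"
proof (rule has_sum_SigmaI)
  show "((\<lambda>y. case (x, y) of (x, y) \<Rightarrow> f x * g y) has_sum f x * b) B" for x
    using has_sum_cmult_right[OF g, of "f x"] by simp
  show "((\<lambda>x. f x * b) has_sum a * b) A"
    using has_sum_cmult_left[OF f] by simp
  have f': "(\<lambda>x. norm (f x)) summable_on A" and g': "(\<lambda>x. norm (g x)) summable_on B"
    unfolding summable_on_iff_abs_summable_on_complex [symmetric] using f g by (auto simp: summable_on_def)
  have "(\<lambda>z. norm (case z of (x, y) \<Rightarrow> f x * g y)) summable_on A \<times> B"
    unfolding Infinite_Sum.abs_summable_on_Sigma_iff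
  proof (intro conjI ballI)
    show "(\<lambda>y. norm (case (x, y) of (x, y) \<Rightarrow> f x * g y)) summable_on B" for x
      using summable_on_cmult_right[OF g'] by (simp add: norm_mult)
    have "(\<lambda>x. norm (f x) * (\<Sum>\<^sub>\<infinity>y\<in>B. norm (g y))) summable_on A"
      by (intro summable_on_cmult_left f')
    hence "(\<lambda>x. \<Sum>\<^sub>\<infinity>y\<in>B. norm (f x) * norm (g y)) summable_on A"
      by (subst infsum_cmult_right) (use g' in auto)
    thus "(\<lambda>x. norm (\<Sum>\<^sub>\<infinity>y\<in>B. norm (case (x, y) of (x, y) \<Rightarrow> f x * g y))) summable_on A"
      by (simp add: norm_mult infsum_nonneg)
  qed
  thus "(\<lambda>(x, y). f x * g y) summable_on A \<times> B"
    by (rule abs_summable_summable)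
qed

text \<open>
  \<open>\<zeta>\<close> to the power \<open>n / 2\<close>, for \<open>\<zeta> = exp (2\<pi>iz)\<close>: half-integral powers occur in \<open>\<vartheta>\<close>.
\<close>

definition zpow :: "complex \<Rightarrow> int \<Rightarrow> complex" where
  "zpow z n = exp (of_real pi * \<i> * of_int n * z)"

lemma zpow_add: "zpow z (m + n) = zpow z m * zpow z n"
  by (simp add: zpow_def exp_add [symmetric] algebra_simps)

lemma zpow_add_left: "zpow (z + w) n = zpow z n * zpow w n"
  by (simp add: zpow_def exp_add [symmetric] algebra_simps)

lemma jtheta_eq_theta_series: "jtheta \<tau> z = theta_series kronecker_m4 (\<tau> / 4) (z / 2)"
proof -
  have "2 * of_real pi * \<i> * (of_int n ^ 2 / 8 * \<tau> + of_int n / 2 * z) =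
          of_real pi * \<i> * ((of_int n)\<^sup>2 * (\<tau> / 4) + 2 * of_int n * (z / 2))" for n :: int
    by (simp add: field_simps)
  thus ?thesis unfolding jtheta_def theta_series_def by (simp only:)
qed

lemma kronecker_m4_bound: "norm (kronecker_m4 n) \<le> 1"
  by (simp add: kronecker_m4_def)

lemma jtheta_has_sum:
  assumes "Im \<tau> > 0"
  shows "((\<lambda>k. parity_sign k * qpow \<tau> ((2 * of_int k + 1)\<^sup>2 / 8) * zpow z (2 * k + 1)) has_sum jtheta \<tau> z) UNIV"
proof -
  define f where "f = (\<lambda>n. kronecker_m4 n * exp (of_real pi * \<i> * (of_int n ^ 2 * (\<tau> / 4) + 2 * of_int n * (z / 2))))"
  have "(f has_sum jtheta \<tau> z) UNIV"
    unfolding f_def jtheta_eq_theta_series by (intro theta_series_has_sum kronecker_m4_bound) (use assms in auto)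
  also have "?this \<longleftrightarrow> (f has_sum jtheta \<tau> z) (range (\<lambda>k. 2 * k + 1))"
  proof (rule has_sum_cong_neutral)
    fix n :: int assume "n \<in> UNIV - range (\<lambda>k. 2 * k + 1)"
    hence "even n" by (metis DiffE oddE rangeI)
    hence "n mod 4 \<noteq> 1" "n mod 4 \<noteq> 3" by presburger+
    hence "kronecker_m4 n = 0" by (simp add: kronecker_m4_def)
    thus "f n = 0" by (simp add: f_def)
  qed auto
  also have "\<dots> \<longleftrightarrow> ((\<lambda>k. f (2 * k + 1)) has_sum jtheta \<tau> z) UNIV"
    by (subst has_sum_reindex) (auto simp: inj_on_def o_def)
  also have "(\<lambda>k. f (2 * k + 1)) = (\<lambda>k. parity_sign k * qpow \<tau> ((2 * of_int k + 1)\<^sup>2 / 8) * zpow z (2 * k + 1))"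
  proof
    fix k :: int
    have "(2 * k + 1) mod 4 = (if even k then 1 else 3)" by presburger
    hence "kronecker_m4 (2 * k + 1) = parity_sign k" by (simp add: kronecker_m4_def parity_sign_def)
    thus "f (2 * k + 1) = parity_sign k * qpow \<tau> ((2 * of_int k + 1)\<^sup>2 / 8) * zpow z (2 * k + 1)"
      by (simp add: f_def qpow_def zpow_def exp_add [symmetric] field_simps)
  qed
  finally show ?thesis .
qed

text \<open>
  Multiply out, fix the exponents \<open>l\<close> and \<open>m\<close> of the two elliptic variables and sum over the index \<open>k\<close>
  of the third factor: completing the square in \<open>k\<close> splits off the exponent \<open>(l\<^sup>2 - l m + m\<^sup>2) / 3\<close> and
  leaves a shifted Euler series. This exponent is half the norm of \<open>(l, m)\<close> in the dual of the root
  lattice \<open>A\<^sub>2\<close>, which is why the weight of the quark is singular.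
\<close>

lemma three_jtheta_has_sum:
  assumes "Im \<tau> > 0"
  shows "((\<lambda>(l, m). parity_sign (l + m) * euler_coeff (l + m) * dedekind_eta \<tau> *
             qpow \<tau> (of_int (l\<^sup>2 - l * m + m\<^sup>2) / 3) * zpow z (2 * l) * zpow w (2 * m)) has_sum
           jtheta \<tau> z * jtheta \<tau> w * jtheta \<tau> (z + w)) UNIV"
proof -
  define f where "f = (\<lambda>z k. parity_sign k * qpow \<tau> ((2 * of_int k + 1)\<^sup>2 / 8) * zpow z (2 * k + 1))"
  define g where "g = (\<lambda>((l, m), k). (parity_sign (l + m) * qpow \<tau> (of_int (l\<^sup>2 - l * m + m\<^sup>2) / 3) * zpow z (2 * l) * zpow w (2 * m)) *
     (parity_sign k * qpow \<tau> ((6 * of_int k + 3 - 2 * of_int (l + m))\<^sup>2 / 24)))"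
  have "((\<lambda>(x, y). (case x of (i, j) \<Rightarrow> f z i * f w j) * f (z + w) y) has_sum jtheta \<tau> z * jtheta \<tau> w * jtheta \<tau> (z + w))
          ((UNIV \<times> UNIV) \<times> UNIV)"
    unfolding f_def by (intro has_sum_product jtheta_has_sum assms)
  also have "?this \<longleftrightarrow> (g has_sum jtheta \<tau> z * jtheta \<tau> w * jtheta \<tau> (z + w)) (UNIV \<times> UNIV)"
  proof (rule has_sum_reindex_bij_witness[of _ "\<lambda>((l, m), k). ((l - k - 1, m - k - 1), k)" "\<lambda>((i, j), k). ((i + k + 1, j + k + 1), k)"], goal_cases)
    case (5 x)
    obtain i j k where x: "x = ((i, j), k)" by (metis surj_pair)
    define l m where "l = i + k + 1" and "m = j + k + 1"
    have i: "i = l - k - 1" and j: "j = m - k - 1" by (simp_all add: l_def m_def)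
    have "(of_int (l\<^sup>2 - l * m + m\<^sup>2) / 3 :: real) + (6 * of_int k + 3 - 2 * of_int (l + m))\<^sup>2 / 24 =
            (2 * of_int i + 1)\<^sup>2 / 8 + (2 * of_int j + 1)\<^sup>2 / 8 + (2 * of_int k + 1)\<^sup>2 / 8"
      unfolding i j by (simp add: power2_eq_square field_simps)
    hence "qpow \<tau> (of_int (l\<^sup>2 - l * m + m\<^sup>2) / 3) * qpow \<tau> ((6 * of_int k + 3 - 2 * of_int (l + m))\<^sup>2 / 24) =
           qpow \<tau> ((2 * of_int i + 1)\<^sup>2 / 8) * qpow \<tau> ((2 * of_int j + 1)\<^sup>2 / 8) * qpow \<tau> ((2 * of_int k + 1)\<^sup>2 / 8)"
      by (simp only: qpow_add [symmetric])
    moreover have "parity_sign (l + m) * parity_sign k = parity_sign i * parity_sign j * parity_sign k" unfolding i j by (auto simp: parity_sign_def)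
    moreover have "zpow z (2 * l) * zpow w (2 * m) = zpow z (2 * i + 1) * zpow w (2 * j + 1) * zpow (z + w) (2 * k + 1)"
    proof -
      have "2 * l = (2 * i + 1) + (2 * k + 1)" "2 * m = (2 * j + 1) + (2 * k + 1)" unfolding i j by simp_all
      thus ?thesis by (simp only: zpow_add zpow_add_left mult_ac)
    qed
    ultimately have "(parity_sign (l + m) * parity_sign k) * (qpow \<tau> (of_int (l\<^sup>2 - l * m + m\<^sup>2) / 3) * qpow \<tau> ((6 * of_int k + 3 - 2 * of_int (l + m))\<^sup>2 / 24)) *
        (zpow z (2 * l) * zpow w (2 * m)) = f z i * f w j * f (z + w) k"
      unfolding f_def by (simp only: mult_ac)
    thus ?case unfolding x prod.case l_def [symmetric] m_def [symmetric] g_def by (simp only: prod.case mult_ac)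
  qed (auto split: prod.splits)
  finally have "(g has_sum jtheta \<tau> z * jtheta \<tau> w * jtheta \<tau> (z + w)) (Sigma UNIV (\<lambda>_. UNIV))" .
  hence "((\<lambda>(l, m). (parity_sign (l + m) * qpow \<tau> (of_int (l\<^sup>2 - l * m + m\<^sup>2) / 3) * zpow z (2 * l) * zpow w (2 * m)) *
            (euler_coeff (l + m) * dedekind_eta \<tau>)) has_sum jtheta \<tau> z * jtheta \<tau> w * jtheta \<tau> (z + w)) UNIV"
  proof (rule has_sum_SigmaD, goal_cases)
    case (1 x)
    show ?case
      by (cases x) (auto simp only: g_def prod.case intro!: has_sum_cmult_right shifted_eta_has_sum assms)
  qed
  thus ?thesis by (simp add: mult_ac)
qed

section \<open>The quintuple product identity\<close>

text \<open>
  The even character \<open>(12 / n)\<close> restricted to \<open>n \<equiv> 1 (mod 6)\<close>; its other half is the mirror image.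
\<close>

definition kronecker_12_half :: "int \<Rightarrow> complex" where
  "kronecker_12_half n = (if n mod 6 = 1 then parity_sign (n div 6) else 0)"

definition theta_12_half :: "complex \<Rightarrow> complex \<Rightarrow> complex" where
  "theta_12_half \<tau> z = theta_series kronecker_12_half (\<tau> / 12) (z / 2)"

text \<open>
  The series \<open>\<Sum> (12 / n)\<close> times \<open>q\<close> to the power \<open>n\<^sup>2 / 24\<close> times \<open>\<zeta>\<close> to the power \<open>n / 2\<close>. By the quintuple
  product identity it is the holomorphic extension \<open>\<vartheta>\<^sub>3\<^sub>/\<^sub>2\<close> of \<open>\<eta>(\<tau>) \<vartheta>(\<tau>, 2z) / \<vartheta>(\<tau>, z)\<close>.
\<close>

definition quintuple_theta :: "complex \<Rightarrow> complex \<Rightarrow> complex" where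
  "quintuple_theta \<tau> z = theta_12_half \<tau> z + theta_12_half \<tau> (- z)"

lemma kronecker_12_half_bound: "norm (kronecker_12_half n) \<le> 1"
  by (simp add: kronecker_12_half_def)

lemma theta_12_half_has_sum:
  assumes "Im \<tau> > 0"
  shows "((\<lambda>k. parity_sign k * qpow \<tau> ((6 * of_int k + 1)\<^sup>2 / 24) * zpow z (6 * k + 1)) has_sum theta_12_half \<tau> z) UNIV"
proof -
  define f where "f = (\<lambda>n. kronecker_12_half n * exp (of_real pi * \<i> * (of_int n ^ 2 * (\<tau> / 12) + 2 * of_int n * (z / 2))))"
  have "(f has_sum theta_12_half \<tau> z) UNIV"
    unfolding f_def theta_12_half_def by (intro theta_series_has_sum kronecker_12_half_bound) (use assms in auto)
  also have "?this \<longleftrightarrow> (f has_sum theta_12_half \<tau> z) (range (\<lambda>k. 6 * k + 1))"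
  proof (rule has_sum_cong_neutral)
    fix n :: int assume n: "n \<in> UNIV - range (\<lambda>k. 6 * k + 1)"
    have "n mod 6 \<noteq> 1"
    proof
      assume "n mod 6 = 1"
      hence "n = 6 * (n div 6) + 1" by presburger
      with n show False by blast
    qed
    thus "f n = 0" unfolding f_def kronecker_12_half_def by simp
  qed auto
  also have "\<dots> \<longleftrightarrow> ((\<lambda>k. f (6 * k + 1)) has_sum theta_12_half \<tau> z) UNIV"
    by (subst has_sum_reindex) (auto simp: inj_on_def o_def)
  also have "(\<lambda>k. f (6 * k + 1)) = (\<lambda>k. parity_sign k * qpow \<tau> ((6 * of_int k + 1)\<^sup>2 / 24) * zpow z (6 * k + 1))"
  proof
    fix k :: int
    have "kronecker_12_half (6 * k + 1) = parity_sign k" unfolding kronecker_12_half_def by simp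
    thus "f (6 * k + 1) = parity_sign k * qpow \<tau> ((6 * of_int k + 1)\<^sup>2 / 24) * zpow z (6 * k + 1)"
      by (simp add: f_def qpow_def zpow_def exp_add [symmetric] field_simps)
  qed
  finally show ?thesis .
qed

definition residue_theta :: "complex \<Rightarrow> int \<Rightarrow> complex" where
  "residue_theta \<tau> r = (\<Sum>\<^sub>\<infinity>k::int. qpow \<tau> ((12 * of_int k + of_int r)\<^sup>2 / 24))"

lemma residue_theta_has_sum:
  assumes "Im \<tau> > 0"
  shows "((\<lambda>k. qpow \<tau> ((12 * of_int k + of_int r)\<^sup>2 / 24)) has_sum residue_theta \<tau> r) UNIV"
  using quadratic_summable[of "\<lambda>_. 1" \<tau> 12 "of_int r"] assms unfolding residue_theta_def by simp

lemma residue_theta_shift: "residue_theta \<tau> (r + 12 * m) = residue_theta \<tau> r"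
  unfolding residue_theta_def
  by (rule infsum_reindex_bij_witness[of _ "\<lambda>k. k - m" "\<lambda>k. k + m"]) (auto simp: algebra_simps)

lemma residue_theta_minus: "residue_theta \<tau> (- r) = residue_theta \<tau> r"
  unfolding residue_theta_def
proof (rule infsum_reindex_bij_witness[of _ uminus uminus])
  fix k :: int
  have "(12 * of_int (- k) + of_int r)\<^sup>2 = (12 * of_int k + of_int (- r) :: real)\<^sup>2"
    by (simp add: power2_eq_square algebra_simps)
  thus "qpow \<tau> ((12 * of_int (- k) + of_int r)\<^sup>2 / 24) = qpow \<tau> ((12 * of_int k + of_int (- r))\<^sup>2 / 24)"
    by (simp only:)
qed auto

lemma residue_theta_cong: "12 dvd r - s \<or> 12 dvd r + s \<Longrightarrow> residue_theta \<tau> r = residue_theta \<tau> s"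
  by (metis residue_theta_minus residue_theta_shift add.commute diff_add_cancel dvdE diff_minus_eq_add)

lemma eta_eq_residue_theta:
  assumes "Im \<tau> > 0"
  shows "dedekind_eta \<tau> = residue_theta \<tau> 1 - residue_theta \<tau> 7"
proof -
  define f where "f = (\<lambda>k. parity_sign k * qpow \<tau> ((6 * of_int k + 1)\<^sup>2 / 24))"
  have "(f has_sum residue_theta \<tau> 1) (range (\<lambda>k. 2 * k))"
    using residue_theta_has_sum[OF assms, of 1]
    by (subst has_sum_reindex) (auto simp: inj_on_def o_def f_def parity_sign_def)
  moreover have "(f has_sum - residue_theta \<tau> 7) (range (\<lambda>k. 2 * k + 1))"
    using has_sum_cmult_right[OF residue_theta_has_sum[OF assms, of 7], of "-1"]
    by (subst has_sum_reindex) (auto simp: inj_on_def o_def f_def parity_sign_def algebra_simps)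
  ultimately have "(f has_sum (residue_theta \<tau> 1 + - residue_theta \<tau> 7)) (range (\<lambda>k. 2 * k) \<union> range (\<lambda>k. 2 * k + 1))"
    by (rule has_sum_Un_disjoint) (auto, presburger)
  also have "range (\<lambda>k. 2 * k) \<union> range (\<lambda>k. 2 * k + 1) = (UNIV :: int set)"
    by (auto simp: image_iff) (metis evenE oddE)
  finally show ?thesis
    using eta_has_sum[OF assms] has_sum_unique unfolding f_def by fastforce
qed

text \<open>
  The series over a residue class modulo 12 depends on the class only up to sign. For even \<open>l\<close> the two
  classes agree; for odd \<open>l\<close> they are \<open>\<plusminus>1\<close> and \<open>\<plusminus>7\<close>, and Euler's series, sorted by the parity of its
  index, is the difference of these two.
\<close>

lemma residue_theta_difference:
  assumes "Im \<tau> > 0"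
  shows "residue_theta \<tau> (2 + 3 * l) - residue_theta \<tau> (2 - 3 * l) =
           (if even l then 0 else - parity_sign (l div 2) * dedekind_eta \<tau>)"
proof (cases "even l")
  case True
  have "residue_theta \<tau> (2 + 3 * l) = residue_theta \<tau> (2 - 3 * l)"
    by (rule residue_theta_cong, rule disjI1) (use True in \<open>presburger\<close>)
  thus ?thesis using True by simp
next
  case False
  then obtain u where l: "l = 2 * u + 1" by (elim oddE)
  show ?thesis
  proof (cases "even u")
    case True
    have "residue_theta \<tau> (2 + 3 * l) = residue_theta \<tau> 7" "residue_theta \<tau> (2 - 3 * l) = residue_theta \<tau> 1"
      by (rule residue_theta_cong, rule disjI2, use True in \<open>simp add: l, presburger\<close>)+
    thus ?thesis using True by (simp add: l eta_eq_residue_theta[OF assms] parity_sign_def)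
  next
    case False
    have "residue_theta \<tau> (2 + 3 * l) = residue_theta \<tau> 1" "residue_theta \<tau> (2 - 3 * l) = residue_theta \<tau> 7"
      by (rule residue_theta_cong, rule disjI2, use False in \<open>simp add: l, presburger\<close>)+
    thus ?thesis using False by (simp add: l eta_eq_residue_theta[OF assms] parity_sign_def)
  qed
qed

text \<open>
  For a fixed power \<open>l\<close> of \<open>\<zeta>\<close> each half of the quintuple theta series contributes, after completing the
  square, the series over one residue class modulo 12.
\<close>

lemma jtheta_times_theta_12:
  fixes \<epsilon> :: int
  assumes "Im \<tau> > 0" and \<epsilon>: "\<epsilon> = 1 \<or> \<epsilon> = -1"
  shows "((\<lambda>l. of_int \<epsilon> * parity_sign l * qpow \<tau> (of_int l ^ 2 / 8) * zpow z (2 * l) * residue_theta \<tau> (2 + 3 * \<epsilon> * l)) has_sum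
            jtheta \<tau> z * theta_12_half \<tau> (- of_int \<epsilon> * z)) UNIV"
proof -
  define w where "w = - of_int \<epsilon> * z"
  \<comment> \<open>The power \<open>2 l\<close> of \<open>zpow z\<close> arises from \<open>(2 k + 1) - \<epsilon> (6 j + 1)\<close>, so \<open>k = l + 3 \<epsilon> j + (\<epsilon> - 1) / 2\<close>.\<close>
  define \<delta> :: int where "\<delta> = (if \<epsilon> = 1 then 0 else 1)"
  define f where "f = (\<lambda>k. parity_sign k * qpow \<tau> ((2 * of_int k + 1)\<^sup>2 / 8) * zpow z (2 * k + 1))"
  define g where "g = (\<lambda>j. parity_sign j * qpow \<tau> ((6 * of_int j + 1)\<^sup>2 / 24) * zpow w (6 * j + 1))"
  define h where "h = (\<lambda>(l, j). of_int \<epsilon> * parity_sign l * qpow \<tau> (of_int l ^ 2 / 8) * zpow z (2 * l) *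
     qpow \<tau> ((12 * of_int j + of_int (2 + 3 * \<epsilon> * l))\<^sup>2 / 24))"
  have zpow_w: "zpow w n = zpow z (- \<epsilon> * n)" for n by (simp add: zpow_def w_def mult_ac)
  have "((\<lambda>(x, y). f x * g y) has_sum jtheta \<tau> z * theta_12_half \<tau> w) (UNIV \<times> UNIV)"
    unfolding f_def g_def by (intro has_sum_product jtheta_has_sum theta_12_half_has_sum assms)
  also have "?this \<longleftrightarrow> (h has_sum jtheta \<tau> z * theta_12_half \<tau> w) (UNIV \<times> UNIV)"
  proof (rule has_sum_reindex_bij_witness[of _ "\<lambda>(l, j). (l + 3 * \<epsilon> * j - \<delta>, j)" "\<lambda>(k, j). (k - 3 * \<epsilon> * j + \<delta>, j)"], goal_cases)
    case (5 x)
    obtain k j where x: "x = (k, j)" by (metis surj_pair)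
    define l where "l = k - 3 * \<epsilon> * j + \<delta>"
    have k: "k = l + 3 * \<epsilon> * j - \<delta>" by (simp add: l_def)
    have "(of_int l ^ 2 / 8 :: real) + (12 * of_int j + of_int (2 + 3 * \<epsilon> * l))\<^sup>2 / 24 = (2 * of_int k + 1)\<^sup>2 / 8 + (6 * of_int j + 1)\<^sup>2 / 24"
      unfolding k \<delta>_def using \<epsilon> by (elim disjE) (simp_all add: power2_eq_square field_simps)
    hence "qpow \<tau> (of_int l ^ 2 / 8) * qpow \<tau> ((12 * of_int j + of_int (2 + 3 * \<epsilon> * l))\<^sup>2 / 24) =
             qpow \<tau> ((2 * of_int k + 1)\<^sup>2 / 8) * qpow \<tau> ((6 * of_int j + 1)\<^sup>2 / 24)"
      by (simp only: qpow_add [symmetric])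
    moreover have "of_int \<epsilon> * parity_sign l = parity_sign k * parity_sign j" unfolding k \<delta>_def using \<epsilon> by (auto simp: parity_sign_def)
    moreover have "zpow z (2 * l) = zpow z (2 * k + 1) * zpow w (6 * j + 1)"
      unfolding zpow_w zpow_add [symmetric] k \<delta>_def using \<epsilon> by auto
    ultimately have "(of_int \<epsilon> * parity_sign l) * (qpow \<tau> (of_int l ^ 2 / 8) * qpow \<tau> ((12 * of_int j + of_int (2 + 3 * \<epsilon> * l))\<^sup>2 / 24)) * zpow z (2 * l) = f k * g j"
      unfolding f_def g_def by (simp only: mult_ac)
    thus ?case unfolding x prod.case l_def [symmetric] h_def by (simp only: mult_ac)
  qed (auto split: prod.splits)
  finally have "(h has_sum jtheta \<tau> z * theta_12_half \<tau> w) (Sigma UNIV (\<lambda>_. UNIV))" .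
  hence "((\<lambda>l. of_int \<epsilon> * parity_sign l * qpow \<tau> (of_int l ^ 2 / 8) * zpow z (2 * l) * residue_theta \<tau> (2 + 3 * \<epsilon> * l)) has_sum
            jtheta \<tau> z * theta_12_half \<tau> w) UNIV"
  proof (rule has_sum_SigmaD, goal_cases)
    case (1 l)
    show ?case unfolding h_def prod.case by (intro has_sum_cmult_right residue_theta_has_sum assms)
  qed
  thus ?thesis unfolding w_def .
qed

text \<open>
  The quintuple product identity, in a form without denominators.
\<close>

lemma jtheta_times_quintuple_theta:
  assumes "Im \<tau> > 0"
  shows "jtheta \<tau> z * quintuple_theta \<tau> z = dedekind_eta \<tau> * jtheta \<tau> (2 * z)"
proof -
  define h where "h = (\<lambda>l. parity_sign l * qpow \<tau> (of_int l ^ 2 / 8) * zpow z (2 * l) *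
                        (residue_theta \<tau> (2 + 3 * l) - residue_theta \<tau> (2 - 3 * l)))"
  have "(h has_sum jtheta \<tau> z * quintuple_theta \<tau> z) UNIV"
    using has_sum_add[OF jtheta_times_theta_12[OF assms, of 1 z] jtheta_times_theta_12[OF assms, of "-1" z]]
    by (simp add: h_def quintuple_theta_def algebra_simps)
  also have "?this \<longleftrightarrow> (h has_sum jtheta \<tau> z * quintuple_theta \<tau> z) (range (\<lambda>k. 2 * k + 1))"
  proof (rule has_sum_cong_neutral)
    fix l :: int assume "l \<in> UNIV - range (\<lambda>k. 2 * k + 1)"
    hence "even l" by (metis DiffE oddE rangeI)
    thus "h l = 0" unfolding h_def residue_theta_difference[OF assms] by simp
  qed auto
  also have "\<dots> \<longleftrightarrow> ((\<lambda>k. h (2 * k + 1)) has_sum jtheta \<tau> z * quintuple_theta \<tau> z) UNIV"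
    by (subst has_sum_reindex) (auto simp: inj_on_def o_def)
  also have "(\<lambda>k. h (2 * k + 1)) = (\<lambda>k. dedekind_eta \<tau> * (parity_sign k * qpow \<tau> ((2 * of_int k + 1)\<^sup>2 / 8) * zpow (2 * z) (2 * k + 1)))"
    unfolding h_def residue_theta_difference[OF assms] by (auto simp: parity_sign_def zpow_def mult_ac)
  finally show ?thesis
    using has_sum_cmult_right[OF jtheta_has_sum[OF assms, of "2 * z"], of "dedekind_eta \<tau>"] has_sum_unique by blast
qed

section \<open>Fourier series of holomorphic functions\<close>

text \<open>
  The characters of \<open>\<real> / \<int>\<close>.
\<close>

definition circle_char :: "int \<Rightarrow> real \<Rightarrow> complex" where
  "circle_char n x = exp (2 * of_real pi * \<i> * of_int n * of_real x)"

lemma circle_char_vector_derivative: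
  "((\<lambda>x. circle_char n x) has_vector_derivative (2 * of_real pi * \<i> * of_int n * circle_char n x)) (at x within S)"
proof -
  have "((\<lambda>z. exp (2 * of_real pi * \<i> * of_int n * z)) has_field_derivative
           (2 * of_real pi * \<i> * of_int n) * circle_char n x) (at (of_real x))"
    unfolding circle_char_def by (auto intro!: derivative_eq_intros)
  thus ?thesis
    unfolding circle_char_def by (rule has_vector_derivative_real_field)
qed

lemma circle_char_add: "circle_char (m + n) x = circle_char m x * circle_char n x"
  by (simp add: circle_char_def exp_add [symmetric] algebra_simps)

lemma circle_char_0 [simp]: "circle_char 0 x = 1" by (simp add: circle_char_def)

lemma norm_circle_char [simp]: "norm (circle_char n x) = 1" by (simp add: circle_char_def)

lemma continuous_on_circle_char [continuous_intros]: "continuous_on S (circle_char n)"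
  unfolding circle_char_def by (intro continuous_intros)

lemma circle_char_half: "circle_char n (1/2) = circle_char n (-1/2)"
proof -
  have "circle_char n (1/2) = circle_char n (-1/2) * exp (2 * of_int n * of_real pi * \<i>)"
    unfolding circle_char_def exp_add [symmetric] by (simp add: algebra_simps)
  also have "exp (2 * of_int n * of_real pi * \<i>) = (1 :: complex)"
    using exp_integer_2pi[of "of_int n"] by (simp add: mult_ac)
  finally show ?thesis by simp
qed

lemma has_integral_circle_char: "(circle_char n has_integral (if n = 0 then 1 else 0)) {-1/2..1/2}"
proof (cases "n = 0")
  case True
  thus ?thesis using has_integral_const_real[of "1::complex" "-1/2" "1/2"] by (simp add: circle_char_def[abs_def])
next
  case False
  define c where "c = 2 * of_real pi * \<i> * (of_int n :: complex)"
  have "c \<noteq> 0" using False by (simp add: c_def)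
  have "((\<lambda>x. circle_char n x / c) has_vector_derivative circle_char n x) (at x within {-1/2..1/2})" for x
    using has_vector_derivative_divide[OF circle_char_vector_derivative[of n x "{-1/2..1/2}"], of c] \<open>c \<noteq> 0\<close>
    by (simp add: c_def)
  hence "(circle_char n has_integral (circle_char n (1/2) / c - circle_char n (-1/2) / c)) {-1/2..1/2}"
    by (intro fundamental_theorem_of_calculus) auto
  thus ?thesis using False by (simp add: circle_char_half)
qed

lemma continuous_on_holomorphic_of_real:
  assumes "h holomorphic_on S" "of_real ` I \<subseteq> S"
  shows "continuous_on I (\<lambda>x. h (of_real x))"
  by (rule continuous_on_compose2[OF holomorphic_on_imp_continuous_on[OF assms(1)] _ assms(2)]) (intro continuous_intros)

lemma has_integral_times_circle_char:
  assumes "continuous_on {-1/2..1/2} f"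
  shows "((\<lambda>x. f x * circle_char n x) has_integral integral {-1/2..1/2} (\<lambda>x. f x * circle_char n x)) {-1/2..1/2}"
  by (intro integrable_integral integrable_continuous_real continuous_on_mult assms continuous_on_circle_char)

text \<open>
  Integration by parts: the boundary terms and the integral with the derivative of \<open>h\<close> are bounded
  independently of \<open>n\<close>.
\<close>

lemma riemann_lebesgue:
  assumes "open S" "h holomorphic_on S" "of_real ` {-1/2..1/2} \<subseteq> S"
  obtains K where "\<And>n. n \<noteq> 0 \<Longrightarrow> norm (integral {-1/2..1/2} (\<lambda>x. h (of_real x) * circle_char n x)) \<le> K / \<bar>of_int n\<bar>"
proof -
  define I where "I = {-1/2..1/2::real}"
  have hI: "continuous_on I (\<lambda>x. h (of_real x))" and h'I: "continuous_on I (\<lambda>x. deriv h (of_real x))"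
    unfolding I_def using assms by (intro continuous_on_holomorphic_of_real[of _ S] holomorphic_deriv; simp)+
  have "compact I" by (simp add: I_def)
  obtain A where A: "\<And>x. x \<in> I \<Longrightarrow> norm (h (of_real x)) \<le> A"
    using compact_imp_bounded[OF compact_continuous_image[OF hI \<open>compact I\<close>]] unfolding bounded_iff by blast
  obtain B where B: "\<And>x. x \<in> I \<Longrightarrow> norm (deriv h (of_real x)) \<le> B"
    using compact_imp_bounded[OF compact_continuous_image[OF h'I \<open>compact I\<close>]] unfolding bounded_iff by blast
  have half: "1/2 \<in> I" "-1/2 \<in> I" by (auto simp: I_def)
  show ?thesis
  proof (rule that[of "(2 * A + B) / (2 * pi)"])
    fix n :: int assume n: "n \<noteq> 0"
    define c where "c = 2 * of_real pi * \<i> * (of_int n :: complex)"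
    define b where "b = integral I (\<lambda>x. h (of_real x) * circle_char n x)"
    define b' where "b' = integral I (\<lambda>x. deriv h (of_real x) * circle_char n x)"
    have b: "((\<lambda>x. h (of_real x) * circle_char n x) has_integral b) I"
      unfolding b_def I_def by (rule has_integral_times_circle_char[OF hI[unfolded I_def]])
    have b': "((\<lambda>x. deriv h (of_real x) * circle_char n x) has_integral b') I"
      unfolding b'_def I_def by (rule has_integral_times_circle_char[OF h'I[unfolded I_def]])
    have "((\<lambda>x. h (of_real x) * circle_char n x) has_vector_derivative
             (h (of_real x) * (c * circle_char n x) + deriv h (of_real x) * circle_char n x)) (at x within I)" if "x \<in> I" for x
    proof -
      have "(h has_field_derivative deriv h (of_real x)) (at (of_real x))"
        using assms that by (intro holomorphic_derivI[of _ S]) (auto simp: I_def)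
      hence "((\<lambda>x. h (of_real x)) has_vector_derivative deriv h (of_real x)) (at x within I)"
        by (rule has_vector_derivative_real_field)
      from has_vector_derivative_mult[OF this circle_char_vector_derivative[of n x I]]
      show ?thesis unfolding c_def .
    qed
    hence "((\<lambda>x. h (of_real x) * (c * circle_char n x) + deriv h (of_real x) * circle_char n x) has_integral
             (h (of_real (1/2)) * circle_char n (1/2) - h (of_real (-1/2)) * circle_char n (-1/2))) I"
      unfolding I_def by (intro fundamental_theorem_of_calculus) auto
    moreover have "((\<lambda>x. c * (h (of_real x) * circle_char n x) + deriv h (of_real x) * circle_char n x) has_integral (c * b + b')) I"
      by (intro has_integral_add has_integral_mult_right b b')
    hence "((\<lambda>x. h (of_real x) * (c * circle_char n x) + deriv h (of_real x) * circle_char n x) has_integral (c * b + b')) I"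
      by (simp add: algebra_simps)
    ultimately have "c * b + b' = h (of_real (1/2)) * circle_char n (1/2) - h (of_real (-1/2)) * circle_char n (-1/2)"
      by (rule has_integral_unique[symmetric])
    hence "c * b = h (of_real (1/2)) * circle_char n (1/2) - h (of_real (-1/2)) * circle_char n (-1/2) - b'"
      by (simp add: algebra_simps)
    hence "norm (c * b) = norm (h (of_real (1/2)) * circle_char n (1/2) - h (of_real (-1/2)) * circle_char n (-1/2) - b')" by simp
    also have "\<dots> \<le> norm (h (of_real (1/2)) * circle_char n (1/2)) + norm (h (of_real (-1/2)) * circle_char n (-1/2)) + norm b'"
      using norm_triangle_ineq4 by (meson add_mono order.trans order_refl)
    also have "\<dots> \<le> A + A + B"
    proof (intro add_mono)
      show "norm (h (of_real (1/2)) * circle_char n (1/2)) \<le> A" "norm (h (of_real (-1/2)) * circle_char n (-1/2)) \<le> A"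
        using A[OF half(1)] A[OF half(2)] by (simp_all add: norm_mult)
      have "B \<ge> 0" using B[OF half(1)] norm_ge_zero order.trans by blast
      hence "norm b' \<le> B * measure lborel (cbox (-1/2) (1/2 :: real))"
        using b' B by (intro has_integral_bound[of B]) (auto simp: I_def norm_mult)
      thus "norm b' \<le> B" by simp
    qed
    finally have "norm c * norm b \<le> 2 * A + B" by (simp add: norm_mult)
    hence "2 * pi * \<bar>of_int n\<bar> * norm b \<le> 2 * A + B" by (simp add: c_def norm_mult)
    hence "norm b \<le> (2 * A + B) / (2 * pi) / \<bar>of_int n\<bar>" using n by (simp add: field_simps)
    thus "norm (integral {-1/2..1/2} (\<lambda>x. h (of_real x) * circle_char n x)) \<le> (2 * A + B) / (2 * pi) / \<bar>of_int n\<bar>"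
      by (simp add: b_def I_def)
  qed
qed

text \<open>
  Chernoff's argument. The quotient \<open>h z = (F z - F 0) / (exp (2\<pi>iz) - 1)\<close> is holomorphic for
  \<open>|Re z| < 1\<close>, and its Fourier coefficients make those of \<open>F - F 0\<close> telescope. By the
  Riemann-Lebesgue estimate both ends of the telescope tend to \<open>0\<close>.
\<close>

lemma fourier_series_at_0:
  assumes hol: "F holomorphic_on UNIV"
    and a: "\<And>n. ((\<lambda>x. F (of_real x) * circle_char (- n) x) has_integral a n) {-1/2..1/2}"
    and summable: "a summable_on UNIV"
  shows "(a has_sum F 0) UNIV"
proof -
  define g where "g = (\<lambda>z. F z - F 0)"
  define E where "E = (\<lambda>z. exp (2 * of_real pi * \<i> * z) - 1 :: complex)"
  \<comment> \<open>Dividing numerator and denominator of \<open>h\<close> by \<open>z\<close> removes the common zero at \<open>0\<close>.\<close>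
  define g1 where "g1 = (\<lambda>z. if z = 0 then deriv g 0 else g z / z)"
  define E1 where "E1 = (\<lambda>z. if z = 0 then deriv E 0 else E z / z)"
  have "g holomorphic_on UNIV" "E holomorphic_on UNIV"
    unfolding g_def E_def by (intro holomorphic_intros hol)+
  have g1: "g1 holomorphic_on UNIV"
    by (rule pole_theorem_open_0[OF \<open>g holomorphic_on UNIV\<close>, of 0]) (auto simp: g1_def g_def)
  have E1: "E1 holomorphic_on UNIV"
    by (rule pole_theorem_open_0[OF \<open>E holomorphic_on UNIV\<close>, of 0]) (auto simp: E1_def E_def)
  define S where "S = {z. Re z < 1} \<inter> {z. Re z > -1}"
  have "open S" unfolding S_def by (intro open_Int open_halfspace_Re_lt open_halfspace_Re_gt)
  have E1_nz: "E1 z \<noteq> 0" if "z \<in> S" for z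
  proof (cases "z = 0")
    case True
    have "(E has_field_derivative 2 * of_real pi * \<i>) (at 0)"
      unfolding E_def by (auto intro!: derivative_eq_intros)
    thus ?thesis using True by (simp add: E1_def DERIV_imp_deriv)
  next
    case False
    have "exp (2 * of_real pi * \<i> * z) \<noteq> 1"
    proof
      assume "exp (2 * of_real pi * \<i> * z) = 1"
      then obtain m :: int where m: "Im (2 * of_real pi * \<i> * z) = of_int (2 * m) * pi" "Re (2 * of_real pi * \<i> * z) = 0"
        unfolding exp_eq_1 by blast
      hence "Re z = of_int m" "Im z = 0" by simp_all
      moreover from this have "m = 0" using that by (auto simp: S_def)
      ultimately show False using False by (simp add: complex_eq_iff)
    qed
    thus ?thesis using False by (simp add: E1_def E_def)
  qed
  define h where "h = (\<lambda>z. g1 z / E1 z)"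
  have "h holomorphic_on S"
    unfolding h_def using E1_nz by (intro holomorphic_intros holomorphic_on_subset[OF g1] holomorphic_on_subset[OF E1]) auto
  have IS: "of_real ` {-1/2..1/2} \<subseteq> S" by (auto simp: S_def)
  have F_eq: "F z = F 0 + E z * h z" if "z \<in> S" for z
  proof (cases "z = 0")
    case False
    thus ?thesis using E1_nz[OF that] by (simp add: h_def g1_def E1_def g_def)
  qed (simp add: E_def)
  define b where "b = (\<lambda>n. integral {-1/2..1/2} (\<lambda>x. h (of_real x) * circle_char n x))"
  have cont: "continuous_on {-1/2..1/2} (\<lambda>x::real. h (of_real x))"
    by (rule continuous_on_holomorphic_of_real[OF \<open>h holomorphic_on S\<close> IS])
  have b: "((\<lambda>x. h (of_real x) * circle_char n x) has_integral b n) {-1/2..1/2}" for n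
    unfolding b_def by (rule has_integral_times_circle_char[OF cont])
  have a_eq: "a n = F 0 * (if n = 0 then 1 else 0) + b (1 - n) - b (- n)" for n
  proof -
    have "((\<lambda>x. F 0 * circle_char (-n) x + h (of_real x) * circle_char (1 - n) x - h (of_real x) * circle_char (- n) x) has_integral
            (F 0 * (if - n = 0 then 1 else 0) + b (1 - n) - b (- n))) {-1/2..1/2}"
      by (intro has_integral_add has_integral_diff has_integral_mult_right has_integral_circle_char b)
    also have "?this \<longleftrightarrow> ((\<lambda>x. F (of_real x) * circle_char (- n) x) has_integral (F 0 * (if - n = 0 then 1 else 0) + b (1 - n) - b (- n))) {-1/2..1/2}"
    proof (rule has_integral_cong)
      fix x :: real assume "x \<in> {-1/2..1/2}"
      with IS have *: "F (of_real x) = F 0 + E (of_real x) * h (of_real x)" by (intro F_eq) auto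
      have **: "E (of_real x) = circle_char 1 x - 1" by (simp add: E_def circle_char_def)
      show "F 0 * circle_char (-n) x + h (of_real x) * circle_char (1 - n) x - h (of_real x) * circle_char (- n) x = F (of_real x) * circle_char (- n) x"
        unfolding * ** using circle_char_add[of 1 "-n" x] by (simp add: algebra_simps)
    qed
    finally show ?thesis using has_integral_unique[OF a[of n]] by simp
  qed
  have sum_eq: "(\<Sum>n\<in>{-int N..int N}. a n) = F 0 + b (1 + int N) - b (- int N)" for N
  proof (induction N)
    case 0
    show ?case by (simp add: a_eq)
  next
    case (Suc N)
    show ?case unfolding sum_symmetric_int_Suc Suc.IH by (simp add: a_eq add_ac)
  qed
  obtain K where K: "\<And>n. n \<noteq> 0 \<Longrightarrow> norm (b n) \<le> K / \<bar>of_int n\<bar>"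
    using riemann_lebesgue[OF \<open>open S\<close> \<open>h holomorphic_on S\<close> IS] unfolding b_def by metis
  have K0: "(\<lambda>N. K / real N) \<longlonglongrightarrow> 0"
    by (rule lim_const_over_n)
  have bound: "norm (b (- int N)) \<le> K / real N" "norm (b (int N)) \<le> K / real N" if "N \<ge> 1" for N
    using K[of "- int N"] K[of "int N"] that by simp_all
  have b1: "(\<lambda>N. b (- int N)) \<longlonglongrightarrow> 0"
    by (rule Lim_null_comparison[OF _ K0], rule eventually_sequentiallyI[of 1], rule bound)
  have "(\<lambda>N. b (int N)) \<longlonglongrightarrow> 0"
    by (rule Lim_null_comparison[OF _ K0], rule eventually_sequentiallyI[of 1], rule bound)
  from LIMSEQ_Suc[OF this] have b2: "(\<lambda>N. b (1 + int N)) \<longlonglongrightarrow> 0" by simp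
  have "(\<lambda>N. F 0 + b (1 + int N) - b (- int N)) \<longlonglongrightarrow> F 0 + 0 - 0"
    by (intro tendsto_intros b1 b2)
  hence "(\<lambda>N. \<Sum>n\<in>{-int N..int N}. a n) \<longlonglongrightarrow> F 0" by (simp add: sum_eq)
  moreover from summable obtain s where s: "(a has_sum s) UNIV" by (auto simp: summable_on_def)
  note tendsto_sum_symmetric_int[OF s]
  ultimately have "s = F 0" using LIMSEQ_unique by blast
  with s show ?thesis by simp
qed

text \<open>
  An affine substitution in the characteristic function of the normal distribution.
\<close>

lemma gaussian_fourier_transform:
  fixes t x0 :: real and n :: int
  assumes "t > 0"
  defines "g \<equiv> \<lambda>x. of_real (exp (- pi * t * (x + x0)\<^sup>2)) * circle_char (- n) x"
  shows "integrable lborel g"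
    and "integral\<^sup>L lborel g = circle_char n x0 * of_real (exp (- pi * of_int n ^ 2 / t) / sqrt t)"
proof -
  define c where "c = sqrt (2 * pi * t)"
  have c: "c > 0" "c\<^sup>2 = 2 * pi * t" using assms by (auto simp: c_def)
  define s where "s = - 2 * pi * of_int n / c"
  define k where "k = (\<lambda>y. complex_of_real (std_normal_density y) * iexp (s * y))"
  have "integrable std_normal_distribution (\<lambda>y. iexp (s * y))"
    using prob_space.integrable_iexp[OF prob_space_normal_density[of 1 0]] by simp
  hence int_k: "integrable lborel k"
    by (subst (asm) integrable_density) (auto simp: k_def scaleR_conv_of_real)
  have "char std_normal_distribution s = integral\<^sup>L lborel k"
    unfolding char_def k_def
    by (subst integral_density) (auto simp: scaleR_conv_of_real)
  hence k_val: "integral\<^sup>L lborel k = of_real (exp (- (s\<^sup>2) / 2))"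
    by (simp add: char_std_normal_distribution)
  have g_eq: "g x = of_real (sqrt (2 * pi)) * circle_char n x0 * k (c * x0 + c * x)" for x
  proof -
    have "exp (- pi * t * (x + x0)\<^sup>2) = sqrt (2 * pi) * std_normal_density (c * x0 + c * x)"
    proof -
      have "(c * x0 + c * x)\<^sup>2 = c\<^sup>2 * (x + x0)\<^sup>2" by (simp add: power2_eq_square algebra_simps)
      thus ?thesis unfolding std_normal_density_def c by simp
    qed
    moreover have "circle_char (- n) x = circle_char n x0 * iexp (s * (c * x0 + c * x))"
    proof -
      have "s * (c * x0 + c * x) = - 2 * pi * of_int n * (x0 + x)" using c(1) by (simp add: s_def field_simps)
      hence "iexp (s * (c * x0 + c * x)) = exp (\<i> * of_real (- 2 * pi * of_int n * (x0 + x)))" by (simp only:)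
      thus ?thesis by (simp add: circle_char_def exp_add [symmetric] algebra_simps)
    qed
    ultimately show ?thesis by (simp add: g_def k_def mult_ac)
  qed
  have "integrable lborel (\<lambda>x. k (c * x0 + c * x))"
    using int_k c(1) by (subst lborel_integrable_real_affine_iff) auto
  thus "integrable lborel g" unfolding g_eq[abs_def] by (intro integrable_mult_right)
  have "integral\<^sup>L lborel k = \<bar>c\<bar> *\<^sub>R integral\<^sup>L lborel (\<lambda>x. k (c * x0 + c * x))"
    using c(1) by (intro lborel_integral_real_affine) auto
  hence "integral\<^sup>L lborel (\<lambda>x. k (c * x0 + c * x)) = of_real (exp (- (s\<^sup>2) / 2) / c)"
    using c(1) by (simp add: k_val scaleR_conv_of_real field_simps)
  hence "integral\<^sup>L lborel g = of_real (sqrt (2 * pi)) * circle_char n x0 * of_real (exp (- (s\<^sup>2) / 2) / c)"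
    unfolding g_eq[abs_def] by simp
  also have "- (s\<^sup>2) / 2 = - pi * of_int n ^ 2 / t"
  proof -
    have "s\<^sup>2 = (2 * pi * of_int n)\<^sup>2 / c\<^sup>2" by (simp add: s_def power_divide)
    thus ?thesis unfolding c using assms by (simp add: power2_eq_square field_simps)
  qed
  finally show "integral\<^sup>L lborel g = circle_char n x0 * of_real (exp (- pi * of_int n ^ 2 / t) / sqrt t)"
    by (simp add: c_def real_sqrt_mult field_simps)
qed

section \<open>Poisson summation for Gaussians\<close>

lemma theta_series_has_field_derivative:
  assumes c: "\<And>n. norm (c n) \<le> 1" and "Im \<tau> > 0"
  shows "\<exists>p. ((\<lambda>t. theta_series c t z) has_field_derivative p) (at \<tau>)"
    and "\<exists>q. ((\<lambda>w. theta_series c \<tau> w) has_field_derivative q) (at z)"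
proof -
  obtain p q where pq: "((\<lambda>(t, w). theta_series c t w) has_derivative (\<lambda>(h, k). p * h + q * k)) (at (\<tau>, z))"
    using theta_series_has_derivative[where c = c and \<tau> = \<tau> and z = z, OF assms] by blast
  have "((\<lambda>t. (t, z)) has_derivative (\<lambda>h. (h, 0))) (at \<tau>)" by (auto intro!: derivative_eq_intros)
  from has_derivative_compose[OF this pq]
  have "((\<lambda>t. theta_series c t z) has_field_derivative p) (at \<tau>)"
    unfolding has_field_derivative_def by simp
  thus "\<exists>p. ((\<lambda>t. theta_series c t z) has_field_derivative p) (at \<tau>)" ..
  have "((\<lambda>w. (\<tau>, w)) has_derivative (\<lambda>h. (0, h))) (at z)" by (auto intro!: derivative_eq_intros)
  from has_derivative_compose[OF this pq]
  have "((\<lambda>w. theta_series c \<tau> w) has_field_derivative q) (at z)"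
    unfolding has_field_derivative_def by simp
  thus "\<exists>q. ((\<lambda>w. theta_series c \<tau> w) has_field_derivative q) (at z)" ..
qed

lemma theta_series_holomorphic_right [holomorphic_intros]:
  assumes "\<And>n. norm (c n) \<le> 1" "Im \<tau> > 0" "f holomorphic_on A"
  shows "(\<lambda>w. theta_series c \<tau> (f w)) holomorphic_on A"
proof -
  have "theta_series c \<tau> holomorphic_on UNIV"
    using theta_series_has_field_derivative(2)[OF assms(1,2)]
    by (auto simp: holomorphic_on_def field_differentiable_def)
  from holomorphic_on_compose_gen[OF assms(3) this] show ?thesis by (simp add: o_def)
qed

lemma theta_series_holomorphic_on_H:
  assumes "\<And>n. norm (c n) \<le> 1" "open A" "f holomorphic_on A" "g holomorphic_on A" "\<And>t. t \<in> A \<Longrightarrow> Im (f t) > 0"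
  shows "(\<lambda>t. theta_series c (f t) (g t)) holomorphic_on A"
  unfolding holomorphic_on_open[OF assms(2)]
proof
  fix t assume t: "t \<in> A"
  obtain f' g' where f': "(f has_field_derivative f') (at t)" and g': "(g has_field_derivative g') (at t)"
    using assms(3,4) t unfolding holomorphic_on_open[OF assms(2)] by blast
  obtain p q where pq: "((\<lambda>(t, w). theta_series c t w) has_derivative (\<lambda>(h, k). p * h + q * k)) (at (f t, g t))"
    using theta_series_has_derivative[where c = c and \<tau> = "f t" and z = "g t", OF assms(1) assms(5)[OF t]] by blast
  have "((\<lambda>t. (f t, g t)) has_derivative (\<lambda>h. (f' * h, g' * h))) (at t)"
    using f' g' unfolding has_field_derivative_def by (intro has_derivative_Pair)
  from has_derivative_compose[OF this pq]
  have "((\<lambda>t. theta_series c (f t) (g t)) has_field_derivative (p * f' + q * g')) (at t)"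
    unfolding has_field_derivative_def prod.case by (rule has_derivative_eq_rhs) (simp add: fun_eq_iff algebra_simps)
  thus "\<exists>f'. ((\<lambda>t. theta_series c (f t) (g t)) has_field_derivative f') (at t)" ..
qed

abbreviation theta :: "complex \<Rightarrow> complex \<Rightarrow> complex" where
  "theta \<equiv> theta_series (\<lambda>_. 1)"

lemma theta_has_sum:
  assumes "Im \<tau> > 0"
  shows "((\<lambda>n. exp (of_real pi * \<i> * (of_int n ^ 2 * \<tau> + 2 * of_int n * z))) has_sum theta \<tau> z) UNIV"
  using theta_series_has_sum[of "\<lambda>_. 1" \<tau> z] assms by simp

lemma theta_minus: "theta \<tau> (- z) = theta \<tau> z"
  unfolding theta_series_def
  by (rule infsum_reindex_bij_witness[of _ uminus uminus]) auto

text \<open>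
  The sum of \<open>exp (-\<pi>t (z + k)\<^sup>2)\<close> over all integers \<open>k\<close>, written by means of the theta function because
  this shows that it is entire in \<open>z\<close>.
\<close>

definition gaussian_sum :: "real \<Rightarrow> complex \<Rightarrow> complex" where
  "gaussian_sum t z = exp (- of_real (pi * t) * z\<^sup>2) * theta (\<i> * of_real t) (\<i> * of_real t * z)"

lemma gaussian_sum_has_sum:
  assumes "t > 0"
  shows "((\<lambda>k. exp (- of_real (pi * t) * (z + of_int k)\<^sup>2)) has_sum gaussian_sum t z) UNIV"
proof -
  have "exp (- of_real (pi * t) * z\<^sup>2) * exp (of_real pi * \<i> * (of_int k ^ 2 * (\<i> * of_real t) + 2 * of_int k * (\<i> * of_real t * z)))
           = exp (- of_real (pi * t) * (z + of_int k)\<^sup>2)" for k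
    unfolding exp_add [symmetric] by (rule arg_cong[of _ _ exp]) (simp add: power2_eq_square algebra_simps)
  moreover have "Im (\<i> * of_real t) > 0" using assms by simp
  note has_sum_cmult_right[OF theta_has_sum[OF this, of "\<i> * of_real t * z"], of "exp (- of_real (pi * t) * z\<^sup>2)"]
  ultimately show ?thesis unfolding gaussian_sum_def by simp
qed

lemma circle_char_shift: "circle_char n (x + of_int k) = circle_char n x"
proof -
  have "circle_char n (x + of_int k) = circle_char n x * exp (2 * of_int (n * k) * of_real pi * \<i>)"
    by (simp add: circle_char_def exp_add [symmetric] algebra_simps)
  thus ?thesis using exp_integer_2pi[of "of_int (n * k)"] by (simp add: mult_ac)
qed

text \<open>
  Unfolding: integrating the periodised Gaussian over one period is integrating a single Gaussian over
  the line. Uniform convergence allows to integrate termwise, the intervals \<open>[k - 1/2, k + 1/2]\<close> are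
  glued together, and dominated convergence exhausts the line.
\<close>

lemma gaussian_sum_fourier_coefficient:
  assumes "t > 0"
  shows "((\<lambda>x. gaussian_sum t (of_real (x + x0)) * circle_char (- n) x) has_integral
            circle_char n x0 * of_real (exp (- pi * of_int n ^ 2 / t) / sqrt t)) {-1/2..1/2}"
proof -
  define g where "g = (\<lambda>x. of_real (exp (- pi * t * (x + x0)\<^sup>2)) * circle_char (- n) x)"
  define f where "f = (\<lambda>(k::int) x. g (x + of_int k))"
  define R where "R = \<bar>x0\<bar> + 1/2"
  define M where "M = (\<lambda>k::int. (1 + \<bar>of_int k\<bar>)\<^sup>2 * exp ((2 * pi * t * R) * \<bar>of_int k\<bar> - (pi * t) * of_int k ^ 2))"
  have M: "M summable_on UNIV"
    unfolding M_def using assms by (intro summable_on_gaussian) auto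
  have cont_g: "continuous_on A g" for A
    unfolding g_def by (intro continuous_intros)
  have f_alt: "f k x = exp (- of_real (pi * t) * (of_real (x + x0) + of_int k)\<^sup>2) * circle_char (- n) x" for k x
  proof -
    have "complex_of_real (- pi * t * (x + of_int k + x0)\<^sup>2) = - of_real (pi * t) * (of_real (x + x0) + of_int k)\<^sup>2"
      by (simp add: power2_eq_square algebra_simps)
    thus ?thesis unfolding f_def g_def circle_char_shift exp_of_real [symmetric] by (simp only:)
  qed
  have f_sum: "((\<lambda>k. f k x) has_sum gaussian_sum t (of_real (x + x0)) * circle_char (- n) x) UNIV" for x
    unfolding f_alt by (intro has_sum_cmult_left gaussian_sum_has_sum assms)
  have f_bound: "norm (f k x) \<le> M k" if "x \<in> cbox (-1/2) (1/2)" for k x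
  proof -
    have x: "\<bar>x + x0\<bar> \<le> R" using that by (auto simp: R_def)
    have "norm (f k x) = exp (- pi * t * (x + of_int k + x0)\<^sup>2)"
      by (simp add: f_def g_def norm_mult)
    also have "- pi * t * (x + of_int k + x0)\<^sup>2 \<le> (2 * pi * t * R) * \<bar>of_int k\<bar> - (pi * t) * of_int k ^ 2"
    proof -
      have "- ((x + x0) * of_int k) \<le> \<bar>x + x0\<bar> * \<bar>of_int k\<bar>"
        unfolding abs_mult [symmetric] by simp
      also have "\<dots> \<le> R * \<bar>of_int k\<bar>" using x by (intro mult_right_mono) auto
      moreover have "(x + of_int k + x0)\<^sup>2 = (x + x0)\<^sup>2 + 2 * ((x + x0) * of_int k) + of_int k ^ 2"
        by (simp add: power2_eq_square algebra_simps)
      moreover have "(x + x0)\<^sup>2 \<ge> 0" by simp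
      ultimately have "- ((x + of_int k + x0)\<^sup>2) \<le> 2 * R * \<bar>of_int k\<bar> - of_int k ^ 2" by linarith
      hence "(pi * t) * (- ((x + of_int k + x0)\<^sup>2)) \<le> (pi * t) * (2 * R * \<bar>of_int k\<bar> - of_int k ^ 2)"
        using assms by (intro mult_left_mono) auto
      thus ?thesis by (simp add: algebra_simps)
    qed
    also have "exp ((2 * pi * t * R) * \<bar>of_int k\<bar> - (pi * t) * of_int k ^ 2) \<le> M k"
    proof -
      have "(1::real) ^ 2 \<le> (1 + \<bar>of_int k\<bar>)\<^sup>2" by (intro power_mono) auto
      thus ?thesis unfolding M_def by simp
    qed
    finally show ?thesis by simp
  qed
  have unif: "uniform_limit (cbox (-1/2) (1/2)) (\<lambda>X x. \<Sum>k\<in>X. f k x)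
          (\<lambda>x. gaussian_sum t (of_real (x + x0)) * circle_char (- n) x) (finite_subsets_at_top UNIV)"
    by (rule Weierstrass_m_test_general'[OF f_bound f_sum M])
  have cont_f: "continuous_on A (f k)" for A k
    unfolding f_def by (rule continuous_on_compose2[OF cont_g[of UNIV]]) (auto intro!: continuous_intros)
  have "continuous_on (cbox (-1/2) (1/2)) (\<lambda>x. \<Sum>k\<in>X. f k x)" for X
    by (intro continuous_on_sum cont_f)
  from uniform_limit_integral_cbox[OF unif this] obtain I J where
      I: "\<And>X. ((\<lambda>x. \<Sum>k\<in>X. f k x) has_integral I X) (cbox (-1/2) (1/2))" and
      J: "((\<lambda>x. gaussian_sum t (of_real (x + x0)) * circle_char (- n) x) has_integral J) (cbox (-1/2) (1/2))" and
      lim: "(I \<longlongrightarrow> J) (finite_subsets_at_top UNIV)" by auto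
  define i where "i = (\<lambda>k. integral {of_int k - 1/2..of_int k + 1/2} g)"
  have f_int: "(f k has_integral i k) {-1/2..1/2}" for k
  proof -
    have "(f k has_integral integral {-1/2..1/2} (f k)) {-1/2..1/2}"
      by (intro integrable_integral integrable_continuous_real cont_f)
    also have "integral {-1/2..1/2} (f k) = i k"
      using integral_shift_real_ivl[of "of_int k - 1/2" "of_int k" "of_int k + 1/2" g] by (simp add: i_def f_def)
    finally show ?thesis .
  qed
  have I_eq: "I X = sum i X" if "finite X" for X
    using has_integral_unique[OF I[of X]] has_integral_sum[OF that, of f i "{-1/2..1/2}"] f_int by simp
  have "(i has_sum J) UNIV"
    unfolding has_sum_def
  proof (rule Lim_transform_eventually[OF lim])
    show "\<forall>\<^sub>F X in finite_subsets_at_top UNIV. I X = sum i X"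
      by (rule eventually_finite_subsets_at_top_weakI) (rule I_eq)
  qed
  from tendsto_sum_symmetric_int[OF this]
  have lim1: "(\<lambda>N. \<Sum>k\<in>{-int N..int N}. i k) \<longlonglongrightarrow> J" .
  have sum_i: "(\<Sum>k\<in>{-int N..int N}. i k) = integral {- real N - 1/2..real N + 1/2} g" for N
  proof (induction N)
    case 0
    show ?case by (simp add: i_def)
  next
    case (Suc N)
    have int: "g integrable_on {a..b}" for a b by (intro integrable_continuous_real cont_g)
    have "integral {- real (Suc N) - 1/2..real (Suc N) + 1/2} g =
            integral {- real (Suc N) - 1/2..- real N - 1/2} g + integral {- real N - 1/2..real (Suc N) + 1/2} g"
      by (rule Henstock_Kurzweil_Integration.integral_combine[symmetric]) (use int in auto)
    also have "integral {- real N - 1/2..real (Suc N) + 1/2} g =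
            integral {- real N - 1/2..real N + 1/2} g + integral {real N + 1/2..real (Suc N) + 1/2} g"
      by (rule Henstock_Kurzweil_Integration.integral_combine[symmetric]) (use int in auto)
    finally have *: "integral {- real (Suc N) - 1/2..real (Suc N) + 1/2} g = integral {- real (Suc N) - 1/2..- real N - 1/2} g +
            (integral {- real N - 1/2..real N + 1/2} g + integral {real N + 1/2..real (Suc N) + 1/2} g)" .
    show ?case
    proof -
      have "i (int (Suc N)) = integral {real N + 1/2..real (Suc N) + 1/2} g"
           "i (- int (Suc N)) = integral {- real (Suc N) - 1/2..- real N - 1/2} g"
        unfolding i_def by (rule arg_cong2[of _ _ _ _ integral]; simp)+
      thus ?thesis unfolding sum_symmetric_int_Suc Suc.IH * by (simp only: add_ac)
    qed
  qed
  have int_g: "integrable lborel g"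
    unfolding g_def by (rule gaussian_fourier_transform(1)[OF assms])
  have "(\<lambda>N. \<integral>x. indicator {- real N - 1/2..real N + 1/2} x *\<^sub>R g x \<partial>lborel) \<longlonglongrightarrow> integral\<^sup>L lborel g"
  proof (rule integral_dominated_convergence[where w = "\<lambda>x. norm (g x)"])
    show "AE x in lborel. (\<lambda>N. indicator {- real N - 1/2..real N + 1/2} x *\<^sub>R g x) \<longlonglongrightarrow> g x"
    proof (rule AE_I2)
      fix x :: real
      have "\<forall>\<^sub>F N in sequentially. indicator {- real N - 1/2..real N + 1/2} x *\<^sub>R g x = g x"
      proof (rule eventually_sequentiallyI[of "nat \<lceil>\<bar>x\<bar>\<rceil>"])
        fix N assume "nat \<lceil>\<bar>x\<bar>\<rceil> \<le> N"
        hence "\<bar>x\<bar> \<le> real N" by linarith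
        hence "x \<in> {- real N - 1/2..real N + 1/2}" by auto
        thus "indicator {- real N - 1/2..real N + 1/2} x *\<^sub>R g x = g x" by simp
      qed
      thus "(\<lambda>N. indicator {- real N - 1/2..real N + 1/2} x *\<^sub>R g x) \<longlonglongrightarrow> g x"
        by (rule tendsto_eventually)
    qed
    show "AE x in lborel. norm (indicator {- real N - 1/2..real N + 1/2} x *\<^sub>R g x) \<le> norm (g x)" for N
      by (rule AE_I2) (auto simp: indicator_def)
  qed (use int_g in auto)
  also have "(\<lambda>N. \<integral>x. indicator {- real N - 1/2..real N + 1/2} x *\<^sub>R g x \<partial>lborel) =
               (\<lambda>N. integral {- real N - 1/2..real N + 1/2} g)"
  proof
    fix N
    have "set_integrable lborel {- real N - 1/2..real N + 1/2} g"
      using int_g unfolding set_integrable_def by (intro integrable_mult_indicator) auto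
    from set_borel_integral_eq_integral(2)[OF this]
    show "(\<integral>x. indicator {- real N - 1/2..real N + 1/2} x *\<^sub>R g x \<partial>lborel) = integral {- real N - 1/2..real N + 1/2} g"
      by (simp add: set_lebesgue_integral_def)
  qed
  finally have "J = integral\<^sup>L lborel g"
    using LIMSEQ_unique[OF lim1] by (simp add: sum_i)
  also have "\<dots> = circle_char n x0 * of_real (exp (- pi * of_int n ^ 2 / t) / sqrt t)"
    unfolding g_def by (rule gaussian_fourier_transform(2)[OF assms])
  finally show ?thesis using J by simp
qed

lemma gaussian_poisson:
  assumes "t > 0"
  shows "gaussian_sum t (of_real x) = theta (\<i> / of_real t) (of_real x) / of_real (sqrt t)"
proof -
  have "Im (\<i> / of_real t) > 0" using assms by simp
  note sum = has_sum_divide_const[OF theta_has_sum[OF this, of "of_real x"], of "of_real (sqrt t)"]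
  have eq: "exp (of_real pi * \<i> * (of_int n ^ 2 * (\<i> / of_real t) + 2 * of_int n * of_real x)) / of_real (sqrt t) =
        circle_char n x * of_real (exp (- pi * of_int n ^ 2 / t) / sqrt t)" for n
  proof -
    have "complex_of_real (exp (- pi * of_int n ^ 2 / t)) = exp (- of_real pi * of_int n ^ 2 / of_real t)"
      by (simp flip: exp_of_real)
    moreover have "exp (of_real pi * \<i> * (of_int n ^ 2 * (\<i> / of_real t) + 2 * of_int n * of_real x)) =
        circle_char n x * exp (- of_real pi * of_int n ^ 2 / of_real t)"
      unfolding circle_char_def exp_add [symmetric] by (rule arg_cong[of _ _ exp]) (simp add: algebra_simps)
    ultimately show ?thesis by simp
  qed
  have "((\<lambda>n. circle_char n x * of_real (exp (- pi * of_int n ^ 2 / t) / sqrt t)) has_sum gaussian_sum t (0 + of_real x)) UNIV"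
  proof (rule fourier_series_at_0[where F = "\<lambda>z. gaussian_sum t (z + of_real x)"])
    show "(\<lambda>z. gaussian_sum t (z + of_real x)) holomorphic_on UNIV"
      unfolding gaussian_sum_def using assms by (intro holomorphic_intros) auto
    show "((\<lambda>y. gaussian_sum t (of_real y + of_real x) * circle_char (- n) y) has_integral
        circle_char n x * of_real (exp (- pi * of_int n ^ 2 / t) / sqrt t)) {-1/2..1/2}" for n
      using gaussian_sum_fourier_coefficient[OF assms, of x n] by simp
    show "(\<lambda>n. circle_char n x * of_real (exp (- pi * of_int n ^ 2 / t) / sqrt t)) summable_on UNIV"
      using sum unfolding eq by (auto simp: summable_on_def)
  qed
  from has_sum_unique[OF this sum[unfolded eq]] show ?thesis by simp
qed

section \<open>Inversion of theta functions and of eta\<close>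

lemma of_real_islimpt_0: "(0::complex) islimpt range of_real"
  unfolding islimpt_approachable
proof (intro allI impI)
  fix e :: real assume "e > 0"
  thus "\<exists>x'\<in>range of_real. x' \<noteq> (0::complex) \<and> dist x' 0 < e"
    by (intro bexI[OF _ rangeI[of _ "e / 2"]]) auto
qed

lemma imaginary_axis_islimpt: "\<i> islimpt ((\<lambda>t. \<i> * of_real t) ` {0<..})"
  unfolding islimpt_approachable
proof (intro allI impI)
  fix e :: real assume "e > 0"
  moreover have "dist (\<i> * of_real (1 + e / 2)) \<i> = \<bar>e / 2\<bar>"
  proof -
    have "\<i> * of_real (1 + e / 2) - \<i> = \<i> * of_real (e / 2)" by (simp add: algebra_simps)
    thus ?thesis unfolding dist_norm by (simp only: norm_mult norm_ii norm_of_real mult_1_left)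
  qed
  moreover from this have "\<i> * of_real (1 + e / 2) \<noteq> \<i>" using \<open>e > 0\<close> by auto
  ultimately show "\<exists>x'\<in>(\<lambda>t. \<i> * of_real t) ` {0<..}. x' \<noteq> \<i> \<and> dist x' \<i> < e"
    by (intro bexI[OF _ imageI[of "1 + e / 2"]]) auto
qed

lemma Im_minus_inverse: "Im \<tau> > 0 \<Longrightarrow> Im (- 1 / \<tau>) > 0"
  by (simp add: Im_divide add_pos_nonneg zero_less_divide_iff) (metis sum_power2_gt_zero_iff power2_eq_square less_irrefl add_nonneg_pos zero_le_power2 zero_less_power)

lemma open_H: "open {t. Im t > 0}" and connected_H: "connected {t. Im t > 0}"
  by (rule open_halfspace_Im_gt, rule convex_connected, rule convex_halfspace_Im_gt)

text \<open>
  Both sides are holomorphic in \<open>z\<close> and in \<open>\<tau>\<close>. Poisson summation gives equality for \<open>\<tau>\<close> on the imaginary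
  axis and real \<open>z\<close>; the identity theorem extends it first to all \<open>z\<close> and then to all \<open>\<tau>\<close>.
\<close>

lemma theta_S_transform:
  assumes "Im \<tau> > 0"
  shows "theta (- 1 / \<tau>) (z / \<tau>) = csqrt (\<tau> / \<i>) * exp (of_real pi * \<i> * z\<^sup>2 / \<tau>) * theta \<tau> z"
proof -
  define D where "D = (\<lambda>\<tau> z. theta (- 1 / \<tau>) (z / \<tau>) - csqrt (\<tau> / \<i>) * exp (of_real pi * \<i> * z\<^sup>2 / \<tau>) * theta \<tau> z)"
  have D_real: "D (\<i> * of_real t) (of_real x) = 0" if "t > 0" for t x
  proof -
    have "gaussian_sum (1 / t) (of_real (- x)) = theta (\<i> * of_real t) (of_real x) * of_real (sqrt t)"
      using gaussian_poisson[of "1 / t" "- x"] that by (simp add: theta_minus real_sqrt_divide)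
    moreover have "gaussian_sum (1 / t) (of_real (- x)) = exp (- of_real (pi / t) * of_real x ^ 2) * theta (\<i> / of_real t) (- (\<i> * of_real x / of_real t))"
      by (simp add: gaussian_sum_def)
    ultimately have *: "exp (- of_real (pi / t) * of_real x ^ 2) * theta (\<i> / of_real t) (- (\<i> * of_real x / of_real t)) =
                         theta (\<i> * of_real t) (of_real x) * of_real (sqrt t)" by simp
    have e: "exp (of_real pi * \<i> * of_real x ^ 2 / (\<i> * of_real t)) * exp (- of_real (pi / t) * of_real x ^ 2) = (1::complex)"
      unfolding exp_add [symmetric] using that by simp
    have args: "- 1 / (\<i> * of_real t) = \<i> / complex_of_real t" "of_real x / (\<i> * of_real t) = - (\<i> * of_real x / complex_of_real t)"
      "csqrt (\<i> * of_real t / \<i>) = of_real (sqrt t)"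
      using that by (auto simp: field_simps)
    have "theta (\<i> / of_real t) (- (\<i> * of_real x / of_real t)) =
            exp (of_real pi * \<i> * of_real x ^ 2 / (\<i> * of_real t)) * (exp (- of_real (pi / t) * of_real x ^ 2) * theta (\<i> / of_real t) (- (\<i> * of_real x / of_real t)))"
      unfolding mult.assoc [symmetric] e by simp
    thus ?thesis unfolding D_def args * by simp
  qed
  have D_imag: "D (\<i> * of_real t) z = 0" if "t > 0" for t z
  proof (rule analytic_continuation[of "D (\<i> * of_real t)" UNIV "range of_real" 0])
    have "Im (- 1 / (\<i> * of_real t)) > 0" using that by (intro Im_minus_inverse) simp
    thus "D (\<i> * of_real t) holomorphic_on UNIV"
      unfolding D_def using that by (intro holomorphic_intros) auto
  qed (use D_real[OF that] of_real_islimpt_0 in auto)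
  have "D \<tau> z = 0"
  proof (rule analytic_continuation[of "\<lambda>\<tau>. D \<tau> z" "{t. Im t > 0}" "(\<lambda>t. \<i> * of_real t) ` {0<..}" \<i>])
    show "(\<lambda>\<tau>. D \<tau> z) holomorphic_on {t. Im t > 0}"
      unfolding D_def
    proof (intro holomorphic_on_diff holomorphic_on_mult theta_series_holomorphic_on_H holomorphic_intros open_H)
      show "t / \<i> \<notin> \<real>\<^sub>\<le>\<^sub>0" if "t \<in> {t. Im t > 0}" for t
        using that by (auto simp: complex_nonpos_Reals_iff)
    qed (use Im_minus_inverse in auto)
  qed (use D_imag open_H connected_H imaginary_axis_islimpt assms in auto)
  thus ?thesis by (simp add: D_def)
qed

lemma parity_sign_eq_exp: "parity_sign k = exp (of_real pi * \<i> * of_int k)"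
proof (cases "even k")
  case True
  then obtain m where "k = 2 * m" by (elim evenE)
  thus ?thesis using exp_integer_2pi[of "of_int m"] by (simp add: parity_sign_def mult_ac)
next
  case False
  then obtain m where "k = 2 * m + 1" by (elim oddE)
  thus ?thesis using exp_integer_2pi_plus1[of "of_int m"] by (simp add: parity_sign_def mult_ac)
qed

lemma jtheta_eq_theta:
  assumes "Im \<tau> > 0"
  shows "jtheta \<tau> z = exp (of_real pi * \<i> * (\<tau> / 4 + z)) * theta \<tau> (z + \<tau> / 2 + 1 / 2)"
proof -
  have eq: "parity_sign k * qpow \<tau> ((2 * of_int k + 1)\<^sup>2 / 8) * zpow z (2 * k + 1) =
          exp (of_real pi * \<i> * (\<tau> / 4 + z)) * exp (of_real pi * \<i> * (of_int k ^ 2 * \<tau> + 2 * of_int k * (z + \<tau> / 2 + 1 / 2)))" for k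
    unfolding parity_sign_eq_exp qpow_def zpow_def exp_add [symmetric]
    by (rule arg_cong[of _ _ exp]) (simp add: power2_eq_square field_simps)
  show ?thesis
    using jtheta_has_sum[OF assms, of z]
      has_sum_cmult_right[OF theta_has_sum[OF assms, of "z + \<tau> / 2 + 1 / 2"], of "exp (of_real pi * \<i> * (\<tau> / 4 + z))"]
    unfolding eq by (rule has_sum_unique)
qed

lemma theta_add_1: "theta \<tau> (z + 1) = theta \<tau> z"
  unfolding theta_series_def
proof (intro infsum_cong arg_cong2[of _ _ _ _ "(*)"] refl)
  fix n :: int
  have "exp (of_real pi * \<i> * (of_int n ^ 2 * \<tau> + 2 * of_int n * (z + 1))) =
         exp (of_real pi * \<i> * (of_int n ^ 2 * \<tau> + 2 * of_int n * z)) * exp (2 * of_int n * of_real pi * \<i>)"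
    unfolding exp_add [symmetric] by (rule arg_cong[of _ _ exp]) (simp add: algebra_simps)
  also have "exp (2 * of_int n * of_real pi * \<i>) = (1 :: complex)"
    using exp_integer_2pi[of "of_int n"] by (simp add: mult_ac)
  finally show "exp (of_real pi * \<i> * (of_int n ^ 2 * \<tau> + 2 * of_int n * (z + 1))) =
         exp (of_real pi * \<i> * (of_int n ^ 2 * \<tau> + 2 * of_int n * z))" by (simp only: mult_1_right)
qed

lemma jtheta_S_transform:
  assumes "Im \<tau> > 0"
  shows "jtheta (- 1 / \<tau>) (z / \<tau>) = - \<i> * csqrt (\<tau> / \<i>) * exp (of_real pi * \<i> * z\<^sup>2 / \<tau>) * jtheta \<tau> z"
proof -
  have nz: "\<tau> \<noteq> 0" using assms by auto
  \<comment> \<open>Half-periods \<open>1/2\<close> and \<open>\<tau>/2\<close> are exchanged by the inversion; \<open>-1/2\<close> and \<open>1/2\<close> differ by a period.\<close>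
  define w where "w = z + \<tau> / 2 - 1 / 2"
  have "jtheta (- 1 / \<tau>) (z / \<tau>) = exp (of_real pi * \<i> * (- 1 / \<tau> / 4 + z / \<tau>)) * theta (- 1 / \<tau>) (z / \<tau> + - 1 / \<tau> / 2 + 1 / 2)"
    by (rule jtheta_eq_theta[OF Im_minus_inverse[OF assms]])
  also have "z / \<tau> + - 1 / \<tau> / 2 + 1 / 2 = w / \<tau>"
    using nz by (simp add: w_def field_simps)
  also have "theta (- 1 / \<tau>) (w / \<tau>) = csqrt (\<tau> / \<i>) * exp (of_real pi * \<i> * w\<^sup>2 / \<tau>) * theta \<tau> w"
    by (rule theta_S_transform[OF assms])
  also have "theta \<tau> w = theta \<tau> (z + \<tau> / 2 + 1 / 2)"
  proof -
    have "z + \<tau> / 2 + 1 / 2 = w + 1" by (simp add: w_def)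
    thus ?thesis by (simp only: theta_add_1)
  qed
  also have "exp (of_real pi * \<i> * (- 1 / \<tau> / 4 + z / \<tau>)) * (csqrt (\<tau> / \<i>) * exp (of_real pi * \<i> * w\<^sup>2 / \<tau>) * theta \<tau> (z + \<tau> / 2 + 1 / 2)) =
     csqrt (\<tau> / \<i>) * (exp (of_real pi * \<i> * (- 1 / \<tau> / 4 + z / \<tau>)) * exp (of_real pi * \<i> * w\<^sup>2 / \<tau>)) * theta \<tau> (z + \<tau> / 2 + 1 / 2)"
    by (simp only: mult_ac)
  also have "exp (of_real pi * \<i> * (- 1 / \<tau> / 4 + z / \<tau>)) * exp (of_real pi * \<i> * w\<^sup>2 / \<tau>) =
               exp (of_real pi * \<i> * z\<^sup>2 / \<tau>) * exp (of_real pi * \<i> * (\<tau> / 4 + z)) * exp (- (of_real pi * \<i> / 2))"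
    unfolding exp_add [symmetric] w_def using nz
    by (intro arg_cong[of _ _ exp]) (simp add: power2_eq_square field_simps)
  also have "exp (- (of_real pi * \<i> / 2)) = - \<i>"
    using cis_minus_pi_half by (simp add: cis_conv_exp mult_ac)
  finally show ?thesis
    unfolding jtheta_eq_theta[OF assms, of z] by (simp only: mult_ac)
qed

lemma eta_eq_theta:
  assumes "Im \<tau> > 0"
  shows "dedekind_eta \<tau> = exp (of_real pi * \<i> * \<tau> / 12) * theta (3 * \<tau>) ((\<tau> + 1) / 2)"
proof -
  have "Im (3 * \<tau>) > 0" using assms by simp
  have eq: "parity_sign k * qpow \<tau> ((6 * of_int k + 1)\<^sup>2 / 24) =
          exp (of_real pi * \<i> * \<tau> / 12) * exp (of_real pi * \<i> * (of_int k ^ 2 * (3 * \<tau>) + 2 * of_int k * ((\<tau> + 1) / 2)))" for k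
    unfolding parity_sign_eq_exp qpow_def exp_add [symmetric]
    by (rule arg_cong[of _ _ exp]) (simp add: power2_eq_square field_simps)
  show ?thesis
    using eta_has_sum[OF assms]
      has_sum_cmult_right[OF theta_has_sum[OF \<open>Im (3 * \<tau>) > 0\<close>, of "(\<tau> + 1) / 2"], of "exp (of_real pi * \<i> * \<tau> / 12)"]
    unfolding eq by (rule has_sum_unique)
qed

lemma has_sum_int_mod_3:
  fixes f :: "int \<Rightarrow> complex"
  assumes "((\<lambda>k. f (3 * k)) has_sum a) UNIV" "((\<lambda>k. f (3 * k + 1)) has_sum b) UNIV" "((\<lambda>k. f (3 * k + 2)) has_sum c) UNIV"
  shows "(f has_sum (a + b + c)) UNIV"
proof -
  have *: "(f has_sum d) (range h)" if "((\<lambda>k. f (h k)) has_sum d) UNIV" "inj h" for d and h :: "int \<Rightarrow> int"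
    using has_sum_reindex[OF that(2), of f d] that(1) unfolding o_def by blast
  have sums: "(f has_sum a) (range (\<lambda>k. 3 * k))" "(f has_sum b) (range (\<lambda>k. 3 * k + 1))" "(f has_sum c) (range (\<lambda>k. 3 * k + 2))"
    by (rule *, rule assms, simp add: inj_on_def)+
  have "range (\<lambda>k. 3 * k) \<inter> range (\<lambda>k. 3 * k + 1) = ({} :: int set)" by (auto, presburger)
  from has_sum_Un_disjoint[OF sums(1,2) this]
  have ab: "(f has_sum (a + b)) (range (\<lambda>k. 3 * k) \<union> range (\<lambda>k. 3 * k + 1))" .
  have "(range (\<lambda>k. 3 * k) \<union> range (\<lambda>k. 3 * k + 1)) \<inter> range (\<lambda>k. 3 * k + 2) = ({} :: int set)" by (auto, presburger+)
  from has_sum_Un_disjoint[OF ab sums(3) this]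
  have abc: "(f has_sum (a + b + c)) ((range (\<lambda>k. 3 * k) \<union> range (\<lambda>k. 3 * k + 1)) \<union> range (\<lambda>k. 3 * k + 2))" .
  have "x = 3 * (x div 3) \<or> x = 3 * (x div 3) + 1 \<or> x = 3 * (x div 3) + 2" for x :: int by presburger
  hence "x \<in> (range (\<lambda>k. 3 * k) \<union> range (\<lambda>k. 3 * k + 1)) \<union> range (\<lambda>k. 3 * k + 2)" for x :: int by blast
  hence "(range (\<lambda>k. 3 * k) \<union> range (\<lambda>k. 3 * k + 1)) \<union> range (\<lambda>k. 3 * k + 2) = (UNIV :: int set)" by blast
  with abc show ?thesis by simp
qed

text \<open>
  Since \<open>\<eta>(\<tau>)\<close> is essentially a value of the theta function at \<open>3 \<tau>\<close>, inversion leads to a value at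
  \<open>\<tau> / 3\<close>. Sorting that series by the residue of its index modulo 3 gives three shifted Euler series;
  one of them vanishes and the other two add up to \<open>2 cos (\<pi> / 6) = \<surd>3\<close> times \<open>\<eta>(\<tau>)\<close>, which cancels the \<open>\<surd>3\<close>
  from the square root of \<open>\<tau> / 3\<close>.
\<close>

lemma eta_S_transform:
  assumes "Im \<tau> > 0"
  shows "dedekind_eta (- 1 / \<tau>) = csqrt (\<tau> / \<i>) * dedekind_eta \<tau>"
proof -
  have nz: "\<tau> \<noteq> 0" using assms by auto
  have \<tau>3: "Im (\<tau> / 3) > 0" using assms by simp
  define w where "w = (\<tau> - 1) / 6"
  define \<zeta> where "\<zeta> = exp (of_real pi * \<i> / 6)"
  have "dedekind_eta (- 1 / \<tau>) = exp (of_real pi * \<i> * (- 1 / \<tau>) / 12) * theta (3 * (- 1 / \<tau>)) ((- 1 / \<tau> + 1) / 2)"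
    by (rule eta_eq_theta[OF Im_minus_inverse[OF assms]])
  also have "3 * (- 1 / \<tau>) = - 1 / (\<tau> / 3)" by simp
  also have "(- 1 / \<tau> + 1) / 2 = w / (\<tau> / 3)" using nz by (simp add: w_def field_simps)
  also have "theta (- 1 / (\<tau> / 3)) (w / (\<tau> / 3)) = csqrt (\<tau> / 3 / \<i>) * exp (of_real pi * \<i> * w\<^sup>2 / (\<tau> / 3)) * theta (\<tau> / 3) w"
    by (rule theta_S_transform[OF \<tau>3])
  also have "csqrt (\<tau> / 3 / \<i>) = csqrt (\<tau> / \<i>) / of_real (sqrt 3)"
  proof (rule csqrt_unique)
    show "(csqrt (\<tau> / \<i>) / of_real (sqrt 3))\<^sup>2 = \<tau> / 3 / \<i>"
      by (simp add: power_divide flip: of_real_power)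
    have "Re (\<tau> / \<i>) > 0" using assms by simp
    hence "Re ((csqrt (\<tau> / \<i>))\<^sup>2) > 0" by (simp only: power2_csqrt)
    hence "Re (csqrt (\<tau> / \<i>)) \<noteq> 0"
      unfolding Re_power2 using zero_le_power2[of "Im (csqrt (\<tau> / \<i>))"] by force
    hence "Re (csqrt (\<tau> / \<i>)) > 0" using csqrt_principal[of "\<tau> / \<i>"] by linarith
    thus "0 < Re (csqrt (\<tau> / \<i>) / of_real (sqrt 3)) \<or> Re (csqrt (\<tau> / \<i>) / of_real (sqrt 3)) = 0 \<and> 0 \<le> Im (csqrt (\<tau> / \<i>) / of_real (sqrt 3))"
      by simp
  qed
  also have "exp (of_real pi * \<i> * (- 1 / \<tau>) / 12) * (csqrt (\<tau> / \<i>) / of_real (sqrt 3) * exp (of_real pi * \<i> * w\<^sup>2 / (\<tau> / 3)) * theta (\<tau> / 3) w) =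
       csqrt (\<tau> / \<i>) / of_real (sqrt 3) * (exp (of_real pi * \<i> * (- 1 / \<tau>) / 12) * exp (of_real pi * \<i> * w\<^sup>2 / (\<tau> / 3)) * theta (\<tau> / 3) w)"
    by (simp only: mult_ac)
  also have "exp (of_real pi * \<i> * (- 1 / \<tau>) / 12) * exp (of_real pi * \<i> * w\<^sup>2 / (\<tau> / 3)) = exp (of_real pi * \<i> * (\<tau> / 12 - 1 / 6))"
    unfolding exp_add [symmetric] w_def using nz
    by (intro arg_cong[of _ _ exp]) (simp add: power2_eq_square field_simps)
  also have "exp (of_real pi * \<i> * (\<tau> / 12 - 1 / 6)) * theta (\<tau> / 3) w = of_real (sqrt 3) * dedekind_eta \<tau>"
  proof -
    define f where "f = (\<lambda>n. exp (of_real pi * \<i> * (\<tau> / 12 - 1 / 6)) * exp (of_real pi * \<i> * (of_int n ^ 2 * (\<tau> / 3) + 2 * of_int n * w)))"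
    have "(f has_sum (exp (of_real pi * \<i> * (\<tau> / 12 - 1 / 6)) * theta (\<tau> / 3) w)) UNIV"
      unfolding f_def by (intro has_sum_cmult_right theta_has_sum \<tau>3)
    moreover have f: "f (3 * k + r) = exp (- of_real pi * \<i> * (1 / 6 + of_int r / 3)) * (parity_sign k * qpow \<tau> ((6 * of_int k + 3 - 2 * of_int (1 - r))\<^sup>2 / 24))" for k r
    proof -
      have "parity_sign k = parity_sign (- k)" by simp
      also have "\<dots> = exp (of_real pi * \<i> * of_int (- k))" by (rule parity_sign_eq_exp)
      finally show ?thesis
        unfolding f_def qpow_def by (simp only: exp_add [symmetric], intro arg_cong[of _ _ exp])
          (simp add: w_def power2_eq_square field_simps)
    qed
    have f_sum: "((\<lambda>k. f (3 * k + r)) has_sum (exp (- of_real pi * \<i> * (1 / 6 + of_int r / 3)) * (euler_coeff (1 - r) * dedekind_eta \<tau>))) UNIV" for r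
      unfolding f by (intro has_sum_cmult_right shifted_eta_has_sum assms)
    have "(f has_sum (exp (- of_real pi * \<i> * (1 / 6 + of_int 0 / 3)) * (euler_coeff (1 - 0) * dedekind_eta \<tau>) +
            exp (- of_real pi * \<i> * (1 / 6 + of_int 1 / 3)) * (euler_coeff (1 - 1) * dedekind_eta \<tau>) +
            exp (- of_real pi * \<i> * (1 / 6 + of_int 2 / 3)) * (euler_coeff (1 - 2) * dedekind_eta \<tau>))) UNIV"
      using f_sum[of 0] f_sum[of 1] f_sum[of 2] by (intro has_sum_int_mod_3) simp_all
    ultimately have "exp (of_real pi * \<i> * (\<tau> / 12 - 1 / 6)) * theta (\<tau> / 3) w =
            exp (- of_real pi * \<i> * (1 / 6 + of_int 0 / 3)) * (euler_coeff (1 - 0) * dedekind_eta \<tau>) +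
            exp (- of_real pi * \<i> * (1 / 6 + of_int 1 / 3)) * (euler_coeff (1 - 1) * dedekind_eta \<tau>) +
            exp (- of_real pi * \<i> * (1 / 6 + of_int 2 / 3)) * (euler_coeff (1 - 2) * dedekind_eta \<tau>)"
      by (rule has_sum_unique)
    also have "euler_coeff (1 - 0) = 1" by (simp add: euler_coeff_def parity_sign_def)
    also have "euler_coeff (1 - 1) = 0" by (simp add: euler_coeff_def)
    also have "euler_coeff (1 - 2) = -1" by (simp add: euler_coeff_def parity_sign_def)
    also have "exp (- of_real pi * \<i> * (1 / 6 + of_int 0 / 3)) * (1 * dedekind_eta \<tau>) +
            exp (- of_real pi * \<i> * (1 / 6 + of_int 1 / 3)) * (0 * dedekind_eta \<tau>) +
            exp (- of_real pi * \<i> * (1 / 6 + of_int 2 / 3)) * (- 1 * dedekind_eta \<tau>) =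
          (cis (- (pi / 6)) - cis (- (5 * pi / 6))) * dedekind_eta \<tau>"
      by (simp add: cis_conv_exp algebra_simps)
    also have "cis (- (pi / 6)) - cis (- (5 * pi / 6)) = of_real (sqrt 3)"
    proof -
      have "cos (5 * pi / 6) = - cos (pi / 6)" "sin (5 * pi / 6) = sin (pi / 6)"
        using cos_pi_minus[of "pi / 6"] sin_pi_minus[of "pi / 6"] by simp_all
      thus ?thesis by (simp add: complex_eq_iff cos_30)
    qed
    finally show ?thesis .
  qed
  finally show ?thesis by simp
qed

text \<open>
  At this point \<open>\<vartheta>\<close> equals \<open>\<eta>(\<tau> / 3)\<close> up to an exponential factor.
\<close>

lemma jtheta_nonzero: "Im \<tau> > 0 \<Longrightarrow> jtheta \<tau> (- \<tau> / 3) \<noteq> 0"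
proof -
  assume \<tau>: "Im \<tau> > 0"
  hence \<tau>3: "Im (\<tau> / 3) > 0" by simp
  have "dedekind_eta (\<tau> / 3) = exp (of_real pi * \<i> * (\<tau> / 3) / 12) * theta \<tau> (- \<tau> / 3 + \<tau> / 2 + 1 / 2)"
    using eta_eq_theta[OF \<tau>3] by (simp add: field_simps)
  hence "theta \<tau> (- \<tau> / 3 + \<tau> / 2 + 1 / 2) \<noteq> 0" using eta_nonzero[OF \<tau>3] by auto
  thus ?thesis by (simp add: jtheta_eq_theta[OF \<tau>])
qed

lemma jtheta_holomorphic [holomorphic_intros]:
  assumes "Im \<tau> > 0" "f holomorphic_on A"
  shows "(\<lambda>w. jtheta \<tau> (f w)) holomorphic_on A"
  unfolding jtheta_eq_theta_series using assms kronecker_m4_bound by (intro holomorphic_intros) auto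

lemma quintuple_theta_holomorphic [holomorphic_intros]:
  assumes "Im \<tau> > 0" "f holomorphic_on A"
  shows "(\<lambda>w. quintuple_theta \<tau> (f w)) holomorphic_on A"
  unfolding quintuple_theta_def theta_12_half_def using assms kronecker_12_half_bound by (intro holomorphic_intros) auto

text \<open>
  The ring of entire functions has no zero divisors.
\<close>

lemma entire_product_zero:
  assumes f: "f holomorphic_on UNIV" and g: "g holomorphic_on UNIV" and "f a \<noteq> 0" and zero: "\<And>z. f z * g z = 0"
  shows "g z = (0::complex)"
proof -
  have "continuous_on UNIV f" using f by (rule holomorphic_on_imp_continuous_on)
  hence "open {z. f z \<noteq> 0}" by (intro open_Collect_neq continuous_intros)
  thus ?thesis
    using analytic_continuation_open[of "{z. f z \<noteq> 0}" UNIV g "\<lambda>_. 0" z] assms(3) zero g by fastforce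
qed

text \<open>
  The quintuple product identity gives the law after multiplication by \<open>\<vartheta>(\<tau>, z)\<close>, and this factor can
  be cancelled because it does not vanish identically in \<open>z\<close>.
\<close>

lemma quintuple_theta_S_transform:
  assumes "Im \<tau> > 0"
  shows "quintuple_theta (- 1 / \<tau>) (z / \<tau>) = csqrt (\<tau> / \<i>) * exp (3 * of_real pi * \<i> * z\<^sup>2 / \<tau>) * quintuple_theta \<tau> z"
proof -
  note \<tau>' = Im_minus_inverse[OF assms]
  define g where "g = (\<lambda>z. quintuple_theta (- 1 / \<tau>) (z / \<tau>) - csqrt (\<tau> / \<i>) * exp (3 * of_real pi * \<i> * z\<^sup>2 / \<tau>) * quintuple_theta \<tau> z)"
  have "g z = 0"
  proof (rule entire_product_zero[of "jtheta \<tau>" g, OF _ _ jtheta_nonzero[OF assms]])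
    show "jtheta \<tau> holomorphic_on UNIV" using assms by (intro holomorphic_intros)
    show "g holomorphic_on UNIV"
      unfolding g_def using assms \<tau>' by (intro holomorphic_intros) auto
    fix z
    define c where "c = csqrt (\<tau> / \<i>)"
    define e where "e = exp (of_real pi * \<i> * z\<^sup>2 / \<tau>)"
    have e3: "exp (3 * of_real pi * \<i> * z\<^sup>2 / \<tau>) = e ^ 3" and e4: "exp (of_real pi * \<i> * (2 * z)\<^sup>2 / \<tau>) = e ^ 4"
      unfolding e_def exp_of_nat_mult [symmetric] by (rule arg_cong[of _ _ exp], simp add: power2_eq_square)+
    have "c \<noteq> 0" using assms by (auto simp: c_def)
    have "e \<noteq> 0" by (simp add: e_def)
    have "jtheta (- 1 / \<tau>) (z / \<tau>) * quintuple_theta (- 1 / \<tau>) (z / \<tau>) = dedekind_eta (- 1 / \<tau>) * jtheta (- 1 / \<tau>) (2 * z / \<tau>)"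
      using jtheta_times_quintuple_theta[OF \<tau>', of "z / \<tau>"] by simp
    hence "- \<i> * c * e * jtheta \<tau> z * quintuple_theta (- 1 / \<tau>) (z / \<tau>) =
             c * dedekind_eta \<tau> * (- \<i> * c * e ^ 4 * jtheta \<tau> (2 * z))"
      unfolding jtheta_S_transform[OF assms] eta_S_transform[OF assms] c_def [symmetric] e_def [symmetric] e4 .
    also have "\<dots> = - \<i> * c ^ 2 * e ^ 4 * (dedekind_eta \<tau> * jtheta \<tau> (2 * z))" by (simp add: power2_eq_square mult_ac)
    also have "dedekind_eta \<tau> * jtheta \<tau> (2 * z) = jtheta \<tau> z * quintuple_theta \<tau> z"
      by (rule jtheta_times_quintuple_theta[OF assms, symmetric])
    finally have "- \<i> * c * e * jtheta \<tau> z * quintuple_theta (- 1 / \<tau>) (z / \<tau>) -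
        - \<i> * c\<^sup>2 * e ^ 4 * (jtheta \<tau> z * quintuple_theta \<tau> z) = 0"
      by (simp only: right_minus_eq)
    also have "- \<i> * c * e * T * Q' - - \<i> * c\<^sup>2 * e ^ 4 * (T * Q) = (- \<i> * c * e) * (T * (Q' - c * e ^ 3 * Q))" for T Q Q'
      by (simp add: eval_nat_numeral algebra_simps)
    finally have "(- \<i> * c * e) * (jtheta \<tau> z * g z) = 0"
      unfolding g_def c_def [symmetric] e3 .
    thus "jtheta \<tau> z * g z = 0" using \<open>c \<noteq> 0\<close> \<open>e \<noteq> 0\<close> by simp
  qed
  thus ?thesis by (simp add: g_def)
qed

text \<open>
  The zeros of \<open>\<vartheta>(\<tau>, \<cdot>)\<close> are isolated, and away from them the quotient coincides with an entire function.
\<close>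

lemma jtheta_3_2_eq_quintuple_theta:
  assumes "Im \<tau> > 0"
  shows "jtheta_3_2 \<tau> z = quintuple_theta \<tau> z"
  unfolding jtheta_3_2_def
proof (rule remove_sings_eqI)
  have hol: "jtheta \<tau> holomorphic_on UNIV" "quintuple_theta \<tau> holomorphic_on UNIV"
    using jtheta_holomorphic[OF assms holomorphic_on_ident] quintuple_theta_holomorphic[OF assms holomorphic_on_ident] by simp_all
  have "\<forall>\<^sub>F w in at z. jtheta \<tau> w \<noteq> 0 \<and> w \<in> UNIV"
    by (rule non_zero_neighbour_alt[OF hol(1), of z "- \<tau> / 3"]) (use jtheta_nonzero[OF assms] in auto)
  hence "\<forall>\<^sub>F w in at z. quintuple_theta \<tau> w = dedekind_eta \<tau> * jtheta \<tau> (2 * w) / jtheta \<tau> w"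
    by eventually_elim (simp add: jtheta_times_quintuple_theta[OF assms, symmetric])
  moreover have "quintuple_theta \<tau> \<midarrow>z\<rightarrow> quintuple_theta \<tau> z"
    using holomorphic_on_imp_continuous_on[OF hol(2)] by (simp add: continuous_on_eq_continuous_at isCont_def)
  ultimately show "(\<lambda>w. dedekind_eta \<tau> * jtheta \<tau> (2 * w) / jtheta \<tau> w) \<midarrow>z\<rightarrow> quintuple_theta \<tau> z"
    by (rule Lim_transform_eventually[rotated])
qed

lemma quintuple_theta_0:
  assumes "Im \<tau> > 0"
  shows "quintuple_theta \<tau> 0 \<noteq> 0"
proof -
  have "theta_12_half \<tau> 0 = dedekind_eta \<tau>"
    using theta_12_half_has_sum[OF assms, of 0] eta_has_sum[OF assms] by (simp add: zpow_def has_sum_unique)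
  thus ?thesis using eta_nonzero[OF assms] by (simp add: quintuple_theta_def)
qed

section \<open>Fourier expansions of products\<close>

text \<open>
  The exponent of \<open>q\<close> is \<open>m / 24\<close>, as required by the multiplier systems of the single factors. The
  integers \<open>l\<^sub>i\<close> are the values of a dual vector on the standard basis; for the diagonal lattice with
  entries \<open>g\<^sub>i\<close> this dual vector has coordinates \<open>l\<^sub>i / g\<^sub>i\<close> and norm \<open>\<Sum> l\<^sub>i\<^sup>2 / g\<^sub>i\<close>.
\<close>

definition fourier_term :: "int \<times> (int ^ 'n) \<Rightarrow> complex \<Rightarrow> complex ^ 'n \<Rightarrow> complex" where
  "fourier_term k \<tau> Z = exp (2 * of_real pi * \<i> * (of_int (fst k) / 24 * \<tau> + (\<Sum>i\<in>UNIV. of_int (snd k $ i) * Z $ i)))"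

lemma fourier_term_nonzero [simp]: "fourier_term k \<tau> Z \<noteq> 0" by (simp add: fourier_term_def)

lemma fourier_term_add: "fourier_term (m + m', l + l') \<tau> Z = fourier_term (m, l) \<tau> Z * fourier_term (m', l') \<tau> Z"
  unfolding fourier_term_def exp_add [symmetric]
  by (rule arg_cong[of _ _ exp]) (simp add: algebra_simps add_divide_distrib sum.distrib)

text \<open>
  The condition on a Fourier exponent of a function of the variables in \<open>A\<close>: the hyperbolic norm is
  nonnegative, or positive if \<open>cusp\<close> holds, and \<open>m \<equiv> t (mod 24)\<close>, which encodes the factor
  \<open>exp (2\<pi>it / 24)\<close> under \<open>\<tau> \<mapsto> \<tau> + 1\<close>.
\<close>

definition admissible :: "('n \<Rightarrow> nat) \<Rightarrow> 'n set \<Rightarrow> nat \<Rightarrow> bool \<Rightarrow> int \<times> (int ^ 'n) \<Rightarrow> bool" where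
  "admissible g A t cusp k \<longleftrightarrow>
     24 dvd fst k - int t \<and> (\<forall>i. i \<notin> A \<longrightarrow> snd k $ i = 0) \<and>
     (\<Sum>i\<in>A. of_int (snd k $ i) ^ 2 / of_nat (g i)) \<le> (of_int (fst k) / 12 :: real) \<and>
     (cusp \<longrightarrow> (\<Sum>i\<in>A. of_int (snd k $ i) ^ 2 / of_nat (g i)) < (of_int (fst k) / 12 :: real))"

definition has_expansion :: "('n \<Rightarrow> nat) \<Rightarrow> 'n set \<Rightarrow> nat \<Rightarrow> bool \<Rightarrow> (complex \<Rightarrow> complex ^ 'n \<Rightarrow> complex) \<Rightarrow> bool" where
  "has_expansion g A t cusp \<phi> \<longleftrightarrow> (\<exists>f. (\<forall>\<tau> Z. Im \<tau> > 0 \<longrightarrow> ((\<lambda>k. f k * fourier_term k \<tau> Z) has_sum \<phi> \<tau> Z) UNIV) \<and>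
      (\<forall>k. f k \<noteq> 0 \<longrightarrow> admissible g A t cusp k))"

text \<open>
  Collecting the terms with equal exponents: parametrisations of theta series by their summation
  indices need not be injective on exponents.
\<close>

lemma has_sum_regroup:
  fixes c :: "'k \<Rightarrow> complex" and p :: "'k \<Rightarrow> 'i"
  assumes sum: "((\<lambda>k. c k * E (p k)) has_sum S) UNIV" and nz: "\<And>i. E i \<noteq> 0"
  shows "((\<lambda>i. (\<Sum>\<^sub>\<infinity>k\<in>{k. p k = i}. c k) * E i) has_sum S) UNIV"
proof -
  have "((\<lambda>k. c k * E (p k)) has_sum S) UNIV \<longleftrightarrow> ((\<lambda>(i, k). c k * E (p k)) has_sum S) (Sigma UNIV (\<lambda>i. {k. p k = i}))"
    by (rule has_sum_reindex_bij_witness[of _ snd "\<lambda>k. (p k, k)"]) auto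
  with sum have "((\<lambda>(i, k). c k * E (p k)) has_sum S) (Sigma UNIV (\<lambda>i. {k. p k = i}))" by simp
  thus ?thesis
  proof (rule has_sum_SigmaD, goal_cases)
    case (1 i)
    have "(\<lambda>k. c k * E (p k)) summable_on {k. p k = i}"
      by (rule summable_on_subset_banach[of _ UNIV]) (use sum in \<open>auto simp: summable_on_def\<close>)
    from iffD1[OF summable_on_cong this, of "\<lambda>k. c k * E i"]
    have "(\<lambda>k. c k * E i) summable_on {k. p k = i}" by simp
    from summable_on_cmult_left[OF this, of "inverse (E i)"]
    have "c summable_on {k. p k = i}" using nz[of i] by (simp add: mult.assoc)
    hence "((\<lambda>k. c k * E i) has_sum (\<Sum>\<^sub>\<infinity>k\<in>{k. p k = i}. c k) * E i) {k. p k = i}"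
      by (intro has_sum_cmult_left has_sum_infsum)
    thus ?case by (rule iffD1[OF has_sum_cong, rotated]) auto
  qed
qed

lemma has_expansionI:
  fixes c :: "'k \<Rightarrow> complex"
  assumes sum: "\<And>\<tau> Z. Im \<tau> > 0 \<Longrightarrow> ((\<lambda>k. c k * fourier_term (p k) \<tau> Z) has_sum \<phi> \<tau> Z) UNIV"
    and adm: "\<And>k. c k \<noteq> 0 \<Longrightarrow> admissible g A t cusp (p k)"
  shows "has_expansion g A t cusp \<phi>"
  unfolding has_expansion_def
proof (intro exI conjI allI impI)
  show "((\<lambda>i. (\<Sum>\<^sub>\<infinity>k\<in>{k. p k = i}. c k) * fourier_term i \<tau> Z) has_sum \<phi> \<tau> Z) UNIV" if "Im \<tau> > 0" for \<tau> Z
    using sum[OF that] by (rule has_sum_regroup) simp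
  fix i assume *: "(\<Sum>\<^sub>\<infinity>k\<in>{k. p k = i}. c k) \<noteq> 0"
  have "\<exists>k. p k = i \<and> c k \<noteq> 0"
  proof (rule ccontr)
    assume "\<not> (\<exists>k. p k = i \<and> c k \<noteq> 0)"
    hence "(\<Sum>\<^sub>\<infinity>k\<in>{k. p k = i}. c k) = (\<Sum>\<^sub>\<infinity>k\<in>{k. p k = i}. 0)" by (intro infsum_cong) auto
    with * show False by simp
  qed
  thus "admissible g A t cusp i" using adm by blast
qed

text \<open>
  Norms are additive over disjoint sets of variables, so one cuspidal factor makes the product cuspidal.
\<close>

lemma admissible_add:
  fixes A B :: "'n :: finite set"
  assumes k: "admissible g A t cusp k" and k': "admissible g B t' cusp' k'" and disj: "A \<inter> B = {}"
  shows "admissible g (A \<union> B) (t + t') (cusp \<or> cusp') (fst k + fst k', snd k + snd k')"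
proof -
  define N where "N = (\<lambda>A l. \<Sum>i\<in>A. of_int (l $ i) ^ 2 / of_nat (g i) :: real)"
  have zero: "snd k' $ i = 0" if "i \<in> A" for i
    using k' that disj unfolding admissible_def by blast
  have zero': "snd k $ i = 0" if "i \<in> B" for i
    using k that disj unfolding admissible_def by blast
  have "N (A \<union> B) (snd k + snd k') = N A (snd k + snd k') + N B (snd k + snd k')"
    unfolding N_def by (rule sum.union_disjoint) (use disj in simp_all)
  also have "N A (snd k + snd k') = N A (snd k)"
    unfolding N_def by (intro sum.cong refl) (simp add: zero)
  also have "N B (snd k + snd k') = N B (snd k')"
    unfolding N_def by (intro sum.cong refl) (simp add: zero')
  finally have N: "N (A \<union> B) (snd k + snd k') = N A (snd k) + N B (snd k')" .
  have "24 dvd (fst k - int t) + (fst k' - int t')"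
    using k k' unfolding admissible_def by (intro dvd_add) blast+
  hence "24 dvd (fst k + fst k') - int (t + t')" by (simp add: algebra_simps)
  moreover have "\<forall>i. i \<notin> A \<union> B \<longrightarrow> (snd k + snd k') $ i = 0"
    using k k' unfolding admissible_def by simp
  moreover have "N A (snd k) \<le> of_int (fst k) / 12" "N B (snd k') \<le> of_int (fst k') / 12"
    "cusp \<longrightarrow> N A (snd k) < of_int (fst k) / 12" "cusp' \<longrightarrow> N B (snd k') < of_int (fst k') / 12"
    using k k' unfolding admissible_def N_def by blast+
  hence "N (A \<union> B) (snd k + snd k') \<le> of_int (fst k + fst k') / 12"
    "cusp \<or> cusp' \<longrightarrow> N (A \<union> B) (snd k + snd k') < of_int (fst k + fst k') / 12"
    unfolding N of_int_add add_divide_distrib by linarith+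
  ultimately show ?thesis unfolding admissible_def N_def fst_conv snd_conv by blast
qed

lemma has_expansion_mult:
  fixes \<phi> \<psi> :: "complex \<Rightarrow> complex ^ 'n \<Rightarrow> complex"
  assumes "has_expansion g A t cusp \<phi>" "has_expansion g B t' cusp' \<psi>" "A \<inter> B = {}"
  shows "has_expansion g (A \<union> B) (t + t') (cusp \<or> cusp') (\<lambda>\<tau> Z. \<phi> \<tau> Z * \<psi> \<tau> Z)"
proof -
  obtain f where f: "\<And>\<tau> Z. Im \<tau> > 0 \<Longrightarrow> ((\<lambda>k. f k * fourier_term k \<tau> Z) has_sum \<phi> \<tau> Z) UNIV" "\<And>k. f k \<noteq> 0 \<Longrightarrow> admissible g A t cusp k"
    using assms(1) unfolding has_expansion_def by blast
  obtain h where h: "\<And>\<tau> Z. Im \<tau> > 0 \<Longrightarrow> ((\<lambda>k. h k * fourier_term k \<tau> Z) has_sum \<psi> \<tau> Z) UNIV" "\<And>k. h k \<noteq> 0 \<Longrightarrow> admissible g B t' cusp' k"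
    using assms(2) unfolding has_expansion_def by blast
  show ?thesis
  proof (rule has_expansionI[where c = "\<lambda>(k, k'). f k * h k'" and p = "\<lambda>(k, k'). (fst k + fst k', snd k + snd k')"])
    fix \<tau> :: complex and Z :: "complex ^ 'n" assume "Im \<tau> > 0"
    from has_sum_product[OF f(1)[OF this, of Z] h(1)[OF this, of Z]]
    show "((\<lambda>k. (case k of (k, k') \<Rightarrow> f k * h k') * fourier_term (case k of (k, k') \<Rightarrow> (fst k + fst k', snd k + snd k')) \<tau> Z) has_sum \<phi> \<tau> Z * \<psi> \<tau> Z) UNIV"
      by (simp add: case_prod_unfold fourier_term_add mult_ac)
  next
    fix k assume "(case k of (k, k') \<Rightarrow> f k * h k') \<noteq> 0"
    thus "admissible g (A \<union> B) (t + t') (cusp \<or> cusp') (case k of (k, k') \<Rightarrow> (fst k + fst k', snd k + snd k'))"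
      using admissible_add[OF f(2)[of "fst k"] h(2)[of "snd k"] assms(3)] by (cases k) simp
  qed
qed

section \<open>Holomorphy in several variables\<close>

lemma holomorphic_on_HxV_cong:
  assumes "holomorphic_on_HxV \<phi>" "\<And>\<tau> Z. Im \<tau> > 0 \<Longrightarrow> \<phi> \<tau> Z = \<psi> \<tau> Z"
  shows "holomorphic_on_HxV \<psi>"
  unfolding holomorphic_on_HxV_def
proof (intro ballI allI)
  fix \<tau> Z assume \<tau>: "\<tau> \<in> \<H>"
  with assms(1) obtain D where D: "((\<lambda>(t, W). \<phi> t W) has_derivative D) (at (\<tau>, Z))" "\<forall>c t W. D (c * t, c *s W) = c * D (t, W)"
    unfolding holomorphic_on_HxV_def by blast
  have "((\<lambda>(t, W). \<psi> t W) has_derivative D) (at (\<tau>, Z))"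
    by (rule has_derivative_transform_within_open[OF D(1), of "{t. Im t > 0} \<times> UNIV"])
       (use \<tau> assms(2) in \<open>auto simp: upper_half_plane_def open_H intro!: open_Times\<close>)
  with D(2) show "\<exists>D. ((\<lambda>(t, W). \<psi> t W) has_derivative D) (at (\<tau>, Z)) \<and> (\<forall>c t W. D (c * t, c *s W) = c * D (t, W))" by blast
qed

lemma holomorphic_on_HxV_const: "holomorphic_on_HxV (\<lambda>_ _. c)"
  unfolding holomorphic_on_HxV_def case_prod_unfold by (auto intro!: exI[of _ "\<lambda>_. 0"])

lemma holomorphic_on_HxV_tau: "holomorphic_on_HxV (\<lambda>\<tau> _. \<tau>)"
  unfolding holomorphic_on_HxV_def case_prod_unfold by (auto intro!: exI[of _ fst] derivative_eq_intros)

lemma holomorphic_on_HxV_coordinate: "holomorphic_on_HxV (\<lambda>_ Z. Z $ i)"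
  unfolding holomorphic_on_HxV_def case_prod_unfold
proof (intro ballI allI exI[of _ "\<lambda>p. snd p $ i"] conjI)
  show "((\<lambda>p. snd p $ i) has_derivative (\<lambda>p. snd p $ i)) (at (\<tau>, Z))" for \<tau> :: complex and Z :: "complex ^ 'a"
    by (intro bounded_linear_imp_has_derivative bounded_linear_compose[OF bounded_linear_vec_nth bounded_linear_snd])
qed auto

text \<open>
  The chain rule with a complex-linear outer derivative; sums, products and theta series are all
  instances.
\<close>

lemma holomorphic_on_HxV_compose2:
  assumes "holomorphic_on_HxV \<phi>" "holomorphic_on_HxV \<psi>"
    and F: "\<And>\<tau> Z. Im \<tau> > 0 \<Longrightarrow>
      \<exists>p q. ((\<lambda>(t, w). F t w) has_derivative (\<lambda>(h, k). p * h + q * k)) (at (\<phi> \<tau> Z, \<psi> \<tau> Z))"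
  shows "holomorphic_on_HxV (\<lambda>\<tau> Z. F (\<phi> \<tau> Z) (\<psi> \<tau> Z))"
  unfolding holomorphic_on_HxV_def
proof (intro ballI allI)
  fix \<tau> Z assume \<tau>: "\<tau> \<in> \<H>"
  obtain D where D: "((\<lambda>(t, W). \<phi> t W) has_derivative D) (at (\<tau>, Z))" "\<forall>c t W. D (c * t, c *s W) = c * D (t, W)"
    using assms(1) \<tau> unfolding holomorphic_on_HxV_def by blast
  obtain E where E: "((\<lambda>(t, W). \<psi> t W) has_derivative E) (at (\<tau>, Z))" "\<forall>c t W. E (c * t, c *s W) = c * E (t, W)"
    using assms(2) \<tau> unfolding holomorphic_on_HxV_def by blast
  obtain p q where "((\<lambda>(t, w). F t w) has_derivative (\<lambda>(h, k). p * h + q * k)) (at (\<phi> \<tau> Z, \<psi> \<tau> Z))"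
    using F[of \<tau> Z] \<tau> unfolding upper_half_plane_def by blast
  hence pq: "((\<lambda>(t, w). F t w) has_derivative (\<lambda>(h, k). p * h + q * k))
          (at ((\<lambda>x. (case x of (t, W) \<Rightarrow> \<phi> t W, case x of (t, W) \<Rightarrow> \<psi> t W)) (\<tau>, Z)))" by simp
  from has_derivative_compose[OF has_derivative_Pair[OF D(1) E(1)] pq]
  have "((\<lambda>(t, W). F (\<phi> t W) (\<psi> t W)) has_derivative (\<lambda>h. p * D h + q * E h)) (at (\<tau>, Z))"
    by (simp add: case_prod_unfold)
  thus "\<exists>D. ((\<lambda>(t, W). F (\<phi> t W) (\<psi> t W)) has_derivative D) (at (\<tau>, Z)) \<and> (\<forall>c t W. D (c * t, c *s W) = c * D (t, W))"
    using D(2) E(2) by (intro exI[of _ "\<lambda>h. p * D h + q * E h"]) (simp add: algebra_simps)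
qed

lemma holomorphic_on_HxV_add:
  assumes "holomorphic_on_HxV \<phi>" "holomorphic_on_HxV \<psi>"
  shows "holomorphic_on_HxV (\<lambda>\<tau> Z. \<phi> \<tau> Z + \<psi> \<tau> Z)"
  by (rule holomorphic_on_HxV_compose2[OF assms, of "(+)"], rule exI[of _ 1], rule exI[of _ 1])
     (auto simp: case_prod_unfold intro!: derivative_eq_intros)

lemma holomorphic_on_HxV_mult:
  assumes "holomorphic_on_HxV \<phi>" "holomorphic_on_HxV \<psi>"
  shows "holomorphic_on_HxV (\<lambda>\<tau> Z. \<phi> \<tau> Z * \<psi> \<tau> Z)"
proof (rule holomorphic_on_HxV_compose2[OF assms, of "(*)"], rule exI, rule exI)
  show "((\<lambda>(t, w). t * w) has_derivative (\<lambda>(h, k). \<psi> \<tau> Z * h + \<phi> \<tau> Z * k)) (at (\<phi> \<tau> Z, \<psi> \<tau> Z))" for \<tau> Z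
    unfolding case_prod_unfold by (auto intro!: derivative_eq_intros simp: algebra_simps)
qed

lemma holomorphic_on_HxV_compose:
  assumes "holomorphic_on_HxV \<phi>" "\<And>\<tau> Z. Im \<tau> > 0 \<Longrightarrow> \<exists>f'. (f has_field_derivative f') (at (\<phi> \<tau> Z))"
  shows "holomorphic_on_HxV (\<lambda>\<tau> Z. f (\<phi> \<tau> Z))"
proof (rule holomorphic_on_HxV_compose2[OF assms(1) assms(1), of "\<lambda>t _. f t"])
  fix \<tau> Z assume "Im \<tau> > 0"
  then obtain f' where "(f has_field_derivative f') (at (\<phi> \<tau> Z))" using assms(2) by blast
  hence "(f has_derivative (*) f') (at (fst (\<phi> \<tau> Z, \<phi> \<tau> Z)))" by (simp add: has_field_derivative_def)
  from has_derivative_compose[OF has_derivative_fst[OF has_derivative_ident] this]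
  show "\<exists>p q. ((\<lambda>(t, _). f t) has_derivative (\<lambda>(h, k). p * h + q * k)) (at (\<phi> \<tau> Z, \<phi> \<tau> Z))"
    by (intro exI[of _ f'] exI[of _ 0]) (simp add: case_prod_unfold)
qed

lemma holomorphic_on_HxV_theta_series:
  assumes "\<And>n. norm (c n) \<le> 1" "holomorphic_on_HxV \<phi>" "holomorphic_on_HxV \<psi>" "\<And>\<tau> Z. Im \<tau> > 0 \<Longrightarrow> Im (\<phi> \<tau> Z) > 0"
  shows "holomorphic_on_HxV (\<lambda>\<tau> Z. theta_series c (\<phi> \<tau> Z) (\<psi> \<tau> Z))"
  by (rule holomorphic_on_HxV_compose2[OF assms(2,3)]) (rule theta_series_has_derivative; use assms(1,4) in simp)

lemma holomorphic_on_HxV_cmult: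
  "holomorphic_on_HxV \<phi> \<Longrightarrow> holomorphic_on_HxV (\<lambda>\<tau> Z. c * \<phi> \<tau> Z)"
  by (intro holomorphic_on_HxV_mult holomorphic_on_HxV_const)

lemma holomorphic_on_HxV_divide_const:
  "holomorphic_on_HxV \<phi> \<Longrightarrow> holomorphic_on_HxV (\<lambda>\<tau> Z. \<phi> \<tau> Z / c)"
  using holomorphic_on_HxV_cmult[of \<phi> "inverse c"] by (simp add: field_simps)

lemma holomorphic_on_HxV_jtheta:
  assumes "holomorphic_on_HxV \<psi>"
  shows "holomorphic_on_HxV (\<lambda>\<tau> Z. jtheta \<tau> (\<psi> \<tau> Z))"
  unfolding jtheta_eq_theta_series
  by (intro holomorphic_on_HxV_theta_series kronecker_m4_bound holomorphic_on_HxV_divide_const holomorphic_on_HxV_tau assms) simp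

lemma holomorphic_on_HxV_quintuple_theta:
  assumes "holomorphic_on_HxV \<psi>"
  shows "holomorphic_on_HxV (\<lambda>\<tau> Z. quintuple_theta \<tau> (\<psi> \<tau> Z))"
proof -
  have "holomorphic_on_HxV (\<lambda>\<tau> Z. quintuple_theta \<tau> (\<psi> \<tau> Z)) \<longleftrightarrow>
          holomorphic_on_HxV (\<lambda>\<tau> Z. theta_series kronecker_12_half (\<tau> / 12) (\<psi> \<tau> Z / 2) + theta_series kronecker_12_half (\<tau> / 12) ((- 1 / 2) * \<psi> \<tau> Z))"
    unfolding quintuple_theta_def theta_12_half_def by simp
  also have \<dots>
    by (intro holomorphic_on_HxV_add holomorphic_on_HxV_theta_series kronecker_12_half_bound holomorphic_on_HxV_divide_const
          holomorphic_on_HxV_cmult holomorphic_on_HxV_tau assms) simp_all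
  finally show ?thesis .
qed

lemma holomorphic_on_HxV_inverse_eta: "holomorphic_on_HxV (\<lambda>\<tau> _. inverse (dedekind_eta \<tau>))"
proof -
  have "holomorphic_on_HxV (\<lambda>\<tau> (_ :: complex ^ 'a). exp (of_real pi * \<i> / 12 * \<tau>) * theta (3 * \<tau>) ((\<tau> + 1) / 2))"
  proof (intro holomorphic_on_HxV_mult holomorphic_on_HxV_theta_series holomorphic_on_HxV_divide_const
           holomorphic_on_HxV_add holomorphic_on_HxV_tau holomorphic_on_HxV_const holomorphic_on_HxV_cmult)
    show "holomorphic_on_HxV (\<lambda>\<tau> (_ :: complex ^ 'a). exp (of_real pi * \<i> / 12 * \<tau>))"
      by (rule holomorphic_on_HxV_compose[of "\<lambda>\<tau> _. of_real pi * \<i> / 12 * \<tau>" exp, OF holomorphic_on_HxV_cmult[OF holomorphic_on_HxV_tau]])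
        (blast intro: DERIV_exp)
  qed auto
  hence "holomorphic_on_HxV (\<lambda>\<tau> (_ :: complex ^ 'a). dedekind_eta \<tau>)"
    by (rule holomorphic_on_HxV_cong) (simp add: eta_eq_theta mult_ac)
  thus ?thesis
    by (rule holomorphic_on_HxV_compose) (use eta_nonzero in \<open>blast intro: DERIV_inverse\<close>)
qed

section \<open>Blocks with multiplier system\<close>

text \<open>
  A factor of weight \<open>w / 2\<close> in the variables from \<open>A\<close> with the multiplier system of \<open>\<eta>\<close> to the power
  \<open>w + 2 s\<close>: comparing \<open>\<eta>\<close> to that power with weight \<open>w / 2\<close> leaves the factor \<open>(-\<i>)\<^sup>s\<close> at the inversion.
  The numbers \<open>w\<close> and \<open>s\<close> add up under multiplication. The inversion and the expansion determine the
  behaviour under \<open>SL\<^sub>2(\<int>)\<close> and under all translations.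
\<close>

definition theta_block :: "('n \<Rightarrow> nat) \<Rightarrow> 'n set \<Rightarrow> nat \<Rightarrow> nat \<Rightarrow> bool \<Rightarrow> (complex \<Rightarrow> complex ^ 'n \<Rightarrow> complex) \<Rightarrow> bool" where
  "theta_block g A w s cusp \<phi> \<longleftrightarrow> holomorphic_on_HxV \<phi> \<and>
     (\<forall>\<tau> Z. Im \<tau> > 0 \<longrightarrow> \<phi> (- 1 / \<tau>) (inverse \<tau> *s Z) =
        csqrt (\<tau> / \<i>) ^ w * (- \<i>) ^ s * exp (of_real pi * \<i> * (\<Sum>i\<in>A. of_nat (g i) * (Z $ i)\<^sup>2) / \<tau>) * \<phi> \<tau> Z) \<and>
     has_expansion g A (w + 2 * s) cusp \<phi>"

lemma theta_block_mult:
  fixes A B :: "'n :: finite set"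
  assumes \<phi>: "theta_block g A w s cusp \<phi>" and \<psi>: "theta_block g B w' s' cusp' \<psi>" and disj: "A \<inter> B = {}"
  shows "theta_block g (A \<union> B) (w + w') (s + s') (cusp \<or> cusp') (\<lambda>\<tau> Z. \<phi> \<tau> Z * \<psi> \<tau> Z)"
  unfolding theta_block_def
proof (intro conjI allI impI)
  show "holomorphic_on_HxV (\<lambda>\<tau> Z. \<phi> \<tau> Z * \<psi> \<tau> Z)"
    using \<phi> \<psi> unfolding theta_block_def by (intro holomorphic_on_HxV_mult) blast+
  have "has_expansion g (A \<union> B) ((w + 2 * s) + (w' + 2 * s')) (cusp \<or> cusp') (\<lambda>\<tau> Z. \<phi> \<tau> Z * \<psi> \<tau> Z)"
    using \<phi> \<psi> unfolding theta_block_def by (intro has_expansion_mult disj) blast+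
  also have "(w + 2 * s) + (w' + 2 * s') = (w + w') + 2 * (s + s')" by simp
  finally show "has_expansion g (A \<union> B) ((w + w') + 2 * (s + s')) (cusp \<or> cusp') (\<lambda>\<tau> Z. \<phi> \<tau> Z * \<psi> \<tau> Z)" .
  fix \<tau> and Z :: "complex ^ 'n" assume \<tau>: "Im \<tau> > 0"
  have "(\<Sum>i\<in>A \<union> B. of_nat (g i) * (Z $ i)\<^sup>2) = (\<Sum>i\<in>A. of_nat (g i) * (Z $ i)\<^sup>2) + (\<Sum>i\<in>B. of_nat (g i) * (Z $ i)\<^sup>2)"
    by (rule sum.union_disjoint) (use disj in simp_all)
  hence e: "exp (of_real pi * \<i> * (\<Sum>i\<in>A \<union> B. of_nat (g i) * (Z $ i)\<^sup>2) / \<tau>) =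
      exp (of_real pi * \<i> * (\<Sum>i\<in>A. of_nat (g i) * (Z $ i)\<^sup>2) / \<tau>) * exp (of_real pi * \<i> * (\<Sum>i\<in>B. of_nat (g i) * (Z $ i)\<^sup>2) / \<tau>)"
    by (simp add: exp_add [symmetric] algebra_simps add_divide_distrib)
  have "\<phi> (- 1 / \<tau>) (inverse \<tau> *s Z) =
        csqrt (\<tau> / \<i>) ^ w * (- \<i>) ^ s * exp (of_real pi * \<i> * (\<Sum>i\<in>A. of_nat (g i) * (Z $ i)\<^sup>2) / \<tau>) * \<phi> \<tau> Z"
    "\<psi> (- 1 / \<tau>) (inverse \<tau> *s Z) =
        csqrt (\<tau> / \<i>) ^ w' * (- \<i>) ^ s' * exp (of_real pi * \<i> * (\<Sum>i\<in>B. of_nat (g i) * (Z $ i)\<^sup>2) / \<tau>) * \<psi> \<tau> Z"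
    using \<phi> \<psi> \<tau> unfolding theta_block_def by blast+
  thus "\<phi> (- 1 / \<tau>) (inverse \<tau> *s Z) * \<psi> (- 1 / \<tau>) (inverse \<tau> *s Z) =
        csqrt (\<tau> / \<i>) ^ (w + w') * (- \<i>) ^ (s + s') * exp (of_real pi * \<i> * (\<Sum>i\<in>A \<union> B. of_nat (g i) * (Z $ i)\<^sup>2) / \<tau>) * (\<phi> \<tau> Z * \<psi> \<tau> Z)"
    unfolding e power_add by (simp only: mult_ac)
qed

lemma theta_block_1: "theta_block g {} 0 0 False (\<lambda>_ _. 1)"
  unfolding theta_block_def
proof (intro conjI)
  show "has_expansion g {} (0 + 2 * 0) False (\<lambda>_ _. 1)"
    unfolding has_expansion_def
  proof (intro exI[of _ "\<lambda>k. if k = 0 then 1 else 0"] conjI allI impI)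
    show "((\<lambda>k. (if k = 0 then 1 else 0) * fourier_term k \<tau> Z) has_sum 1) UNIV" for \<tau> and Z :: "complex ^ 'a"
      by (rule has_sum_finite_neutralI[of "{0}"]) (auto simp: fourier_term_def)
  qed (auto simp: admissible_def split: if_splits)
qed (auto simp: holomorphic_on_HxV_const)

lemma theta_block_prod:
  fixes \<phi> :: "'n :: finite \<Rightarrow> complex \<Rightarrow> complex ^ 'n \<Rightarrow> complex"
  assumes "\<And>i. i \<in> A \<Longrightarrow> theta_block g {i} w s False (\<phi> i)"
  shows "theta_block g A (w * card A) (s * card A) False (\<lambda>\<tau> Z. \<Prod>i\<in>A. \<phi> i \<tau> Z)"
proof -
  have "finite A" by simp
  thus ?thesis using assms
  proof (induction A rule: finite_induct)
    case empty
    show ?case using theta_block_1 by simp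
  next
    case (insert i A)
    have "theta_block g ({i} \<union> A) (w + w * card A) (s + s * card A) (False \<or> False) (\<lambda>\<tau> Z. \<phi> i \<tau> Z * (\<Prod>i\<in>A. \<phi> i \<tau> Z))"
      using insert by (intro theta_block_mult) auto
    thus ?case using insert.hyps by simp
  qed
qed

lemma sum_axis: "(\<Sum>i\<in>UNIV. of_int ((axis j a :: int ^ 'n) $ i) * Z $ i) = of_int a * (Z $ j :: complex)"
proof -
  have "(\<Sum>i\<in>UNIV. of_int ((axis j a :: int ^ 'n) $ i) * Z $ i) = (\<Sum>i\<in>UNIV. if i = j then of_int a * Z $ i else 0)"
    by (intro sum.cong) (auto simp: axis_def)
  thus ?thesis by simp
qed

lemma fourier_term_axis: "fourier_term (m, axis j a) \<tau> Z = qpow \<tau> (of_int m / 24) * zpow (Z $ j) (2 * a)"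
  unfolding fourier_term_def fst_conv snd_conv sum_axis qpow_def zpow_def exp_add [symmetric]
  by (rule arg_cong[of _ _ exp]) (simp add: algebra_simps)

lemma admissible_axis:
  assumes "24 dvd m - int t" "of_int a ^ 2 / of_nat (g j) \<le> (of_int m / 12 :: real)"
    "cusp \<Longrightarrow> of_int a ^ 2 / of_nat (g j) < (of_int m / 12 :: real)"
  shows "admissible g {j} t cusp (m, axis j a)"
  using assms by (auto simp: admissible_def axis_def)

lemma square_mod_24:
  fixes n :: int
  assumes "n mod 6 = 1 \<or> n mod 6 = 5"
  shows "24 dvd n ^ 2 - 1"
proof -
  have "n mod 24 \<in> {1, 5, 7, 11, 13, 17, 19, 23}" using assms by auto presburger+
  hence "(n mod 24) ^ 2 mod 24 = 1" by auto
  hence "n ^ 2 mod 24 = 1 mod 24" by (simp add: power_mod)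
  thus ?thesis by (simp only: mod_eq_dvd_iff)
qed

text \<open>
  The argument \<open>2 Z\<^sub>j\<close> makes the exponents of the elliptic variable integral, whence periodicity under
  the whole lattice.
\<close>

lemma theta_block_jtheta:
  fixes j :: "'n :: finite"
  assumes "g j = 4"
  shows "theta_block g {j} 1 1 False (\<lambda>\<tau> Z. jtheta \<tau> (2 * Z $ j))"
  unfolding theta_block_def
proof (intro conjI allI impI)
  show "holomorphic_on_HxV (\<lambda>\<tau> Z :: complex ^ 'n. jtheta \<tau> (2 * Z $ j))"
    by (intro holomorphic_on_HxV_jtheta holomorphic_on_HxV_cmult holomorphic_on_HxV_coordinate)
  show "has_expansion g {j} (1 + 2 * 1) False (\<lambda>\<tau> Z. jtheta \<tau> (2 * Z $ j))"
  proof (rule has_expansionI[where c = parity_sign and p = "\<lambda>k. (3 * (2 * k + 1)\<^sup>2, axis j (2 * k + 1))"])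
    fix \<tau> :: complex and Z :: "complex ^ 'n" assume "Im \<tau> > 0"
    from jtheta_has_sum[OF this, of "2 * Z $ j"]
    show "((\<lambda>k. parity_sign k * fourier_term (3 * (2 * k + 1)\<^sup>2, axis j (2 * k + 1)) \<tau> Z) has_sum jtheta \<tau> (2 * Z $ j)) UNIV"
      unfolding fourier_term_axis by (simp add: zpow_def mult_ac)
  next
    fix k :: int
    have "24 dvd 3 * (2 * k + 1)\<^sup>2 - 3"
    proof -
      have "3 * (2 * k + 1)\<^sup>2 - 3 = 12 * (k * (k + 1))" by (simp add: power2_eq_square algebra_simps)
      also have "even (k * (k + 1))" by simp
      then obtain r where "k * (k + 1) = 2 * r" by (elim evenE)
      hence "12 * (k * (k + 1)) = 24 * r" by simp
      finally show ?thesis by simp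
    qed
    thus "admissible g {j} (1 + 2 * 1) False (3 * (2 * k + 1)\<^sup>2, axis j (2 * k + 1))"
      by (intro admissible_axis) (auto simp: assms)
  qed
  fix \<tau> and Z :: "complex ^ 'n" assume \<tau>: "Im \<tau> > 0"
  have "(inverse \<tau> *s Z) $ j * 2 = 2 * Z $ j / \<tau>" by (simp add: field_simps)
  thus "jtheta (- 1 / \<tau>) (2 * (inverse \<tau> *s Z) $ j) = csqrt (\<tau> / \<i>) ^ 1 * (- \<i>) ^ 1 *
           exp (of_real pi * \<i> * (\<Sum>i\<in>{j}. of_nat (g i) * (Z $ i)\<^sup>2) / \<tau>) * jtheta \<tau> (2 * Z $ j)"
    using jtheta_S_transform[OF \<tau>, of "2 * Z $ j"] by (simp add: assms mult_ac power_mult_distrib)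
qed

lemma quintuple_theta_has_sum:
  assumes "Im \<tau> > 0"
  shows "((\<lambda>n. (kronecker_12_half n + kronecker_12_half (- n)) * qpow \<tau> (of_int n ^ 2 / 24) * zpow z n) has_sum quintuple_theta \<tau> z) UNIV"
proof -
  define f where "f = (\<lambda>z n. kronecker_12_half n * exp (of_real pi * \<i> * (of_int n ^ 2 * (\<tau> / 12) + 2 * of_int n * (z / 2))))"
  have f: "(f z has_sum theta_12_half \<tau> z) UNIV" for z
    unfolding f_def theta_12_half_def by (intro theta_series_has_sum kronecker_12_half_bound) (use assms in auto)
  have "((\<lambda>n. f (- z) (- n)) has_sum theta_12_half \<tau> (- z)) UNIV \<longleftrightarrow> (f (- z) has_sum theta_12_half \<tau> (- z)) UNIV"
    by (rule has_sum_reindex_bij_witness[of _ uminus uminus]) auto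
  with f have "((\<lambda>n. f (- z) (- n)) has_sum theta_12_half \<tau> (- z)) UNIV" by simp
  from has_sum_add[OF f[of z] this]
  have "((\<lambda>n. f z n + f (- z) (- n)) has_sum quintuple_theta \<tau> z) UNIV" by (simp add: quintuple_theta_def)
  also have "(\<lambda>n. f z n + f (- z) (- n)) = (\<lambda>n. (kronecker_12_half n + kronecker_12_half (- n)) * qpow \<tau> (of_int n ^ 2 / 24) * zpow z n)"
  proof
    fix n :: int
    have "exp (of_real pi * \<i> * (of_int n ^ 2 * (\<tau> / 12) + 2 * of_int n * (z / 2))) = qpow \<tau> (of_int n ^ 2 / 24) * zpow z n"
      unfolding qpow_def zpow_def exp_add [symmetric] by (rule arg_cong[of _ _ exp]) (simp add: field_simps)
    thus "f z n + f (- z) (- n) = (kronecker_12_half n + kronecker_12_half (- n)) * qpow \<tau> (of_int n ^ 2 / 24) * zpow z n"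
      by (simp add: f_def algebra_simps)
  qed
  finally show ?thesis .
qed

lemma theta_block_quintuple_theta:
  fixes j :: "'n :: finite"
  assumes "g j = 12"
  shows "theta_block g {j} 1 0 False (\<lambda>\<tau> Z. quintuple_theta \<tau> (2 * Z $ j))"
  unfolding theta_block_def
proof (intro conjI allI impI)
  show "holomorphic_on_HxV (\<lambda>\<tau> Z :: complex ^ 'n. quintuple_theta \<tau> (2 * Z $ j))"
    by (intro holomorphic_on_HxV_quintuple_theta holomorphic_on_HxV_cmult holomorphic_on_HxV_coordinate)
  show "has_expansion g {j} (1 + 2 * 0) False (\<lambda>\<tau> Z. quintuple_theta \<tau> (2 * Z $ j))"
  proof (rule has_expansionI[where c = "\<lambda>n. kronecker_12_half n + kronecker_12_half (- n)" and p = "\<lambda>n. (n\<^sup>2, axis j n)"])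
    fix \<tau> :: complex and Z :: "complex ^ 'n" assume "Im \<tau> > 0"
    from quintuple_theta_has_sum[OF this, of "2 * Z $ j"]
    show "((\<lambda>n. (kronecker_12_half n + kronecker_12_half (- n)) * fourier_term (n\<^sup>2, axis j n) \<tau> Z) has_sum quintuple_theta \<tau> (2 * Z $ j)) UNIV"
      unfolding fourier_term_axis by (simp add: zpow_def mult_ac)
  next
    fix n assume "kronecker_12_half n + kronecker_12_half (- n) \<noteq> 0"
    hence "n mod 6 = 1 \<or> (- n) mod 6 = 1" by (auto simp: kronecker_12_half_def split: if_splits)
    hence "n mod 6 = 1 \<or> n mod 6 = 5" by presburger
    from square_mod_24[OF this] show "admissible g {j} (1 + 2 * 0) False (n\<^sup>2, axis j n)"
      by (intro admissible_axis) (auto simp: assms)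
  qed
  fix \<tau> and Z :: "complex ^ 'n" assume \<tau>: "Im \<tau> > 0"
  have "(inverse \<tau> *s Z) $ j * 2 = 2 * Z $ j / \<tau>" by (simp add: field_simps)
  thus "quintuple_theta (- 1 / \<tau>) (2 * (inverse \<tau> *s Z) $ j) = csqrt (\<tau> / \<i>) ^ 1 * (- \<i>) ^ 0 *
           exp (of_real pi * \<i> * (\<Sum>i\<in>{j}. of_nat (g i) * (Z $ i)\<^sup>2) / \<tau>) * quintuple_theta \<tau> (2 * Z $ j)"
    using quintuple_theta_S_transform[OF \<tau>, of "2 * Z $ j"] by (simp add: assms mult_ac power_mult_distrib)
qed

text \<open>
  The theta quark, which is up to normalisation the denominator function of the affine root system
  \<open>A\<^sub>2\<close>.
\<close>

definition theta_quark :: "complex \<Rightarrow> complex \<Rightarrow> complex \<Rightarrow> complex" where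
  "theta_quark \<tau> z w = jtheta \<tau> z * jtheta \<tau> w * jtheta \<tau> (z + w) * inverse (dedekind_eta \<tau>)"

lemma theta_quark_has_sum:
  assumes "Im \<tau> > 0"
  shows "((\<lambda>(l, m). parity_sign (l + m) * euler_coeff (l + m) * (qpow \<tau> (of_int (8 * (l\<^sup>2 - l * m + m\<^sup>2)) / 24) * zpow z (2 * l) * zpow w (2 * m))) has_sum
           theta_quark \<tau> z w) UNIV"
proof -
  define \<eta> where "\<eta> = dedekind_eta \<tau>"
  have "\<eta> \<noteq> 0" using eta_nonzero[OF assms] by (simp add: \<eta>_def)
  have "((\<lambda>x. (case x of (l, m) \<Rightarrow> parity_sign (l + m) * euler_coeff (l + m) * \<eta> *
             qpow \<tau> (of_int (l\<^sup>2 - l * m + m\<^sup>2) / 3) * zpow z (2 * l) * zpow w (2 * m)) * inverse \<eta>) has_sum theta_quark \<tau> z w) UNIV"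
    unfolding theta_quark_def \<eta>_def by (intro has_sum_cmult_left three_jtheta_has_sum assms)
  also have "(\<lambda>x. (case x of (l, m) \<Rightarrow> parity_sign (l + m) * euler_coeff (l + m) * \<eta> *
             qpow \<tau> (of_int (l\<^sup>2 - l * m + m\<^sup>2) / 3) * zpow z (2 * l) * zpow w (2 * m)) * inverse \<eta>) =
         (\<lambda>(l, m). parity_sign (l + m) * euler_coeff (l + m) * (qpow \<tau> (of_int (8 * (l\<^sup>2 - l * m + m\<^sup>2)) / 24) * zpow z (2 * l) * zpow w (2 * m)))"
  proof (rule ext, clarify)
    fix l m :: int
    have "(of_int (8 * (l\<^sup>2 - l * m + m\<^sup>2)) / 24 :: real) = of_int (l\<^sup>2 - l * m + m\<^sup>2) / 3" by simp
    hence q: "qpow \<tau> (of_int (8 * (l\<^sup>2 - l * m + m\<^sup>2)) / 24) = qpow \<tau> (of_int (l\<^sup>2 - l * m + m\<^sup>2) / 3)" by (simp only:)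
    have "a * b * \<eta> * c * d * e * inverse \<eta> = a * b * (c * d * e)" for a b c d e
      using \<open>\<eta> \<noteq> 0\<close> by (simp add: field_simps)
    thus "parity_sign (l + m) * euler_coeff (l + m) * \<eta> * qpow \<tau> (of_int (l\<^sup>2 - l * m + m\<^sup>2) / 3) * zpow z (2 * l) * zpow w (2 * m) * inverse \<eta> =
         parity_sign (l + m) * euler_coeff (l + m) * (qpow \<tau> (of_int (8 * (l\<^sup>2 - l * m + m\<^sup>2)) / 24) * zpow z (2 * l) * zpow w (2 * m))"
      unfolding q .
  qed
  finally show ?thesis .
qed

lemma theta_quark_S_transform:
  assumes "Im \<tau> > 0"
  shows "theta_quark (- 1 / \<tau>) (z / \<tau>) (w / \<tau>) = csqrt (\<tau> / \<i>) ^ 2 * (- \<i>) ^ 3 *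
           exp (of_real pi * \<i> * (z\<^sup>2 + w\<^sup>2 + (z + w)\<^sup>2) / \<tau>) * theta_quark \<tau> z w"
proof -
  define c where "c = csqrt (\<tau> / \<i>)"
  have "c \<noteq> 0" using assms by (auto simp: c_def)
  have zw: "z / \<tau> + w / \<tau> = (z + w) / \<tau>" by (simp add: add_divide_distrib)
  have e: "exp (of_real pi * \<i> * (z\<^sup>2 + w\<^sup>2 + (z + w)\<^sup>2) / \<tau>) =
      exp (of_real pi * \<i> * z\<^sup>2 / \<tau>) * exp (of_real pi * \<i> * w\<^sup>2 / \<tau>) * exp (of_real pi * \<i> * (z + w)\<^sup>2 / \<tau>)"
    unfolding exp_add [symmetric] by (rule arg_cong[of _ _ exp]) (simp add: algebra_simps add_divide_distrib)
  show ?thesis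
    unfolding theta_quark_def zw jtheta_S_transform[OF assms] eta_S_transform[OF assms] e c_def [symmetric]
    using \<open>c \<noteq> 0\<close> by (simp add: field_simps power2_eq_square power3_eq_cube)
qed

lemma holomorphic_on_HxV_theta_quark:
  assumes "holomorphic_on_HxV \<phi>" "holomorphic_on_HxV \<psi>"
  shows "holomorphic_on_HxV (\<lambda>\<tau> Z. theta_quark \<tau> (\<phi> \<tau> Z) (\<psi> \<tau> Z))"
  unfolding theta_quark_def
  by (intro holomorphic_on_HxV_mult holomorphic_on_HxV_jtheta holomorphic_on_HxV_add holomorphic_on_HxV_inverse_eta assms)

text \<open>
  Modulo 3 the form \<open>l\<^sup>2 - l m + m\<^sup>2\<close> is \<open>(l + m)\<^sup>2\<close>, and this is \<open>1\<close> on the support of the coefficients.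
\<close>

lemma theta_quark_exponent_mod:
  assumes "euler_coeff (l + m) \<noteq> 0"
  shows "24 dvd 8 * (l\<^sup>2 - l * m + m\<^sup>2) - 8"
proof -
  have "\<not> 3 dvd l + m" using assms by (auto simp: euler_coeff_def)
  hence "(l + m) mod 3 = 1 \<or> (l + m) mod 3 = 2" by presburger
  hence "((l + m) mod 3)\<^sup>2 mod 3 = 1" by auto
  hence "(l + m)\<^sup>2 mod 3 = 1 mod 3" by (simp add: power_mod)
  hence "3 dvd (l + m)\<^sup>2 - 1" by (simp only: mod_eq_dvd_iff)
  moreover have "l\<^sup>2 - l * m + m\<^sup>2 - 1 = ((l + m)\<^sup>2 - 1) - 3 * (l * m)"
    by (simp add: power2_eq_square algebra_simps)
  ultimately have "3 dvd l\<^sup>2 - l * m + m\<^sup>2 - 1" by (simp only: dvd_diff dvd_triv_left)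
  then obtain r where "l\<^sup>2 - l * m + m\<^sup>2 - 1 = 3 * r" by (elim dvdE)
  hence "8 * (l\<^sup>2 - l * m + m\<^sup>2) - 8 = 24 * r" by simp
  thus ?thesis by simp
qed

text \<open>
  On the line \<open>w = 2 z\<close> the hyperbolic norm of the term with indices \<open>l\<close> and \<open>m\<close> is \<open>(5 l - 4 m)\<^sup>2 / 42\<close>. If
  it vanishes, \<open>3\<close> divides \<open>l + m\<close> and the coefficient is zero.
\<close>

lemma theta_block_cuspidal_quark:
  fixes j :: "'n :: finite"
  assumes "g j = 14"
  shows "theta_block g {j} 2 3 True (\<lambda>\<tau> Z. theta_quark \<tau> (Z $ j) (2 * Z $ j))"
  unfolding theta_block_def
proof (intro conjI allI impI)
  show "holomorphic_on_HxV (\<lambda>\<tau> Z :: complex ^ 'n. theta_quark \<tau> (Z $ j) (2 * Z $ j))"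
    by (intro holomorphic_on_HxV_theta_quark holomorphic_on_HxV_cmult holomorphic_on_HxV_coordinate)
  show "has_expansion g {j} (2 + 2 * 3) True (\<lambda>\<tau> Z. theta_quark \<tau> (Z $ j) (2 * Z $ j))"
  proof (rule has_expansionI[where c = "\<lambda>(l, m). parity_sign (l + m) * euler_coeff (l + m)" and p = "\<lambda>(l, m). (8 * (l\<^sup>2 - l * m + m\<^sup>2), axis j (l + 2 * m))"])
    fix \<tau> :: complex and Z :: "complex ^ 'n" assume "Im \<tau> > 0"
    have "zpow (Z $ j) (2 * l) * zpow (2 * Z $ j) (2 * m) = zpow (Z $ j) (2 * (l + 2 * m))" for l m
      unfolding zpow_def exp_add [symmetric] by (rule arg_cong[of _ _ exp]) (simp add: algebra_simps)
    with theta_quark_has_sum[OF \<open>Im \<tau> > 0\<close>, of "Z $ j" "2 * Z $ j"]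
    show "((\<lambda>k. (case k of (l, m) \<Rightarrow> parity_sign (l + m) * euler_coeff (l + m)) * fourier_term (case k of (l, m) \<Rightarrow> (8 * (l\<^sup>2 - l * m + m\<^sup>2), axis j (l + 2 * m))) \<tau> Z)
             has_sum theta_quark \<tau> (Z $ j) (2 * Z $ j)) UNIV"
      unfolding case_prod_unfold fourier_term_axis by (simp only: mult.assoc)
  next
    fix k assume *: "(case k of (l, m) \<Rightarrow> parity_sign (l + m) * euler_coeff (l + m)) \<noteq> 0"
    obtain l m where k: "k = (l, m)" by (cases k)
    have ec: "euler_coeff (l + m) \<noteq> 0" using * by (auto simp: k)
    have "5 * l \<noteq> 4 * m"
    proof
      assume "5 * l = 4 * m"
      hence "3 dvd l + m" by presburger
      with ec show False by (simp add: euler_coeff_def)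
    qed
    hence "of_int (5 * l - 4 * m) \<noteq> (0 :: real)" by (simp only: of_int_eq_0_iff right_minus_eq) simp
    hence "0 < (of_int (5 * l - 4 * m) :: real)\<^sup>2 / 42" by simp
    also have "(of_int (5 * l - 4 * m) :: real)\<^sup>2 / 42 = of_int (8 * (l\<^sup>2 - l * m + m\<^sup>2)) / 12 - of_int (l + 2 * m) ^ 2 / 14"
      by (simp add: power2_eq_square field_simps)
    finally have "of_int (l + 2 * m) ^ 2 / 14 < (of_int (8 * (l\<^sup>2 - l * m + m\<^sup>2)) / 12 :: real)" by simp
    thus "admissible g {j} (2 + 2 * 3) True (case k of (l, m) \<Rightarrow> (8 * (l\<^sup>2 - l * m + m\<^sup>2), axis j (l + 2 * m)))"
      unfolding k prod.case using theta_quark_exponent_mod[OF ec] by (intro admissible_axis) (simp_all add: assms)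
  qed
  fix \<tau> and Z :: "complex ^ 'n" assume \<tau>: "Im \<tau> > 0"
  have 1: "(inverse \<tau> *s Z) $ j = Z $ j / \<tau>" "2 * (Z $ j / \<tau>) = (2 * Z $ j) / \<tau>" by (simp_all add: field_simps)
  have 2: "(\<Sum>i\<in>{j}. of_nat (g i) * (Z $ i)\<^sup>2) = (Z $ j)\<^sup>2 + (2 * Z $ j)\<^sup>2 + (Z $ j + 2 * Z $ j)\<^sup>2"
    by (simp add: assms power2_eq_square algebra_simps)
  show "theta_quark (- 1 / \<tau>) ((inverse \<tau> *s Z) $ j) (2 * (inverse \<tau> *s Z) $ j) = csqrt (\<tau> / \<i>) ^ 2 * (- \<i>) ^ 3 *
           exp (of_real pi * \<i> * (\<Sum>i\<in>{j}. of_nat (g i) * (Z $ i)\<^sup>2) / \<tau>) * theta_quark \<tau> (Z $ j) (2 * Z $ j)"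
    unfolding 1 2 by (rule theta_quark_S_transform[OF \<tau>])
qed

text \<open>
  The substitution \<open>z = x + y\<close>, \<open>w = x - y\<close> passes to a sublattice of \<open>A\<^sub>2\<close> on which the form is the
  diagonal form \<open>6 x\<^sup>2 + 2 y\<^sup>2\<close>.
\<close>

lemma theta_block_quark:
  fixes i j :: "'n :: finite"
  assumes "i \<noteq> j" "g i = 6" "g j = 2"
  shows "theta_block g {i, j} 2 3 False (\<lambda>\<tau> Z. theta_quark \<tau> (Z $ i + Z $ j) (Z $ i - Z $ j))"
  unfolding theta_block_def
proof (intro conjI allI impI)
  have minus: "Z $ i - Z $ j = Z $ i + (- 1) * Z $ j" for Z :: "complex ^ 'n" by simp
  show "holomorphic_on_HxV (\<lambda>\<tau> Z :: complex ^ 'n. theta_quark \<tau> (Z $ i + Z $ j) (Z $ i - Z $ j))"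
    unfolding minus by (intro holomorphic_on_HxV_theta_quark holomorphic_on_HxV_add holomorphic_on_HxV_cmult holomorphic_on_HxV_coordinate)
  show "has_expansion g {i, j} (2 + 2 * 3) False (\<lambda>\<tau> Z. theta_quark \<tau> (Z $ i + Z $ j) (Z $ i - Z $ j))"
  proof (rule has_expansionI[where c = "\<lambda>(l, m). parity_sign (l + m) * euler_coeff (l + m)" and
         p = "\<lambda>(l, m). (8 * (l\<^sup>2 - l * m + m\<^sup>2) + 0, axis i (l + m) + axis j (l - m))"])
    fix \<tau> :: complex and Z :: "complex ^ 'n" assume "Im \<tau> > 0"
    have "zpow (Z $ i + Z $ j) (2 * l) * zpow (Z $ i - Z $ j) (2 * m) = zpow (Z $ i) (2 * (l + m)) * zpow (Z $ j) (2 * (l - m))" for l m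
      unfolding zpow_def exp_add [symmetric] by (rule arg_cong[of _ _ exp]) (simp add: algebra_simps)
    with theta_quark_has_sum[OF \<open>Im \<tau> > 0\<close>, of "Z $ i + Z $ j" "Z $ i - Z $ j"]
    show "((\<lambda>k. (case k of (l, m) \<Rightarrow> parity_sign (l + m) * euler_coeff (l + m)) *
              fourier_term (case k of (l, m) \<Rightarrow> (8 * (l\<^sup>2 - l * m + m\<^sup>2) + 0, axis i (l + m) + axis j (l - m))) \<tau> Z)
             has_sum theta_quark \<tau> (Z $ i + Z $ j) (Z $ i - Z $ j)) UNIV"
      unfolding case_prod_unfold fourier_term_add fourier_term_axis by (simp only: mult.assoc) (simp add: mult_ac)
  next
    fix k assume *: "(case k of (l, m) \<Rightarrow> parity_sign (l + m) * euler_coeff (l + m)) \<noteq> 0"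
    obtain l m where k: "k = (l, m)" by (cases k)
    have ec: "euler_coeff (l + m) \<noteq> 0" using * by (auto simp: k)
    have "of_int (l + m) ^ 2 / 6 + of_int (l - m) ^ 2 / 2 = (of_int (8 * (l\<^sup>2 - l * m + m\<^sup>2)) / 12 :: real)"
      by (simp add: power2_eq_square field_simps)
    thus "admissible g {i, j} (2 + 2 * 3) False (case k of (l, m) \<Rightarrow> (8 * (l\<^sup>2 - l * m + m\<^sup>2) + 0, axis i (l + m) + axis j (l - m)))"
      unfolding k prod.case admissible_def using theta_quark_exponent_mod[OF ec] assms by (simp add: axis_def)
  qed
  fix \<tau> and Z :: "complex ^ 'n" assume \<tau>: "Im \<tau> > 0"
  have 1: "(inverse \<tau> *s Z) $ i + (inverse \<tau> *s Z) $ j = (Z $ i + Z $ j) / \<tau>" "(inverse \<tau> *s Z) $ i - (inverse \<tau> *s Z) $ j = (Z $ i - Z $ j) / \<tau>"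
    by (simp_all add: algebra_simps divide_inverse)
  have 2: "(\<Sum>i\<in>{i, j}. of_nat (g i) * (Z $ i)\<^sup>2) = (Z $ i + Z $ j)\<^sup>2 + (Z $ i - Z $ j)\<^sup>2 + ((Z $ i + Z $ j) + (Z $ i - Z $ j))\<^sup>2"
    using assms by (simp add: power2_eq_square algebra_simps)
  show "theta_quark (- 1 / \<tau>) ((inverse \<tau> *s Z) $ i + (inverse \<tau> *s Z) $ j) ((inverse \<tau> *s Z) $ i - (inverse \<tau> *s Z) $ j) = csqrt (\<tau> / \<i>) ^ 2 * (- \<i>) ^ 3 *
           exp (of_real pi * \<i> * (\<Sum>i\<in>{i, j}. of_nat (g i) * (Z $ i)\<^sup>2) / \<tau>) * theta_quark \<tau> (Z $ i + Z $ j) (Z $ i - Z $ j)"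
    unfolding 1 2 by (rule theta_quark_S_transform[OF \<tau>])
qed

section \<open>Diagonal lattices and the modular group\<close>

definition diagonal_gram :: "('n \<Rightarrow> nat) \<Rightarrow> int ^ 'n ^ 'n" where
  "diagonal_gram g = (\<chi> i j. if i = j then int (g i) else 0)"

lemma lform_diagonal: "lform (diagonal_gram g) v w = (\<Sum>i\<in>UNIV. of_nat (g i) * v $ i * w $ i)"
proof -
  have "(\<Sum>j\<in>UNIV. of_int (diagonal_gram g $ i $ j) * v $ i * w $ j) = (\<Sum>j\<in>UNIV. if j = i then of_nat (g i) * v $ i * w $ i else 0)" for i
    by (intro sum.cong) (auto simp: diagonal_gram_def)
  thus ?thesis unfolding lform_def by simp
qed

lemma pos_def_even_diagonal:
  fixes g :: "'n :: finite \<Rightarrow> nat"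
  assumes "\<And>i. g i > 0" "\<And>i. even (g i)"
  shows "pos_def_even_lattice (diagonal_gram g)"
  unfolding pos_def_even_lattice_def
proof (intro conjI allI impI)
  show "transpose (diagonal_gram g) = diagonal_gram g"
    by (auto simp: transpose_def diagonal_gram_def vec_eq_iff)
  show "lform (diagonal_gram g) x x > 0" if x: "x \<noteq> 0" for x :: "real ^ 'n"
  proof -
    obtain i where i: "x $ i \<noteq> 0" using x by (auto simp: vec_eq_iff)
    hence "of_nat (g i) * x $ i * x $ i > 0" using assms(1)[of i] by (auto simp: mult.assoc zero_less_mult_iff)
    thus ?thesis unfolding lform_diagonal
      by (intro sum_pos2[of UNIV i]) (auto simp: mult.assoc)
  qed
  show "even (lform (diagonal_gram g) x x)" for x :: "int ^ 'n"
    unfolding lform_diagonal using assms(2) by (intro dvd_sum) auto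
qed

definition transforms_under :: "int \<Rightarrow> (complex ^ 'n \<Rightarrow> complex) \<Rightarrow> (complex \<Rightarrow> complex ^ 'n \<Rightarrow> complex) \<Rightarrow> int \<Rightarrow> int \<Rightarrow> int \<Rightarrow> int \<Rightarrow> bool" where
  "transforms_under k Q \<phi> a b c d \<longleftrightarrow> (\<forall>\<tau> Z. Im \<tau> > 0 \<longrightarrow>
        \<phi> ((of_int a * \<tau> + of_int b) / (of_int c * \<tau> + of_int d)) (inverse (of_int c * \<tau> + of_int d) *s Z)
        = (of_int c * \<tau> + of_int d) powi k * exp (of_real pi * \<i> * (of_int c * Q Z / (of_int c * \<tau> + of_int d))) * \<phi> \<tau> Z)"

lemma automorphy_nonzero:
  fixes c d :: int
  assumes "Im \<tau> > 0" "c \<noteq> 0 \<or> d \<noteq> 0"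
  shows "of_int c * \<tau> + of_int d \<noteq> 0"
proof
  assume *: "of_int c * \<tau> + of_int d = 0"
  hence "Im (of_int c * \<tau> + of_int d) = 0" by simp
  hence "c = 0" using assms(1) by simp
  with * assms(2) show False by simp
qed

lemma transforms_under_T:
  assumes "transforms_under k Q \<phi> a b c d" and T: "\<And>\<tau> Z. Im \<tau> > 0 \<Longrightarrow> \<phi> (\<tau> + 1) Z = \<phi> \<tau> Z"
  shows "transforms_under k Q \<phi> a (b + a * m) c (d + c * m)"
  unfolding transforms_under_def
proof (intro allI impI)
  have nat: "\<phi> (\<tau> + of_nat r) Z = \<phi> \<tau> Z" if "Im \<tau> > 0" for \<tau> Z and r :: nat
  proof (induction r)
    case (Suc r)
    have "\<phi> ((\<tau> + of_nat r) + 1) Z = \<phi> (\<tau> + of_nat r) Z" by (rule T) (use that in simp)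
    with Suc show ?case by (simp add: add_ac)
  qed simp
  fix \<tau> Z assume \<tau>: "Im \<tau> > (0 :: real)"
  have shift: "\<phi> (\<tau> + of_int m) Z = \<phi> \<tau> Z"
  proof (cases m rule: int_cases2)
    case (nonneg r)
    thus ?thesis using nat[OF \<tau>] by simp
  next
    case (nonpos r)
    have "\<phi> ((\<tau> - of_nat r) + of_nat r) Z = \<phi> (\<tau> - of_nat r) Z" by (rule nat) (use \<tau> in simp)
    thus ?thesis using nonpos by simp
  qed
  have *: "of_int a * (\<tau> + of_int m) + of_int b = of_int a * \<tau> + of_int (b + a * m)"
    "of_int c * (\<tau> + of_int m) + of_int d = of_int c * \<tau> + of_int (d + c * m)" by (simp_all add: algebra_simps)
  have "Im (\<tau> + of_int m) > 0" using \<tau> by simp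
  with assms(1) have "\<phi> ((of_int a * (\<tau> + of_int m) + of_int b) / (of_int c * (\<tau> + of_int m) + of_int d)) (inverse (of_int c * (\<tau> + of_int m) + of_int d) *s Z)
        = (of_int c * (\<tau> + of_int m) + of_int d) powi k * exp (of_real pi * \<i> * (of_int c * Q Z / (of_int c * (\<tau> + of_int m) + of_int d))) * \<phi> (\<tau> + of_int m) Z"
    unfolding transforms_under_def by blast
  thus "\<phi> ((of_int a * \<tau> + of_int (b + a * m)) / (of_int c * \<tau> + of_int (d + c * m))) (inverse (of_int c * \<tau> + of_int (d + c * m)) *s Z)
        = (of_int c * \<tau> + of_int (d + c * m)) powi k * exp (of_real pi * \<i> * (of_int c * Q Z / (of_int c * \<tau> + of_int (d + c * m)))) * \<phi> \<tau> Z"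
    unfolding * shift .
qed

lemma transforms_under_S:
  fixes \<phi> :: "complex \<Rightarrow> complex ^ 'n \<Rightarrow> complex"
  assumes tr: "transforms_under k Q \<phi> a b c d" and cd: "c \<noteq> 0 \<or> d \<noteq> 0"
    and S: "\<And>\<tau> Z. Im \<tau> > 0 \<Longrightarrow> \<phi> (- 1 / \<tau>) (inverse \<tau> *s Z) = \<tau> powi k * exp (of_real pi * \<i> * Q Z / \<tau>) * \<phi> \<tau> Z"
    and Q: "\<And>r Z. Q (r *s Z) = r\<^sup>2 * Q Z"
  shows "transforms_under k Q \<phi> b (- a) d (- c)"
  unfolding transforms_under_def
proof (intro allI impI)
  fix \<tau> and Z :: "complex ^ 'n" assume \<tau>: "Im \<tau> > 0"
  hence nz: "\<tau> \<noteq> 0" by auto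
  define j where "j = of_int d * \<tau> + of_int (- c)"
  have j: "j \<noteq> 0" unfolding j_def by (rule automorphy_nonzero[OF \<tau>]) (use cd in auto)
  have e1: "of_int c * (- 1 / \<tau>) + of_int d = j / \<tau>" using nz by (simp add: j_def field_simps)
  have e2: "(of_int a * (- 1 / \<tau>) + of_int b) / (j / \<tau>) = (of_int b * \<tau> + of_int (- a)) / j"
    using nz j by (simp add: field_simps)
  have e3: "inverse (j / \<tau>) *s (inverse \<tau> *s Z) = inverse j *s Z"
  proof -
    have "inverse (j / \<tau>) * inverse \<tau> = inverse j" using nz by (simp add: inverse_eq_divide)
    thus ?thesis by (simp only: vector_smult_assoc)
  qed
  have "\<phi> ((of_int a * (- 1 / \<tau>) + of_int b) / (of_int c * (- 1 / \<tau>) + of_int d)) (inverse (of_int c * (- 1 / \<tau>) + of_int d) *s (inverse \<tau> *s Z))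
        = (of_int c * (- 1 / \<tau>) + of_int d) powi k * exp (of_real pi * \<i> * (of_int c * Q (inverse \<tau> *s Z) / (of_int c * (- 1 / \<tau>) + of_int d))) * \<phi> (- 1 / \<tau>) (inverse \<tau> *s Z)"
    using tr Im_minus_inverse[OF \<tau>] unfolding transforms_under_def by blast
  hence "\<phi> ((of_int b * \<tau> + of_int (- a)) / j) (inverse j *s Z) =
      (j / \<tau>) powi k * exp (of_real pi * \<i> * (of_int c * ((inverse \<tau>)\<^sup>2 * Q Z) / (j / \<tau>))) * (\<tau> powi k * exp (of_real pi * \<i> * Q Z / \<tau>) * \<phi> \<tau> Z)"
    unfolding e1 e2 e3 S[OF \<tau>] Q .
  also have "\<dots> = ((j / \<tau>) powi k * \<tau> powi k) * (exp (of_real pi * \<i> * (of_int c * ((inverse \<tau>)\<^sup>2 * Q Z) / (j / \<tau>))) * exp (of_real pi * \<i> * Q Z / \<tau>)) * \<phi> \<tau> Z"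
    by (simp only: mult_ac)
  also have "(j / \<tau>) powi k * \<tau> powi k = j powi k"
    using nz by (simp add: power_int_divide_distrib)
  also have "exp (of_real pi * \<i> * (of_int c * ((inverse \<tau>)\<^sup>2 * Q Z) / (j / \<tau>))) * exp (of_real pi * \<i> * Q Z / \<tau>) = exp (of_real pi * \<i> * (of_int d * Q Z / j))"
  proof -
    have "of_int c * ((inverse \<tau>)\<^sup>2 * Q Z) / (j / \<tau>) + Q Z / \<tau> = of_int d * Q Z / j"
    proof -
      have "of_int c * ((inverse \<tau>)\<^sup>2 * Q Z) / (j / \<tau>) + Q Z / \<tau> = (of_int c + j) * Q Z / (\<tau> * j)"
        using nz j by (simp add: field_simps power2_eq_square)
      also have "of_int c + j = of_int d * \<tau>" by (simp add: j_def)
      also have "of_int d * \<tau> * Q Z / (\<tau> * j) = of_int d * Q Z / j" using nz by simp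
      finally show ?thesis .
    qed
    hence "of_real pi * \<i> * (of_int c * ((inverse \<tau>)\<^sup>2 * Q Z) / (j / \<tau>)) + of_real pi * \<i> * Q Z / \<tau> = of_real pi * \<i> * (of_int d * Q Z / j)"
      by (metis distrib_left times_divide_eq_right)
    thus ?thesis by (simp only: exp_add [symmetric])
  qed
  finally show "\<phi> ((of_int b * \<tau> + of_int (- a)) / (of_int d * \<tau> + of_int (- c))) (inverse (of_int d * \<tau> + of_int (- c)) *s Z)
        = (of_int d * \<tau> + of_int (- c)) powi k * exp (of_real pi * \<i> * (of_int d * Q Z / (of_int d * \<tau> + of_int (- c)))) * \<phi> \<tau> Z"
    unfolding j_def .
qed

text \<open>
  The Euclidean algorithm on the lower row: a power of \<open>T\<close> reduces \<open>d\<close> modulo \<open>c\<close>, and \<open>S\<close> moves the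
  smaller entry to the place of \<open>c\<close>.
\<close>

lemma transforms_under_SL2:
  assumes S: "\<And>\<tau> Z. Im \<tau> > 0 \<Longrightarrow> \<phi> (- 1 / \<tau>) (inverse \<tau> *s Z) = \<tau> powi k * exp (of_real pi * \<i> * Q Z / \<tau>) * \<phi> \<tau> Z"
    and T: "\<And>\<tau> Z. Im \<tau> > 0 \<Longrightarrow> \<phi> (\<tau> + 1) Z = \<phi> \<tau> Z"
    and Q: "\<And>r Z. Q (r *s Z) = r\<^sup>2 * Q Z"
    and det: "a * d - b * c = 1"
  shows "transforms_under k Q \<phi> a b c d"
  using det
proof (induction "nat \<bar>c\<bar>" arbitrary: a b c d rule: less_induct)
  case less
  have S_step: "transforms_under k Q \<phi> b (- a) d (- c)" if "transforms_under k Q \<phi> a b c d" "c \<noteq> 0 \<or> d \<noteq> 0" for a b c d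
    using that by (rule transforms_under_S) (rule S Q; assumption?)+
  have T_step: "transforms_under k Q \<phi> a (b + a * m) c (d + c * m)" if "transforms_under k Q \<phi> a b c d" for a b c d m
    using that by (rule transforms_under_T) (rule T)
  have one: "transforms_under k Q \<phi> 1 0 0 1" by (simp add: transforms_under_def)
  show ?case
  proof (cases "c = 0")
    case True
    with less.prems have "a * d = 1" by simp
    hence "a = 1 \<and> d = 1 \<or> a = -1 \<and> d = -1" by (rule zmult_eq_1_iff[THEN iffD1])
    thus ?thesis
    proof
      assume ad: "a = 1 \<and> d = 1"
      show ?thesis using T_step[OF one, of b] ad True by simp
    next
      assume ad: "a = -1 \<and> d = -1"
      have "transforms_under k Q \<phi> 0 (- 1) 1 (- 0)" by (rule S_step[OF one]) simp
      hence "transforms_under k Q \<phi> (- 1) (- 0) (- 0) (- 1)" by (rule S_step) simp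
      from T_step[OF this, of "- b"] show ?thesis using ad True by simp
    qed
  next
    case False
    define m where "m = d div c"
    define b' where "b' = b - a * m"
    define d' where "d' = d - c * m"
    have d': "d' = d mod c" by (simp add: d'_def m_def minus_mult_div_eq_mod)
    have "\<bar>d'\<bar> < \<bar>c\<bar>" unfolding d' using False by (rule abs_mod_less)
    hence "nat \<bar>d'\<bar> < nat \<bar>c\<bar>" by simp
    moreover have "b' * (- c) - (- a) * d' = 1" using less.prems by (simp add: b'_def d'_def algebra_simps)
    ultimately have "transforms_under k Q \<phi> b' (- a) d' (- c)" by (rule less.hyps)
    \<comment> \<open>Three further inversions undo the one just applied, as \<open>S\<^sup>4 = 1\<close>.\<close>
    hence "transforms_under k Q \<phi> (- a) (- b') (- c) (- d')" by (rule S_step) (use False in simp)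
    hence "transforms_under k Q \<phi> (- b') (- (- a)) (- d') (- (- c))" by (rule S_step) (use False in simp)
    hence "transforms_under k Q \<phi> (- (- a)) (- (- b')) (- (- c)) (- (- d'))" by (rule S_step) (use False in simp)
    hence "transforms_under k Q \<phi> a b' c d'" by simp
    from T_step[OF this, of m] show ?thesis by (simp add: b'_def d'_def)
  qed
qed

section \<open>Jacobi cusp forms from blocks\<close>

lemma exp_int_multiple: "exp (2 * of_real pi * \<i> * of_int m) = (1 :: complex)"
  using exp_integer_2pi[of "of_int m"] by (simp add: mult_ac)

lemma expansion_invariant:
  assumes exp: "\<And>\<tau> Z. Im \<tau> > 0 \<Longrightarrow> ((\<lambda>k. f k * fourier_term k \<tau> Z) has_sum \<phi> \<tau> Z) UNIV"
    and "Im \<tau> > 0" "Im \<tau>' > 0" and eq: "\<And>k. f k \<noteq> 0 \<Longrightarrow> fourier_term k \<tau>' Z' = fourier_term k \<tau> Z"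
  shows "\<phi> \<tau>' Z' = \<phi> \<tau> Z"
proof -
  have "(\<lambda>k. f k * fourier_term k \<tau>' Z') = (\<lambda>k. f k * fourier_term k \<tau> Z)"
    using eq by (metis mult_zero_left)
  with exp[OF assms(2), of Z] exp[OF assms(3), of Z'] show ?thesis by (simp add: has_sum_unique)
qed

lemma fourier_term_tau_shift:
  assumes "24 dvd fst k"
  shows "fourier_term k (\<tau> + 1) Z = fourier_term k \<tau> Z"
proof -
  obtain r where r: "fst k = 24 * r" using assms by (elim dvdE)
  have "fourier_term k (\<tau> + 1) Z = fourier_term k \<tau> Z * exp (2 * of_real pi * \<i> * of_int r)"
    unfolding fourier_term_def exp_add [symmetric] by (rule arg_cong[of _ _ exp]) (simp add: r algebra_simps)
  thus ?thesis by (simp add: exp_int_multiple)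
qed

lemma fourier_term_Z_shift: "fourier_term k \<tau> (Z + vec_of_int y) = fourier_term k \<tau> Z"
proof -
  have "fourier_term k \<tau> (Z + vec_of_int y) = fourier_term k \<tau> Z * exp (2 * of_real pi * \<i> * of_int (\<Sum>i\<in>UNIV. snd k $ i * y $ i))"
    unfolding fourier_term_def exp_add [symmetric] by (rule arg_cong[of _ _ exp]) (simp add: vec_of_int_def algebra_simps sum.distrib)
  thus ?thesis by (simp only: exp_int_multiple mult_1_right)
qed

lemma dual_lattice_diagonal:
  fixes g :: "'n :: finite \<Rightarrow> nat"
  shows "l \<in> dual_lattice (diagonal_gram g) \<longleftrightarrow> (\<forall>i. of_nat (g i) * l $ i \<in> \<int>)"
proof
  assume l: "l \<in> dual_lattice (diagonal_gram g)"
  show "\<forall>i. of_nat (g i) * l $ i \<in> \<int>"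
  proof
    fix i
    have "lform (diagonal_gram g) l (vec_of_int (axis i 1)) \<in> \<int>"
      using l unfolding dual_lattice_def by blast
    also have "lform (diagonal_gram g) l (vec_of_int (axis i 1)) = (\<Sum>j\<in>UNIV. if j = i then of_nat (g i) * l $ i else 0)"
      unfolding lform_diagonal by (intro sum.cong) (auto simp: vec_of_int_def axis_def)
    finally show "of_nat (g i) * l $ i \<in> \<int>" by simp
  qed
next
  assume "\<forall>i. of_nat (g i) * l $ i \<in> \<int>"
  thus "l \<in> dual_lattice (diagonal_gram g)"
    unfolding dual_lattice_def lform_diagonal by (auto simp: vec_of_int_def intro!: Ints_sum Ints_mult[OF _ Ints_of_int])
qed

text \<open>
  For a trivial multiplier system the exponents are \<open>m = 24 n\<close>, and \<open>l\<close> corresponds to the dual vector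
  with coordinates \<open>l\<^sub>i / g\<^sub>i\<close>.
\<close>

lemma fourier_expansion_of_block:
  fixes g :: "'n :: finite \<Rightarrow> nat"
  assumes g: "\<And>i. g i > 0" and t: "24 dvd t"
    and exp: "\<And>\<tau> Z. Im \<tau> > 0 \<Longrightarrow> ((\<lambda>k. f k * fourier_term k \<tau> Z) has_sum \<phi> \<tau> Z) UNIV"
    and adm: "\<And>k. f k \<noteq> 0 \<Longrightarrow> admissible g UNIV t cusp k"
  defines "F \<equiv> \<lambda>n l. f (24 * int n, \<chi> i. \<lfloor>of_nat (g i) * l $ i\<rfloor>)"
  shows "has_jacobi_fourier_expansion (diagonal_gram g) \<phi> F"
    and "\<And>n l. (n, l) \<in> jacobi_index_set (diagonal_gram g) \<Longrightarrow> F n l \<noteq> 0 \<Longrightarrow> cusp \<Longrightarrow> 2 * real n - lform (diagonal_gram g) l l > 0"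
proof -
  define J where "J = jacobi_index_set (diagonal_gram g)"
  define K where "K = {k :: int \<times> (int ^ 'n). 24 dvd fst k \<and> fst k \<ge> 0 \<and> (\<Sum>i\<in>UNIV. of_int (snd k $ i) ^ 2 / of_nat (g i)) \<le> (of_int (fst k) / 12 :: real)}"
  define to_K where "to_K = (\<lambda>(n, l :: real ^ 'n). (24 * int n, (\<chi> i. \<lfloor>of_nat (g i) * l $ i\<rfloor>) :: int ^ 'n))"
  define to_J where "to_J = (\<lambda>(m, l). (nat (m div 24), (\<chi> i. of_int (l $ i) / of_nat (g i)) :: real ^ 'n))"
  have l_eq: "of_int \<lfloor>of_nat (g i) * l $ i\<rfloor> = of_nat (g i) * l $ i" if "(n, l) \<in> J" for n l i
    using that unfolding J_def jacobi_index_set_def by (auto simp: dual_lattice_diagonal)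
  have norm_eq: "(\<Sum>i\<in>UNIV. of_int (snd (to_K (n, l)) $ i) ^ 2 / of_nat (g i)) = lform (diagonal_gram g) l l" if "(n, l) \<in> J" for n l
    unfolding lform_diagonal to_K_def prod.case snd_conv
    by (intro sum.cong refl) (use g in \<open>simp add: l_eq[OF that] power2_eq_square\<close>)
  have f_K: "k \<in> K" if "f k \<noteq> 0" for k
  proof -
    have "24 dvd (fst k - int t) + int t"
      using adm[OF that] t unfolding admissible_def by (intro dvd_add) (auto simp: int_dvd_int_iff[of 24, simplified])
    moreover have "0 \<le> (\<Sum>i\<in>UNIV. of_int (snd k $ i) ^ 2 / of_nat (g i) :: real)" by (intro sum_nonneg) auto
    moreover have "\<dots> \<le> (of_int (fst k) / 12 :: real)" using adm[OF that] unfolding admissible_def by blast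
    ultimately show ?thesis unfolding K_def by auto
  qed
  show "has_jacobi_fourier_expansion (diagonal_gram g) \<phi> F"
    unfolding has_jacobi_fourier_expansion_def J_def [symmetric]
  proof (intro ballI allI)
    fix \<tau> and Z :: "complex ^ 'n" assume "\<tau> \<in> \<H>"
    hence \<tau>: "Im \<tau> > 0" by (simp add: upper_half_plane_def)
    from exp[OF \<tau>, of Z] have "((\<lambda>k. f k * fourier_term k \<tau> Z) has_sum \<phi> \<tau> Z) K"
      by (rule iffD1[OF has_sum_cong_neutral, rotated -1]) (use f_K in auto)
    also have "?this \<longleftrightarrow> ((\<lambda>(n, l). F n l * exp (2 * of_real pi * \<i> * (of_nat n * \<tau> + lform (diagonal_gram g) (vec_of_real l) Z))) has_sum \<phi> \<tau> Z) J"
    proof (rule has_sum_reindex_bij_witness[of _ to_K to_J])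
      fix k assume k: "k \<in> K"
      obtain m l where ml: "k = (m, l)" by (cases k)
      obtain n where n: "m = 24 * int n"
      proof -
        from k have "24 dvd m" "m \<ge> 0" by (auto simp: K_def ml)
        then obtain r where "m = 24 * r" "r \<ge> 0" by (auto elim!: dvdE)
        thus ?thesis using that[of "nat r"] by simp
      qed
      have J: "to_J k = (n, \<chi> i. of_int (l $ i) / of_nat (g i))" by (simp add: to_J_def ml n)
      show "to_K (to_J k) = k"
        unfolding J by (simp add: to_K_def ml n vec_eq_iff less_imp_neq[OF g, symmetric])
      have "lform (diagonal_gram g) (\<chi> i. of_int (l $ i) / of_nat (g i)) (\<chi> i. of_int (l $ i) / of_nat (g i)) =
              (\<Sum>i\<in>UNIV. of_int (l $ i) ^ 2 / of_nat (g i) :: real)"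
        unfolding lform_diagonal by (intro sum.cong refl) (simp add: less_imp_neq[OF g, symmetric] power2_eq_square)
      thus "to_J k \<in> J"
        using k unfolding J J_def jacobi_index_set_def by (simp add: K_def ml n dual_lattice_diagonal less_imp_neq[OF g, symmetric])
      have F: "F n (\<chi> i. of_int (l $ i) / of_nat (g i)) = f k"
        by (simp add: F_def ml n less_imp_neq[OF g, symmetric])
      have "lform (diagonal_gram g) (vec_of_real (\<chi> i. of_int (l $ i) / of_nat (g i))) Z = (\<Sum>i\<in>UNIV. of_int (l $ i) * Z $ i)"
        unfolding lform_diagonal by (intro sum.cong refl) (simp add: vec_of_real_def less_imp_neq[OF g, symmetric])
      thus "(case to_J k of (n, l) \<Rightarrow> F n l * exp (2 * of_real pi * \<i> * (of_nat n * \<tau> + lform (diagonal_gram g) (vec_of_real l) Z))) = f k * fourier_term k \<tau> Z"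
        unfolding J prod.case F by (simp add: fourier_term_def ml n)
    next
      fix x assume x: "x \<in> J"
      obtain n l where nl: "x = (n, l)" by (cases x)
      show "to_J (to_K x) = x"
      proof -
        have "(\<chi> i. of_int ((\<chi> i. \<lfloor>of_nat (g i) * l $ i\<rfloor>) $ i) / of_nat (g i)) = l"
          unfolding vec_eq_iff vec_lambda_beta l_eq[OF x[unfolded nl]] by (simp add: less_imp_neq[OF g, symmetric])
        thus ?thesis by (simp add: nl to_K_def to_J_def)
      qed
      have "lform (diagonal_gram g) l l \<le> 2 * real n" using x by (simp add: J_def jacobi_index_set_def nl)
      thus "to_K x \<in> K"
        unfolding K_def mem_Collect_eq nl norm_eq[OF x[unfolded nl]] by (simp add: to_K_def)
    qed simp
    finally show "((\<lambda>(n, l). F n l * exp (2 * of_real pi * \<i> * (of_nat n * \<tau> + lform (diagonal_gram g) (vec_of_real l) Z))) has_sum \<phi> \<tau> Z) J" .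
  qed
  fix n l assume nl: "(n, l) \<in> jacobi_index_set (diagonal_gram g)" and "F n l \<noteq> 0" cusp
  hence "f (to_K (n, l)) \<noteq> 0" by (simp add: F_def to_K_def)
  from adm[OF this] \<open>cusp\<close> have "(\<Sum>i\<in>UNIV. of_int (snd (to_K (n, l)) $ i) ^ 2 / of_nat (g i)) < (of_int (fst (to_K (n, l))) / 12 :: real)"
    unfolding admissible_def by blast
  thus "2 * real n - lform (diagonal_gram g) l l > 0"
    unfolding norm_eq[OF nl[folded J_def]] by (simp add: to_K_def)
qed

text \<open>
  Divisibility by 24 makes the multiplier system trivial. Translation by \<open>\<lambda> \<tau>\<close> becomes translation by \<open>\<lambda>\<close>
  after the inversion, and the function is periodic under the latter; comparing the two exponential
  factors of the inversion law gives the automorphy factor of the translation.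
\<close>

lemma jacobi_cusp_form_of_block:
  fixes g :: "'n :: finite \<Rightarrow> nat"
  assumes g: "\<And>i. g i > 0" and block: "theta_block g UNIV (2 * k) s True \<phi>" and t: "24 dvd 2 * k + 2 * s"
  shows "\<phi> \<in> jacobi_cusp_forms (int k) (diagonal_gram g)"
proof -
  define Q where "Q = (\<lambda>Z :: complex ^ 'n. lform (diagonal_gram g) Z Z)"
  have Q_sum: "Q Z = (\<Sum>i\<in>UNIV. of_nat (g i) * (Z $ i)\<^sup>2)" for Z
    unfolding Q_def lform_diagonal by (simp add: power2_eq_square mult.assoc)
  have Q_scale: "Q (r *s Z) = r\<^sup>2 * Q Z" for r Z
    unfolding Q_sum sum_distrib_left by (intro sum.cong refl) (simp add: power_mult_distrib)
  obtain f where f: "\<And>\<tau> Z. Im \<tau> > 0 \<Longrightarrow> ((\<lambda>k. f k * fourier_term k \<tau> Z) has_sum \<phi> \<tau> Z) UNIV"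
      "\<And>x. f x \<noteq> 0 \<Longrightarrow> admissible g UNIV (2 * k + 2 * s) True x"
    using block unfolding theta_block_def has_expansion_def by blast
  have S: "\<phi> (- 1 / \<tau>) (inverse \<tau> *s Z) = \<tau> powi int k * exp (of_real pi * \<i> * Q Z / \<tau>) * \<phi> \<tau> Z" if "Im \<tau> > 0" for \<tau> Z
  proof -
    have "\<phi> (- 1 / \<tau>) (inverse \<tau> *s Z) = csqrt (\<tau> / \<i>) ^ (2 * k) * (- \<i>) ^ s * exp (of_real pi * \<i> * Q Z / \<tau>) * \<phi> \<tau> Z"
      using block that unfolding theta_block_def Q_sum by blast
    also have "csqrt (\<tau> / \<i>) ^ (2 * k) * (- \<i>) ^ s = \<tau> ^ k"
    proof -
      obtain j where j: "2 * k + 2 * s = 24 * j" using t by (elim dvdE)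
      have "csqrt (\<tau> / \<i>) ^ (2 * k) = (\<tau> / \<i>) ^ k" by (simp only: power_mult power2_csqrt)
      also have "\<dots> = (\<tau> * (- \<i>)) ^ k" by (simp add: mult.commute)
      finally have "csqrt (\<tau> / \<i>) ^ (2 * k) * (- \<i>) ^ s = (\<tau> * (- \<i>)) ^ k * (- \<i>) ^ s" by (simp only:)
      also have "(\<tau> * (- \<i>)) ^ k * (- \<i>) ^ s = \<tau> ^ k * (- \<i>) ^ (k + s)"
        by (simp only: power_mult_distrib power_add mult.assoc)
      also have "k + s = 4 * (3 * j)" using j by simp
      also have "(- \<i>) ^ (4 * (3 * j)) = 1" by (simp add: power_mult)
      finally show ?thesis by simp
    qed
    finally show ?thesis unfolding power_int_of_nat .
  qed
  have T: "\<phi> (\<tau> + 1) Z = \<phi> \<tau> Z" if "Im \<tau> > 0" for \<tau> Z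
  proof (rule expansion_invariant[OF f(1) that])
    fix x assume "f x \<noteq> 0"
    hence "24 dvd (fst x - int (2 * k + 2 * s)) + int (2 * k + 2 * s)"
      using f(2)[of x] t unfolding admissible_def by (intro dvd_add) (auto simp only: int_dvd_int_iff[of 24, simplified])
    thus "fourier_term x (\<tau> + 1) Z = fourier_term x \<tau> Z" by (intro fourier_term_tau_shift) simp
  qed (use that in auto)
  have period: "\<phi> \<tau> (Z + vec_of_int y) = \<phi> \<tau> Z" if "Im \<tau> > 0" for \<tau> Z y
    by (rule expansion_invariant[OF f(1) that that fourier_term_Z_shift])
  have hol: "holomorphic_on_HxV \<phi>" using block unfolding theta_block_def by blast
  note F = fourier_expansion_of_block[OF g t f]
  have "\<phi> \<in> jacobi_forms (int k) (diagonal_gram g)"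
    unfolding jacobi_forms_def mem_Collect_eq
  proof (intro conjI allI impI ballI hol)
    fix a b c d :: int and \<tau> and Z :: "complex ^ 'n"
    assume "a * d - b * c = 1" "\<tau> \<in> \<H>"
    with transforms_under_SL2[of \<phi> "int k" Q, OF S T Q_scale]
    show "\<phi> ((of_int a * \<tau> + of_int b) / (of_int c * \<tau> + of_int d)) (inverse (of_int c * \<tau> + of_int d) *s Z)
        = (of_int c * \<tau> + of_int d) powi int k * exp (of_real pi * \<i> * (of_int c * lform (diagonal_gram g) Z Z / (of_int c * \<tau> + of_int d))) * \<phi> \<tau> Z"
      unfolding transforms_under_def Q_def upper_half_plane_def by blast
  next
    fix x y :: "int ^ 'n" and \<tau> and Z :: "complex ^ 'n" assume "\<tau> \<in> \<H>"
    hence \<tau>: "Im \<tau> > 0" by (simp add: upper_half_plane_def)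
    hence nz: "\<tau> \<noteq> 0" by auto
    define W where "W = Z + vec_of_int y"
    define B where "B = lform (diagonal_gram g) (vec_of_int x) W"
    have QW: "Q (W + \<tau> *s vec_of_int x) = Q W + 2 * \<tau> * B + \<tau>\<^sup>2 * of_int (lform (diagonal_gram g) x x)"
      unfolding Q_def B_def lform_diagonal
      by (simp add: vec_of_int_def sum_distrib_left sum.distrib [symmetric] power2_eq_square algebra_simps)
    have "inverse \<tau> *s (W + \<tau> *s vec_of_int x) = inverse \<tau> *s W + vec_of_int x"
      using nz by (simp add: vector_add_ldistrib vector_smult_assoc)
    hence "\<phi> (- 1 / \<tau>) (inverse \<tau> *s (W + \<tau> *s vec_of_int x)) = \<phi> (- 1 / \<tau>) (inverse \<tau> *s W)"
      by (simp only: period[OF Im_minus_inverse[OF \<tau>]])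
    hence "\<tau> powi int k * exp (of_real pi * \<i> * Q (W + \<tau> *s vec_of_int x) / \<tau>) * \<phi> \<tau> (W + \<tau> *s vec_of_int x) =
             \<tau> powi int k * exp (of_real pi * \<i> * Q W / \<tau>) * \<phi> \<tau> W"
      unfolding S[OF \<tau>] .
    moreover have "\<tau> powi int k \<noteq> 0" using nz by simp
    ultimately have "exp (of_real pi * \<i> * Q (W + \<tau> *s vec_of_int x) / \<tau>) * \<phi> \<tau> (W + \<tau> *s vec_of_int x) = exp (of_real pi * \<i> * Q W / \<tau>) * \<phi> \<tau> W"
      by (simp only: mult.assoc mult_cancel_left) simp
    moreover have "exp (of_real pi * \<i> * Q W / \<tau>) = exp (of_real pi * \<i> * Q (W + \<tau> *s vec_of_int x) / \<tau>) *
        exp (- (of_real pi * \<i> * (of_int (lform (diagonal_gram g) x x) * \<tau> + 2 * B)))"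
      unfolding exp_add [symmetric] QW by (rule arg_cong[of _ _ exp]) (use nz in \<open>simp add: field_simps power2_eq_square\<close>)
    ultimately have 1: "\<phi> \<tau> (W + \<tau> *s vec_of_int x) = exp (- (of_real pi * \<i> * (of_int (lform (diagonal_gram g) x x) * \<tau> + 2 * B))) * \<phi> \<tau> W"
      by (simp only: mult.assoc mult_cancel_left exp_not_eq_zero) simp
    have "B = lform (diagonal_gram g) (vec_of_int x) Z + of_int (lform (diagonal_gram g) x y)"
      unfolding B_def W_def lform_diagonal by (simp add: vec_of_int_def algebra_simps sum.distrib)
    hence "exp (- (of_real pi * \<i> * (of_int (lform (diagonal_gram g) x x) * \<tau> + 2 * B))) =
       exp (- (of_real pi * \<i> * (of_int (lform (diagonal_gram g) x x) * \<tau> + 2 * lform (diagonal_gram g) (vec_of_int x) Z))) *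
       exp (2 * of_real pi * \<i> * of_int (- lform (diagonal_gram g) x y))"
      unfolding exp_add [symmetric] by (intro arg_cong[of _ _ exp]) (simp add: algebra_simps)
    also have "exp (2 * of_real pi * \<i> * of_int (- lform (diagonal_gram g) x y)) = (1 :: complex)" by (rule exp_int_multiple)
    finally have 2: "exp (- (of_real pi * \<i> * (of_int (lform (diagonal_gram g) x x) * \<tau> + 2 * B))) =
       exp (- (of_real pi * \<i> * (of_int (lform (diagonal_gram g) x x) * \<tau> + 2 * lform (diagonal_gram g) (vec_of_int x) Z)))" by simp
    have "Z + \<tau> *s vec_of_int x + vec_of_int y = W + \<tau> *s vec_of_int x" by (simp add: W_def add_ac)
    thus "\<phi> \<tau> (Z + \<tau> *s vec_of_int x + vec_of_int y) =
       exp (- (of_real pi * \<i> * (of_int (lform (diagonal_gram g) x x) * \<tau> + 2 * lform (diagonal_gram g) (vec_of_int x) Z))) * \<phi> \<tau> Z"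
      using 1 2 period[OF \<tau>, of Z y] by (simp only: W_def)
  next
    show "\<exists>f. has_jacobi_fourier_expansion (diagonal_gram g) \<phi> f" using F(1) by blast
  qed
  thus ?thesis unfolding jacobi_cusp_forms_def using F by blast
qed

section \<open>Theta-products of critical weight\<close>

lemma entire_product_nonzero:
  assumes "f holomorphic_on UNIV" "g holomorphic_on UNIV" "f a \<noteq> 0" "g b \<noteq> (0 :: complex)"
  shows "\<exists>z. f z * g z \<noteq> 0"
  using entire_product_zero[OF assms(1-3)] assms(4) by blast

lemma cuspidal_quark_nonzero:
  assumes "Im \<tau> > 0"
  shows "\<exists>z. theta_quark \<tau> z (2 * z) \<noteq> 0"
proof -
  have hol: "(\<lambda>z. jtheta \<tau> (c * z)) holomorphic_on UNIV" for c
    by (intro jtheta_holomorphic assms holomorphic_intros)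
  have nz: "jtheta \<tau> (c * (- \<tau> / 3 / c)) \<noteq> 0" if "c \<noteq> 0" for c
    using jtheta_nonzero[OF assms] that by simp
  obtain b where b: "jtheta \<tau> (1 * b) * jtheta \<tau> (2 * b) \<noteq> 0"
    using entire_product_nonzero[OF hol[of 1] hol[of 2] nz[of 1] nz[of 2]] by auto
  obtain z where "jtheta \<tau> (1 * z) * jtheta \<tau> (2 * z) * jtheta \<tau> (3 * z) \<noteq> 0"
    using entire_product_nonzero[OF holomorphic_on_mult[OF hol[of 1] hol[of 2]] hol[of 3] b nz[of 3]] by auto
  moreover have "z + 2 * z = 3 * z" by simp
  ultimately have "theta_quark \<tau> z (2 * z) \<noteq> 0"
    using eta_nonzero[OF assms] by (simp add: theta_quark_def)
  thus ?thesis ..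
qed

lemma quark_nonzero:
  assumes "Im \<tau> > 0"
  shows "\<exists>x y. theta_quark \<tau> (x + y) (x - y) \<noteq> 0"
proof -
  define x where "x = - \<tau> / 6"
  have 1: "jtheta \<tau> (x + (- \<tau> / 3 - x)) \<noteq> 0" and 2: "jtheta \<tau> (x - (x - (- \<tau> / 3))) \<noteq> 0" and 3: "jtheta \<tau> (2 * x) \<noteq> 0"
    using jtheta_nonzero[OF assms] by (simp_all add: x_def)
  have "(\<lambda>y. jtheta \<tau> (x + y)) holomorphic_on UNIV" "(\<lambda>y. jtheta \<tau> (x - y)) holomorphic_on UNIV"
    by (intro jtheta_holomorphic assms holomorphic_intros)+
  from entire_product_nonzero[OF this 1 2] obtain y where "jtheta \<tau> (x + y) * jtheta \<tau> (x - y) \<noteq> 0" by blast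
  moreover have "(x + y) + (x - y) = 2 * x" by simp
  ultimately have "theta_quark \<tau> (x + y) (x - y) \<noteq> 0"
    using 3 eta_nonzero[OF assms] by (simp add: theta_quark_def)
  thus ?thesis by blast
qed

lemma linear_form_coordinate: "linear_form (\<lambda>Z. Z $ i)"
  and linear_form_scale: "linear_form (\<lambda>Z. c * Z $ i)"
  and linear_form_add: "linear_form \<l> \<Longrightarrow> linear_form \<l>' \<Longrightarrow> linear_form (\<lambda>Z. \<l> Z + \<l>' Z)"
  and linear_form_diff: "linear_form \<l> \<Longrightarrow> linear_form \<l>' \<Longrightarrow> linear_form (\<lambda>Z. \<l> Z - \<l>' Z)"
  unfolding linear_form_def Vector_Spaces.linear_iff
  by (auto simp: algebra_simps vec.vector_space_axioms vector_space_over_itself.vector_space_axioms)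

lemma theta_productI:
  fixes \<phi> :: "complex \<Rightarrow> complex ^ 'n \<Rightarrow> complex"
  assumes "\<And>\<l>. \<l> \<in> set ls \<Longrightarrow> linear_form \<l>" "\<And>\<l>. \<l> \<in> set ms \<Longrightarrow> linear_form \<l>"
    and "\<And>\<tau> Z. Im \<tau> > 0 \<Longrightarrow> \<phi> \<tau> Z = (\<Prod>\<l>\<leftarrow>ls. jtheta \<tau> (\<l> Z)) * (\<Prod>\<l>\<leftarrow>ms. quintuple_theta \<tau> (\<l> Z)) * dedekind_eta \<tau> powi e"
  shows "theta_product \<phi>"
  unfolding theta_product_def
proof (rule exI[of _ ls], rule exI[of _ ms], rule exI[of _ e], intro conjI ballI allI)
  show "linear_form \<l>" if "\<l> \<in> set ls \<union> set ms" for \<l> :: "complex ^ 'n \<Rightarrow> complex" using that assms(1,2) by blast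
  fix \<tau> and Z :: "complex ^ 'n" assume "\<tau> \<in> \<H>"
  hence \<tau>: "Im \<tau> > 0" by (simp add: upper_half_plane_def)
  show "\<phi> \<tau> Z = (\<Prod>\<l>\<leftarrow>ls. jtheta \<tau> (\<l> Z)) * (\<Prod>\<l>\<leftarrow>ms. jtheta_3_2 \<tau> (\<l> Z)) * dedekind_eta \<tau> powi e"
    unfolding jtheta_3_2_eq_quintuple_theta[OF \<tau>] by (rule assms(3)[OF \<tau>])
qed

lemma Im_ii_pos: "Im \<i> > 0" by simp

text \<open>
  Two quarks and a cuspidal quark: weight \<open>1 + 1 + 1\<close> and multiplier exponent \<open>8 + 8 + 8\<close>.
\<close>

lemma cusp_form_rank_5:
  assumes "CARD('n :: finite) = 5"
  shows "\<exists>(G :: int ^ 'n ^ 'n) \<phi>. pos_def_even_lattice G \<and> \<phi> \<in> jacobi_cusp_forms 3 G \<and> (\<exists>\<tau>\<in>\<H>. \<exists>Z. \<phi> \<tau> Z \<noteq> 0) \<and> theta_product \<phi>"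
proof -
  obtain xs where xs: "set xs = (UNIV :: 'n set)" "distinct xs" using finite_distinct_list[of "UNIV :: 'n set"] by auto
  have "length xs = 5" using distinct_card[OF xs(2)] xs(1) assms by simp
  then obtain a b c d e where abcde: "xs = [a, b, c, d, e]"
    by (auto simp: length_Suc_conv eval_nat_numeral)
  have dist: "distinct [a, b, c, d, e]" and univ: "UNIV = {a, b} \<union> {c, d} \<union> {e}"
    using xs unfolding abcde by auto
  define g where "g = (\<lambda>i. if i = e then 14 else if i \<in> {a, c} then 6 else 2 :: nat)"
  define \<phi> :: "complex \<Rightarrow> complex ^ 'n \<Rightarrow> complex" where
    "\<phi> = (\<lambda>\<tau> Z. theta_quark \<tau> (Z $ a + Z $ b) (Z $ a - Z $ b) * theta_quark \<tau> (Z $ c + Z $ d) (Z $ c - Z $ d) * theta_quark \<tau> (Z $ e) (2 * Z $ e))"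
  have "theta_block g ({a, b} \<union> {c, d} \<union> {e}) (2 + 2 + 2) (3 + 3 + 3) ((False \<or> False) \<or> True) \<phi>"
    unfolding \<phi>_def using dist
    by (intro theta_block_mult theta_block_quark theta_block_cuspidal_quark) (auto simp: g_def)
  hence block: "theta_block g UNIV (2 * 3) 9 True \<phi>" unfolding univ by simp
  have cusp: "\<phi> \<in> jacobi_cusp_forms (int 3) (diagonal_gram g)"
    by (rule jacobi_cusp_form_of_block[OF _ block]) (auto simp: g_def)
  have lattice: "pos_def_even_lattice (diagonal_gram g)"
    by (rule pos_def_even_diagonal) (auto simp: g_def)
  obtain x y where xy: "theta_quark \<i> (x + y) (x - y) \<noteq> 0" using quark_nonzero[OF Im_ii_pos] by blast
  obtain z where z: "theta_quark \<i> z (2 * z) \<noteq> 0" using cuspidal_quark_nonzero[OF Im_ii_pos] by blast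
  have "\<phi> \<i> (\<chi> i. if i = e then z else if i \<in> {a, c} then x else y) \<noteq> 0"
    using xy z dist by (auto simp: \<phi>_def)
  hence nonzero: "\<exists>\<tau>\<in>\<H>. \<exists>Z. \<phi> \<tau> Z \<noteq> 0" using Im_ii_pos unfolding upper_half_plane_def by blast
  define ls :: "(complex ^ 'n \<Rightarrow> complex) list" where
    "ls = [\<lambda>Z. Z $ a + Z $ b, \<lambda>Z. Z $ a - Z $ b, \<lambda>Z. (Z $ a + Z $ b) + (Z $ a - Z $ b),
           \<lambda>Z. Z $ c + Z $ d, \<lambda>Z. Z $ c - Z $ d, \<lambda>Z. (Z $ c + Z $ d) + (Z $ c - Z $ d),
           \<lambda>Z. Z $ e, \<lambda>Z. 2 * Z $ e, \<lambda>Z. Z $ e + 2 * Z $ e]"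
  have "theta_product \<phi>"
  proof (rule theta_productI[of ls "[]" _ "- 3"])
    show "linear_form \<l>" if "\<l> \<in> set ls" for \<l>
      using that unfolding ls_def
      by (auto intro!: linear_form_add linear_form_diff linear_form_coordinate linear_form_scale simp del: add_diff_cancel)
    show "\<phi> \<tau> Z = (\<Prod>\<l>\<leftarrow>ls. jtheta \<tau> (\<l> Z)) * (\<Prod>\<l>\<leftarrow>[]. quintuple_theta \<tau> (\<l> Z)) * dedekind_eta \<tau> powi - 3" if "Im \<tau> > 0" for \<tau> Z
    proof -
      have "dedekind_eta \<tau> powi - 3 = inverse (dedekind_eta \<tau>) ^ 3" by (simp add: power_int_minus power_inverse)
      thus ?thesis by (simp only: \<phi>_def ls_def theta_quark_def) (simp add: power3_eq_cube mult_ac)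
    qed
  qed auto
  with cusp lattice nonzero show ?thesis by auto
qed

text \<open>
  A cuspidal quark, \<open>b\<close> factors \<open>\<vartheta>\<close> and \<open>2 r - b\<close> factors \<open>\<vartheta>\<^sub>3\<^sub>/\<^sub>2\<close> have the multiplier exponent
  \<open>8 + 3 b + (2 r - b) = 2 (r + 4 + b)\<close>, so \<open>b\<close> has to be congruent to \<open>-(r + 4)\<close> modulo 12. Such a \<open>b \<le> 2 r\<close>
  exists for \<open>r \<ge> 3\<close>; for \<open>r = 2\<close> the least one is \<open>6\<close>, which is too large.
\<close>

lemma cusp_form_rank_ge_7:
  assumes "CARD('n :: finite) = 2 * r + 1" "r \<ge> 3"
  shows "\<exists>(G :: int ^ 'n ^ 'n) \<phi>. pos_def_even_lattice G \<and> \<phi> \<in> jacobi_cusp_forms (int r + 1) G \<and> (\<exists>\<tau>\<in>\<H>. \<exists>Z. \<phi> \<tau> Z \<noteq> 0) \<and> theta_product \<phi>"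
proof -
  obtain b where b: "b \<le> 2 * r" "12 dvd r + 4 + b"
  proof -
    \<comment> \<open>The residue of \<open>-(r + 4)\<close>, written without subtraction.\<close>
    define b where "b = (11 * (r + 4)) mod 12"
    have "12 dvd r + 4 + b" unfolding b_def by presburger
    moreover have "b \<le> 2 * r"
    proof (cases "r \<ge> 6")
      case False
      hence "r = 3 \<or> r = 4 \<or> r = 5" using assms(2) by linarith
      thus ?thesis by (auto simp: b_def)
    qed (simp add: b_def)
    ultimately show ?thesis using that by blast
  qed
  obtain e :: 'n where True by blast
  have card: "card (UNIV - {e}) = 2 * r" by (simp add: card_Diff_singleton assms)
  then obtain B where B: "B \<subseteq> UNIV - {e}" "card B = b" using b(1) obtain_subset_with_card_n by metis
  define C where "C = UNIV - {e} - B"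
  have card_C: "card C = 2 * r - b" unfolding C_def using B card by (simp add: card_Diff_subset)
  have disj: "e \<notin> B" "e \<notin> C" "B \<inter> C = {}" and univ: "UNIV = {e} \<union> B \<union> C" using B by (auto simp: C_def)
  define g where "g = (\<lambda>i. if i = e then 14 else if i \<in> B then 4 else 12 :: nat)"
  define \<phi> :: "complex \<Rightarrow> complex ^ 'n \<Rightarrow> complex" where
    "\<phi> = (\<lambda>\<tau> Z. theta_quark \<tau> (Z $ e) (2 * Z $ e) * (\<Prod>i\<in>B. jtheta \<tau> (2 * Z $ i)) * (\<Prod>i\<in>C. quintuple_theta \<tau> (2 * Z $ i)))"
  have "theta_block g ({e} \<union> B \<union> C) (2 + 1 * card B + 1 * card C) (3 + 1 * card B + 0 * card C) ((True \<or> False) \<or> False) \<phi>"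
    unfolding \<phi>_def using disj
    by (intro theta_block_mult theta_block_prod theta_block_cuspidal_quark theta_block_jtheta theta_block_quintuple_theta) (auto simp: g_def)
  hence block: "theta_block g UNIV (2 * (r + 1)) (3 + b) True \<phi>" unfolding univ using B(2) card_C b(1) by simp
  have "24 dvd 2 * (r + 1) + 2 * (3 + b)"
  proof -
    obtain q where "r + 4 + b = 12 * q" using b(2) by (elim dvdE)
    hence "2 * (r + 1) + 2 * (3 + b) = 24 * q" by simp
    thus ?thesis by simp
  qed
  hence cusp: "\<phi> \<in> jacobi_cusp_forms (int (r + 1)) (diagonal_gram g)"
    by (intro jacobi_cusp_form_of_block[OF _ block]) (auto simp: g_def)
  have lattice: "pos_def_even_lattice (diagonal_gram g)"
    by (rule pos_def_even_diagonal) (auto simp: g_def)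
  obtain z where z: "theta_quark \<i> z (2 * z) \<noteq> 0" using cuspidal_quark_nonzero[OF Im_ii_pos] by blast
  \<comment> \<open>\<open>2 Z\<^sub>i = -\<i> / 3\<close> is a point at which \<open>\<vartheta>(\<i>, \<cdot>)\<close> is known not to vanish, and \<open>\<vartheta>\<^sub>3\<^sub>/\<^sub>2(\<i>, 0) = 2 \<eta>(\<i>)\<close>.\<close>
  define Z :: "complex ^ 'n" where "Z = (\<chi> i. if i = e then z else if i \<in> B then - \<i> / 6 else 0)"
  have "jtheta \<i> (2 * Z $ i) \<noteq> 0" if "i \<in> B" for i
    using jtheta_nonzero[OF Im_ii_pos] that disj by (auto simp: Z_def)
  moreover have "quintuple_theta \<i> (2 * Z $ i) \<noteq> 0" if "i \<in> C" for i
  proof -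
    have "Z $ i = 0" using that disj by (auto simp: Z_def)
    thus ?thesis using quintuple_theta_0[OF Im_ii_pos] by simp
  qed
  ultimately have "\<phi> \<i> Z \<noteq> 0" using z by (simp add: \<phi>_def) (simp add: Z_def)
  hence nonzero: "\<exists>\<tau>\<in>\<H>. \<exists>Z. \<phi> \<tau> Z \<noteq> 0" using Im_ii_pos unfolding upper_half_plane_def by blast
  obtain bs where bs: "set bs = B" "distinct bs" using finite_distinct_list[of B] by auto
  obtain cs where cs: "set cs = C" "distinct cs" using finite_distinct_list[of C] by auto
  have "theta_product \<phi>"
  proof (rule theta_productI[of "[\<lambda>Z. Z $ e, \<lambda>Z. 2 * Z $ e, \<lambda>Z. Z $ e + 2 * Z $ e] @ map (\<lambda>i Z. 2 * Z $ i) bs"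
           "map (\<lambda>i Z. 2 * Z $ i) cs" _ "- 1"])
    show "linear_form \<l>" if "\<l> \<in> set ([\<lambda>Z. Z $ e, \<lambda>Z. 2 * Z $ e, \<lambda>Z. Z $ e + 2 * Z $ e] @ map (\<lambda>i Z. 2 * Z $ i) bs)" for \<l> :: "complex ^ 'n \<Rightarrow> complex"
      using that by (auto intro!: linear_form_add linear_form_coordinate linear_form_scale)
    show "linear_form \<l>" if "\<l> \<in> set (map (\<lambda>i Z. 2 * Z $ i) cs)" for \<l> :: "complex ^ 'n \<Rightarrow> complex"
      using that by (auto intro!: linear_form_scale)
    show "\<phi> \<tau> Z = (\<Prod>\<l>\<leftarrow>[\<lambda>Z. Z $ e, \<lambda>Z. 2 * Z $ e, \<lambda>Z. Z $ e + 2 * Z $ e] @ map (\<lambda>i Z. 2 * Z $ i) bs. jtheta \<tau> (\<l> Z)) *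
            (\<Prod>\<l>\<leftarrow>map (\<lambda>i Z. 2 * Z $ i) cs. quintuple_theta \<tau> (\<l> Z)) * dedekind_eta \<tau> powi - 1" for \<tau> Z
      unfolding \<phi>_def theta_quark_def bs(1) [symmetric] cs(1) [symmetric] prod.distinct_set_conv_list[OF bs(2)] prod.distinct_set_conv_list[OF cs(2)]
      by (simp add: o_def power_int_minus mult_ac)
  qed
  with cusp lattice nonzero show ?thesis by (auto simp: add_ac)
qed

theorem proposition3p11:
  fixes n :: nat
  assumes "CARD('n::finite) = n" and "odd n" and "n \<ge> 5"
  shows "\<exists>(G :: int ^ 'n ^ 'n) \<phi>.
           pos_def_even_lattice G \<and>
           \<phi> \<in> jacobi_cusp_forms ((int n + 1) div 2) G \<and>
           (\<exists>\<tau>\<in>\<H>. \<exists>Z. \<phi> \<tau> Z \<noteq> 0) \<and>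
           theta_product \<phi>"
proof (cases "n = 5")
  case True
  with cusp_form_rank_5 assms(1) show ?thesis by simp
next
  case False
  obtain r where r: "n = 2 * r + 1" using assms(2) by (elim oddE)
  have "CARD('n) = 2 * r + 1" "r \<ge> 3" using False assms r by simp_all
  from cusp_form_rank_ge_7[OF this] show ?thesis using r by (simp add: add_ac)
qed

end
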